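(* Let $T_n^{\rm sp}$ be a random split tree with $n$ balls and parameters $b,s,s_0,s_1,\mathcal V$, and suppose that $\mathbb P(V_1=1)=\mathbb P(V_1=0)=0$. Fix $c>0$ and perform Bernoulli bond percolation on $T_n^{\rm sp}$ with parameter $p_n=1-\frac{c}{\ln n}$. Let $\hat G_n$ be the number of balls in the percolation cluster containing the root. Then $$\lim_{n\to\infty}n^{-1}\hat G_n=e^{-\frac{c}{\mu}}\quad\text{in probability}.$$ Moreover, the root cluster is the unique giant component, i.e., $\lim_{n\to\infty}n^{-1}\hat G_n^{2\mathrm{nd}}=0$ in probability, where $\hat G_n^{2\mathrm{nd}}$ denotes the number of balls of the second largest percolation cluster.
   Context: Split trees. Let $b,s,s_0,s_1$ be integers with $b\ge 2$, $0<s$, $0\le s_0\le s$, $0\le bs_1\le s+1-s_0$, and let $\mathcal V=(V_1,\dots,V_b)$ be a random vector with $V_i\ge0$, $\sum_i V_i=1$, whose components are (standing assumption) identically distributed, so $\mathbb E[V_1]=1/b$. Let $\mathbb T$ be the infinite rooted $b$-ary tree; each vertex $u$ carries an independent copy $\mathcal V_u=(V_{u,1},\dots,V_{u,b})$ of $\mathcal V$. Place $n$ balls at the root and let $n_u$ denote the number of balls in the sub-tree rooted at $u$ (root: $n$). Recursively, given $n_u$ and $\mathcal V_u$: if $n_u\le s$ all $n_u$ balls are stored at $u$ and $n_{u_i}=0$ for all children $u_1,\dots,u_b$; if $n_u>s$, then $s_0$ balls are stored at $u$ and $(n_{u_1},\dots,n_{u_b})$ is distributed as $\mathrm{Mult}(n_u-s_0-bs_1,V_{u,1},\dots,V_{u,b})+(s_1,\dots,s_1)$.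 The split tree $T_n^{\rm sp}$ consists of all $u$ with $n_u>0$. Constant: $\mu=b\,\mathbb E[-V_1\ln V_1]$. Bernoulli bond percolation with parameter $p$: given the tree, each edge is removed with probability $1-p$, independently of the other edges; clusters are the resulting connected components ($n$ is taken large enough that $p_n\in[0,1]$). The size of a cluster is here its number of balls. *)

theory Defs
  imports "HOL-Probability.Probability" "HOL-Library.Sublist"
begin

text \<open>
  The law \<open>\<nu>\<close> of the split vector lives on the product space indexed by \<open>{..<b}\<close>, so the
  components \<open>V\<^sub>1, \<dots>, V\<^sub>b\<close> are numbered \<open>0, \<dots>, b - 1\<close> here.
\<close>

abbreviation split_space :: "nat \<Rightarrow> (nat \<Rightarrow> real) measure" where
  "split_space b \<equiv> PiM {..<b} (\<lambda>_. borel)"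

locale split_parameters =
  fixes b s s0 s1 :: nat and \<nu> :: "(nat \<Rightarrow> real) measure"
  assumes b_ge_2: "2 \<le> b"
    and s_pos: "0 < s"
    and s0_le: "s0 \<le> s"
    and s1_le: "b * s1 \<le> s + 1 - s0"
    and prob_space_split: "prob_space \<nu>"
    and sets_split: "sets \<nu> = sets (split_space b)"
    and split_nonneg: "AE v in \<nu>. \<forall>i<b. 0 \<le> v i"
    and split_sum: "AE v in \<nu>. (\<Sum>i<b. v i) = 1"
    and split_identically_distributed:
      "\<And>i. i < b \<Longrightarrow> distr \<nu> borel (\<lambda>v. v i) = distr \<nu> borel (\<lambda>v. v 0)"

definition split_mu :: "nat \<Rightarrow> (nat \<Rightarrow> real) measure \<Rightarrow> real" where
  "split_mu b \<nu> = real b * (\<integral>v. - v 0 * ln (v 0) \<partial>\<nu>)"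

definition multinomial_prob :: "nat \<Rightarrow> nat \<Rightarrow> (nat \<Rightarrow> real) \<Rightarrow> (nat \<Rightarrow> nat) \<Rightarrow> real" where
  "multinomial_prob b m v k =
     (if (\<Sum>i<b. k i) = m
      then fact m / (\<Prod>i<b. fact (k i)) * (\<Prod>i<b. v i ^ k i) else 0)"

text \<open>
  The probability that a vertex with \<open>m\<close> balls in its subtree and split vector \<open>v\<close> passes \<open>k i\<close>
  balls to its \<open>i\<close>-th child for every \<open>i < b\<close>. For \<open>m > s\<close> the subtraction does not truncate, by
  the constraint on \<open>s\<^sub>1\<close>.
\<close>

definition split_prob ::
    "nat \<Rightarrow> nat \<Rightarrow> nat \<Rightarrow> nat \<Rightarrow> nat \<Rightarrow> (nat \<Rightarrow> real) \<Rightarrow> (nat \<Rightarrow> nat) \<Rightarrow> real" where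
  "split_prob b s s0 s1 m v k =
     (if m \<le> s then (if \<forall>i<b. k i = 0 then 1 else 0)
      else if \<forall>i<b. s1 \<le> k i
           then multinomial_prob b (m - s0 - b * s1) v (\<lambda>i. k i - s1)
           else 0)"

definition balls_at :: "nat \<Rightarrow> nat \<Rightarrow> nat \<Rightarrow> nat" where
  "balls_at s s0 m = (if m \<le> s then m else s0)"

text \<open>
  Vertices of the infinite \<open>b\<close>-ary tree are words over \<open>{..<b}\<close>: the root is \<open>[]\<close> and the
  \<open>i\<close>-th child of \<open>u\<close> is \<open>u @ [i]\<close>.
\<close>

abbreviation vertices :: "nat \<Rightarrow> nat list set" where
  "vertices b \<equiv> lists {..<b}"

text \<open>
  The information given when the balls at \<open>u\<close> are split: all split vectors, and the ball counts of
  all vertices that are not proper descendants of \<open>u\<close>.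
\<close>

definition split_history ::
    "'a measure \<Rightarrow> nat \<Rightarrow> (nat list \<Rightarrow> 'a \<Rightarrow> nat \<Rightarrow> real) \<Rightarrow> (nat list \<Rightarrow> 'a \<Rightarrow> nat) \<Rightarrow>
       nat list \<Rightarrow> 'a measure" where
  "split_history M b V N u = sigma (space M)
     ({V w -` A \<inter> space M | w A. w \<in> vertices b \<and> A \<in> sets (split_space b)} \<union>
      {N w -` A \<inter> space M | w A. w \<in> vertices b \<and> \<not> strict_prefix u w})"

text \<open>
  \<open>V u\<close> is the split vector of \<open>u\<close> and \<open>N u\<close> is the number of balls in the subtree rooted at \<open>u\<close>.
  The assumption \<open>split_cond\<close> says that the children counts of \<open>u\<close> have the prescribed law
  conditionally on the history, a law which depends on the history only through \<open>N u\<close> and \<open>V u\<close>;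
  applied to the vertices generation by generation it determines the joint law of all counts.
\<close>

locale split_tree = prob_space M for M :: "'a measure" +
  fixes b s s0 s1 :: nat and \<nu> :: "(nat \<Rightarrow> real) measure" and n :: nat
    and V :: "nat list \<Rightarrow> 'a \<Rightarrow> nat \<Rightarrow> real"
    and N :: "nat list \<Rightarrow> 'a \<Rightarrow> nat"
  assumes split_indep: "indep_vars (\<lambda>_. split_space b) V (vertices b)"
    and split_law: "\<And>u. u \<in> vertices b \<Longrightarrow> distr M (split_space b) (V u) = \<nu>"
    and count_measurable: "\<And>u. u \<in> vertices b \<Longrightarrow> random_variable (count_space UNIV) (N u)"
    and count_root: "AE x in M. N [] x = n"
    and split_cond: "\<And>u k. u \<in> vertices b \<Longrightarrow>
      AE x in M. real_cond_exp M (split_history M b V N u)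
          (indicator {y \<in> space M. \<forall>i<b. N (u @ [i]) y = k i}) x
        = split_prob b s s0 s1 (N u x) (V u x) k"

text \<open>
  \<open>E u x\<close> says that the edge from \<open>u\<close> to its parent is kept. Edge variables are attached to all
  edges of the infinite tree, independently of the ball counts; only those of edges of the split
  tree matter below.
\<close>

locale percolated_split_tree = split_tree M b s s0 s1 \<nu> n V N
  for M :: "'a measure" and b s s0 s1 \<nu> n V N +
  fixes p :: real and E :: "nat list \<Rightarrow> 'a \<Rightarrow> bool"
  assumes edge_indep: "indep_vars (\<lambda>_. count_space UNIV) E (vertices b - {[]})"
    and edge_prob: "\<And>u. u \<in> vertices b - {[]} \<Longrightarrow> \<P>(x in M. E u x) = p"
    and edge_indep_tree: "indep_set
      (sigma_sets (space M) {N u -` A \<inter> space M | u A. u \<in> vertices b})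
      (sigma_sets (space M) {E u -` A \<inter> space M | u A. u \<in> vertices b - {[]}})"

text \<open>
  In the following, \<open>N\<close> and \<open>E\<close> are realisations of the ball counts and of the kept edges.
\<close>

definition tree_vertices :: "nat \<Rightarrow> (nat list \<Rightarrow> nat) \<Rightarrow> nat list set" where
  "tree_vertices b N = {u \<in> vertices b. N u > 0}"

definition kept_edges ::
    "nat \<Rightarrow> (nat list \<Rightarrow> nat) \<Rightarrow> (nat list \<Rightarrow> bool) \<Rightarrow> (nat list \<times> nat list) set" where
  "kept_edges b N E =
     {(u, u @ [i]) | u i. u \<in> tree_vertices b N \<and> u @ [i] \<in> tree_vertices b N \<and> E (u @ [i])}"

definition connection ::
    "nat \<Rightarrow> (nat list \<Rightarrow> nat) \<Rightarrow> (nat list \<Rightarrow> bool) \<Rightarrow> (nat list \<times> nat list) set" where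
  "connection b N E =
     {(u, w). u \<in> tree_vertices b N \<and> w \<in> tree_vertices b N \<and>
        (u, w) \<in> (kept_edges b N E \<union> (kept_edges b N E)\<inverse>)\<^sup>*}"

definition clusters ::
    "nat \<Rightarrow> (nat list \<Rightarrow> nat) \<Rightarrow> (nat list \<Rightarrow> bool) \<Rightarrow> nat list set set" where
  "clusters b N E = tree_vertices b N // connection b N E"

definition cluster_size ::
    "nat \<Rightarrow> nat \<Rightarrow> (nat list \<Rightarrow> nat) \<Rightarrow> nat list set \<Rightarrow> nat" where
  "cluster_size s s0 N C = (\<Sum>u\<in>C. balls_at s s0 (N u))"

definition root_cluster_size ::
    "nat \<Rightarrow> nat \<Rightarrow> nat \<Rightarrow> (nat list \<Rightarrow> nat) \<Rightarrow> (nat list \<Rightarrow> bool) \<Rightarrow> nat" where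
  "root_cluster_size b s s0 N E = cluster_size s s0 N (connection b N E `` {[]})"

text \<open>
  Sizes are ranked with multiplicity, and the second largest is \<open>0\<close> if there is only one cluster.
  The default values for infinite trees are irrelevant: if \<open>V\<^sub>1 < 1\<close> almost surely, then the split
  tree is almost surely finite.
\<close>

definition second_cluster_size ::
    "nat \<Rightarrow> nat \<Rightarrow> nat \<Rightarrow> (nat list \<Rightarrow> nat) \<Rightarrow> (nat list \<Rightarrow> bool) \<Rightarrow> nat" where
  "second_cluster_size b s s0 N E =
     (let sizes = rev (sorted_list_of_multiset
                        (image_mset (cluster_size s s0 N) (mset_set (clusters b N E))))
      in if length sizes < 2 then 0 else sizes ! 1)"

text \<open>The random variables may be defined on different probability spaces.\<close>

definition tendsto_in_probability ::
    "(nat \<Rightarrow> 'a measure) \<Rightarrow> (nat \<Rightarrow> 'a \<Rightarrow> real) \<Rightarrow> real \<Rightarrow> bool" where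
  "tendsto_in_probability M X L \<longleftrightarrow>
     (\<forall>\<^sub>F n in sequentially. X n \<in> borel_measurable (M n)) \<and>
     (\<forall>\<epsilon>>0. (\<lambda>n. \<P>(x in M n. \<bar>X n x - L\<bar> > \<epsilon>)) \<longlonglongrightarrow> 0)"

end

theory Submission
  imports Defs "HOL-Real_Asymp.Real_Asymp"
begin

text \<open>
  Let \<open>G\<close> and \<open>S\<close> be the sizes of the root cluster and of the second largest cluster, let \<open>X\<close> be the
  sum of the squares of all cluster sizes and \<open>L = exp (- c / \<mu>)\<close>. In every tree \<open>G\<^sup>2 + S\<^sup>2 \<le> X\<close>. So
  both claims follow from Chebyshev's inequality once \<open>liminf E G / n \<ge> L\<close> and
  \<open>limsup E X / n\<^sup>2 \<le> L\<^sup>2\<close>: the second moment of \<open>G / n - L\<close> is at most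
  \<open>E X / n\<^sup>2 - 2 L E G / n + L\<^sup>2\<close>, and that of \<open>S / n\<close> is at most \<open>E X / n\<^sup>2 - (E G / n)\<^sup>2\<close>
  (\<open>fraction_tail_bounds\<close>).

  Given the tree, a ball at depth \<open>k\<close> belongs to the root cluster with probability \<open>p ^ k\<close>. This is
  convex in \<open>k\<close>, so \<open>E G / n \<ge> p powr d\<close>, where \<open>d\<close> bounds the expected depth \<open>E D\<close> of a uniformly
  chosen ball (\<open>first_moment_ge\<close>). Balls at \<open>u\<close> and \<open>w\<close> share a cluster with probability
  \<open>p ^ (|u| + |w| - 2 k)\<close>, where \<open>k\<close> counts the common ancestors other than the root. This is at most
  \<open>(p ^ (2 |u|) + p ^ (2 |w|)) / 2 + 2 (1 - p) k\<close>, so that \<open>E X / n\<^sup>2\<close> is at most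
  \<open>E p ^ (2 D)\<close> plus \<open>2 (1 - p) / n\<^sup>2\<close> times the expected sum of the squares \<open>(N v)\<^sup>2\<close>
  (\<open>second_moment_le\<close>).

  What remains are three estimates on the tree alone: \<open>E D \<le> (1 + o(1)) ln n / \<mu>\<close>,
  \<open>limsup E p ^ (2 D) \<le> L\<^sup>2\<close>, and that the expected sum of the \<open>(N v)\<^sup>2\<close> is \<open>O(n\<^sup>2)\<close>. Each is about a
  sum over the tree of terms \<open>q ^ |u| * \<phi> (N u)\<close>, whose expectation obeys a recursion over one split.
  It is therefore at most \<open>f n\<close> for every supersolution \<open>f\<close> of the recursion
  (\<open>supersolution_bound\<close>), and suitable supersolutions are \<open>A m\<^sup>2\<close>, then
  \<open>(1 + e) / \<mu> * m ln m + A min (m\<^sup>2, K m)\<close>, and \<open>min (m, K powr \<delta> * m powr (1 - \<delta>))\<close> with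
  \<open>\<delta>\<close> close to \<open>2 c / (\<mu> ln n)\<close>. The exponent is dictated by
  \<open>b * E V\<^sub>1 powr (1 - \<delta>) = 1 + \<delta> \<mu> + O(\<delta>\<^sup>2)\<close>, which balances the loss \<open>p\<^sup>2 = 1 - 2 c / ln n + ...\<close>
  per generation, and \<open>n powr - \<delta>\<close> tends to \<open>L\<^sup>2\<close>.
\<close>

section \<open>Moments of the multinomial distribution\<close>

text \<open>
  Functions are extensional, so that there are only finitely many of them.
\<close>

definition compositions :: "nat \<Rightarrow> nat \<Rightarrow> (nat \<Rightarrow> nat) set" where
  "compositions b m = {k \<in> {..<b} \<rightarrow>\<^sub>E UNIV. (\<Sum>i<b. k i) = m}"

definition multinomial_mean ::
    "nat \<Rightarrow> nat \<Rightarrow> (nat \<Rightarrow> real) \<Rightarrow> ((nat \<Rightarrow> nat) \<Rightarrow> real) \<Rightarrow> real" where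
  "multinomial_mean b m v f = (\<Sum>k\<in>compositions b m. multinomial_prob b m v k * f k)"

lemma component_le_sum_nat: "i < (b::nat) \<Longrightarrow> (k::nat \<Rightarrow> nat) i \<le> (\<Sum>i<b. k i)"
  by (simp add: member_le_sum)

lemma finite_compositions: "finite (compositions b m)"
proof (rule finite_subset)
  show "compositions b m \<subseteq> {..<b} \<rightarrow>\<^sub>E {..m}"
  proof
    fix k assume "k \<in> compositions b m"
    then have k: "k \<in> {..<b} \<rightarrow>\<^sub>E UNIV" and sum: "(\<Sum>i<b. k i) = m"
      unfolding compositions_def by blast+
    have "k i \<le> m" if "i < b" for i
      using component_le_sum_nat[OF that, of k] unfolding sum .
    with k show "k \<in> {..<b} \<rightarrow>\<^sub>E {..m}" by (simp add: PiE_iff)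
  qed
  show "finite ({..<b} \<rightarrow>\<^sub>E {..m})" by (intro finite_PiE) auto
qed

lemma sum_fun_upd_Suc:
  "i < (b::nat) \<Longrightarrow> (\<Sum>j<b. (k(i := Suc (k i))) j) = Suc (\<Sum>j<b. k j)"
proof -
  assume i: "i < b"
  have "(\<Sum>j<b. (k(i := Suc (k i))) j) = Suc (k i) + (\<Sum>j\<in>{..<b} - {i}. k j)"
    using i by (subst sum.remove[of _ i]) auto
  moreover have "(\<Sum>j<b. k j) = k i + (\<Sum>j\<in>{..<b} - {i}. k j)"
    using i by (subst sum.remove[of _ i]) auto
  ultimately show ?thesis by simp
qed

lemma multinomial_prob_Suc:
  assumes i: "i < b" and k: "(\<Sum>j<b. k j) = m"
  shows "multinomial_prob b (Suc m) v (k(i := Suc (k i))) * real (Suc (k i))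
           = real (Suc m) * v i * multinomial_prob b m v k"
proof -
  let ?I = "{..<b} - {i}"
  have 1: "(\<Prod>j<b. fact ((k(i := Suc (k i))) j) :: real) = fact (Suc (k i)) * (\<Prod>j\<in>?I. fact (k j))"
    using i by (subst prod.remove[of _ i]) (auto intro!: prod.cong)
  have 2: "(\<Prod>j<b. v j ^ (k(i := Suc (k i))) j) = v i ^ Suc (k i) * (\<Prod>j\<in>?I. v j ^ k j)"
    using i by (subst prod.remove[of _ i]) (auto intro!: prod.cong)
  have 3: "(\<Prod>j<b. fact (k j) :: real) = fact (k i) * (\<Prod>j\<in>?I. fact (k j))"
    using i by (subst prod.remove[of _ i]) auto
  have 4: "(\<Prod>j<b. v j ^ k j) = v i ^ k i * (\<Prod>j\<in>?I. v j ^ k j)"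
    using i by (subst prod.remove[of _ i]) auto
  have 5: "(\<Prod>j\<in>?I. fact (k j) :: real) \<noteq> 0" by simp
  have 6: "(\<Sum>j<b. (k(i := Suc (k i))) j) = Suc m" using sum_fun_upd_Suc[OF i, of k] k by simp
  show ?thesis
    unfolding multinomial_prob_def 6 k 1 2 3 4
    using 5 by (simp add: field_simps del: of_nat_Suc)
qed

text \<open>
  Weighting by \<open>k i\<close> amounts to adding one forced ball in box \<open>i\<close> to a throw of \<open>m\<close> balls. Every moment
  of the multinomial law below, even its total mass, is extracted from this identity.
\<close>

lemma multinomial_mean_size_bias:
  assumes i: "i < b"
  shows "multinomial_mean b (Suc m) v (\<lambda>k. real (k i) * f k)
           = real (Suc m) * v i * multinomial_mean b m v (\<lambda>k. f (k(i := Suc (k i))))"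
proof -
  define T where "T = (\<lambda>k::nat \<Rightarrow> nat. k(i := Suc (k i)))"
  let ?g = "\<lambda>k. multinomial_prob b (Suc m) v k * (real (k i) * f k)"
  have inj: "inj_on T (compositions b m)"
  proof (rule inj_onI)
    fix k l assume eq: "T k = T l"
    have "k j = l j" for j
      using fun_cong[OF eq, of j] by (cases "j = i") (simp_all add: T_def)
    then show "k = l" by (rule ext)
  qed
  have img: "T ` compositions b m = {k \<in> compositions b (Suc m). k i \<noteq> 0}"
  proof (intro equalityI subsetI)
    fix k assume "k \<in> T ` compositions b m"
    then obtain l where l: "l \<in> compositions b m" "k = T l" by auto
    then show "k \<in> {k \<in> compositions b (Suc m). k i \<noteq> 0}"
      using i sum_fun_upd_Suc[OF i, of l]
      by (simp add: T_def compositions_def PiE_iff extensional_def del: fun_upd_apply) simp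
  next
    fix k assume k: "k \<in> {k \<in> compositions b (Suc m). k i \<noteq> 0}"
    define l where "l = k(i := k i - 1)"
    have kl: "k = T l" using k by (auto simp: l_def T_def)
    have "(\<Sum>j<b. l j) = m" using sum_fun_upd_Suc[OF i, of l] k kl unfolding T_def compositions_def by simp
    moreover have "l \<in> {..<b} \<rightarrow>\<^sub>E UNIV" using k i by (auto simp: l_def compositions_def PiE_iff extensional_def)
    ultimately show "k \<in> T ` compositions b m" using kl by (auto simp: compositions_def)
  qed
  have "multinomial_mean b (Suc m) v (\<lambda>k. real (k i) * f k) = sum ?g (compositions b (Suc m))"
    by (simp add: multinomial_mean_def)
  also have "\<dots> = sum ?g (T ` compositions b m)"
    unfolding img by (intro sum.mono_neutral_right) (auto simp: finite_compositions)
  also have "\<dots> = (\<Sum>k\<in>compositions b m. ?g (T k))"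
    by (simp add: sum.reindex[OF inj])
  also have "\<dots> = (\<Sum>k\<in>compositions b m. real (Suc m) * v i * (multinomial_prob b m v k * f (T k)))"
  proof (intro sum.cong refl)
    fix k assume "k \<in> compositions b m"
    then have k: "(\<Sum>j<b. k j) = m" by (simp add: compositions_def)
    have "?g (T k) = (multinomial_prob b (Suc m) v (k(i := Suc (k i))) * real (Suc (k i))) * f (T k)"
      by (simp add: T_def)
    then show "?g (T k) = real (Suc m) * v i * (multinomial_prob b m v k * f (T k))"
      unfolding multinomial_prob_Suc[OF i k] by simp
  qed
  finally show ?thesis by (simp add: multinomial_mean_def sum_distrib_left T_def)
qed

lemma multinomial_mean_add:
  "multinomial_mean b m v (\<lambda>k. f k + g k) = multinomial_mean b m v f + multinomial_mean b m v g"
  unfolding multinomial_mean_def distrib_left sum.distrib ..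

lemma multinomial_mean_cmult:
  "multinomial_mean b m v (\<lambda>k. c * f k) = c * multinomial_mean b m v f"
  unfolding multinomial_mean_def sum_distrib_left mult.left_commute[of _ c] ..

lemma multinomial_mean_sum:
  "multinomial_mean b m v (\<lambda>k. \<Sum>i\<in>I. f i k) = (\<Sum>i\<in>I. multinomial_mean b m v (f i))"
  unfolding multinomial_mean_def sum_distrib_left by (rule sum.swap)

lemma multinomial_prob_nonneg:
  assumes "\<And>i. i < b \<Longrightarrow> 0 \<le> v i"
  shows "0 \<le> multinomial_prob b m v k"
proof -
  have "0 \<le> (\<Prod>i<b. v i ^ k i)" by (rule prod_nonneg) (use assms in simp)
  moreover have "0 \<le> (\<Prod>i<b. fact (k i) :: real)" by (rule prod_nonneg) simp
  ultimately show ?thesis by (simp add: multinomial_prob_def del: of_nat_Suc)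
qed

lemma multinomial_mean_mono:
  assumes "\<And>i. i < b \<Longrightarrow> 0 \<le> v i"
    and "\<And>k. k \<in> compositions b m \<Longrightarrow> f k \<le> g k"
  shows "multinomial_mean b m v f \<le> multinomial_mean b m v g"
  unfolding multinomial_mean_def
  by (intro sum_mono mult_left_mono assms multinomial_prob_nonneg) auto

lemma multinomial_mean_cong:
  assumes "\<And>k. k \<in> compositions b m \<Longrightarrow> f k = g k"
  shows "multinomial_mean b m v f = multinomial_mean b m v g"
  unfolding multinomial_mean_def using assms by (intro sum.cong) auto

context
  fixes b :: nat and v :: "nat \<Rightarrow> real"
  assumes nonneg: "\<And>i. i < b \<Longrightarrow> 0 \<le> v i" and total: "(\<Sum>i<b. v i) = 1"
begin

text \<open>
  By induction on \<open>m\<close>: the coordinates sum to \<open>m + 1\<close>, and by the size bias identity each of them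
  contributes \<open>(m + 1) v\<^sub>i\<close> times the total mass for \<open>m\<close>.
\<close>

lemma multinomial_mean_const: "multinomial_mean b m v (\<lambda>_. c) = c"
proof -
  have "multinomial_mean b m v (\<lambda>_. 1) = 1"
  proof (induction m)
    case 0
    have "compositions b 0 = {\<lambda>i\<in>{..<b}. 0}"
      by (auto simp: compositions_def PiE_iff extensional_def fun_eq_iff)
    then show ?case by (simp add: multinomial_mean_def multinomial_prob_def)
  next
    case (Suc m)
    have "real (Suc m) * multinomial_mean b (Suc m) v (\<lambda>_. 1)
        = multinomial_mean b (Suc m) v (\<lambda>k. \<Sum>i<b. real (k i) * 1)"
      unfolding multinomial_mean_cmult[symmetric]
      by (intro multinomial_mean_cong)
         (simp add: compositions_def flip: of_nat_sum)
    also have "\<dots> = (\<Sum>i<b. real (Suc m) * v i * multinomial_mean b m v (\<lambda>_. 1))"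
      unfolding multinomial_mean_sum by (intro sum.cong refl multinomial_mean_size_bias) auto
    also have "\<dots> = real (Suc m)"
      using Suc total by (simp flip: sum_distrib_left)
    finally show ?case by (simp del: of_nat_Suc)
  qed
  then show ?thesis using multinomial_mean_cmult[of b m v c "\<lambda>_. 1"] by simp
qed

lemma multinomial_mean_component:
  assumes "i < b" shows "multinomial_mean b m v (\<lambda>k. real (k i)) = real m * v i"
proof (cases m)
  case 0
  have "multinomial_mean b m v (\<lambda>k. real (k i)) = multinomial_mean b m v (\<lambda>k. 0)"
  proof (rule multinomial_mean_cong)
    fix k assume "k \<in> compositions b m"
    then have "k i \<le> 0" using component_le_sum_nat[OF assms, of k] 0 by (simp only: compositions_def) simp
    then show "real (k i) = 0" by simp
  qed
  then show ?thesis unfolding multinomial_mean_const by (simp add: 0)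
next
  case (Suc m')
  then show ?thesis
    using multinomial_mean_size_bias[OF assms, of m' v "\<lambda>_. 1"] by (simp add: multinomial_mean_const)
qed

lemma multinomial_mean_component_square:
  assumes "i < b"
  shows "multinomial_mean b m v (\<lambda>k. (real (k i))\<^sup>2) = real m * v i + real m * (real m - 1) * (v i)\<^sup>2"
proof (cases m)
  case 0
  have "multinomial_mean b m v (\<lambda>k. (real (k i))\<^sup>2) = multinomial_mean b m v (\<lambda>k. 0)"
  proof (rule multinomial_mean_cong)
    fix k assume "k \<in> compositions b m"
    then have "k i \<le> 0" using component_le_sum_nat[OF assms, of k] 0 by (simp only: compositions_def) simp
    then show "(real (k i))\<^sup>2 = 0" by simp
  qed
  then show ?thesis unfolding multinomial_mean_const by (simp add: 0)
next
  case (Suc m')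
  have "multinomial_mean b m v (\<lambda>k. (real (k i))\<^sup>2)
      = real (Suc m') * v i * multinomial_mean b m' v (\<lambda>k. real ((k(i := Suc (k i))) i))"
    unfolding Suc power2_eq_square by (rule multinomial_mean_size_bias[OF assms])
  also have "(\<lambda>k. real ((k(i := Suc (k i))) i)) = (\<lambda>k. 1 + real (k i))" by (rule ext) simp
  also have "multinomial_mean b m' v (\<lambda>k. 1 + real (k i)) = 1 + real m' * v i"
    unfolding multinomial_mean_add multinomial_mean_const multinomial_mean_component[OF assms] ..
  finally show ?thesis unfolding Suc by (simp add: power2_eq_square algebra_simps)
qed

text \<open>
  Jensen, through the tangent of the logarithm at the mean of \<open>a + k i\<close>.
\<close>

lemma multinomial_mean_ln_le:
  assumes "i < b" "0 < a"
  shows "multinomial_mean b m v (\<lambda>k. ln (a + real (k i))) \<le> ln (a + real m * v i)"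
proof -
  define x where "x = a + real m * v i"
  have x: "0 < x" using assms nonneg[of i] unfolding x_def by (intro add_pos_nonneg) auto
  have "multinomial_mean b m v (\<lambda>k. ln (a + real (k i)))
      \<le> multinomial_mean b m v (\<lambda>k. (ln x + (a - x) / x) + 1 / x * real (k i))"
  proof (rule multinomial_mean_mono[OF nonneg])
    fix k :: "nat \<Rightarrow> nat"
    have "ln ((a + real (k i)) / x) \<le> (a + real (k i)) / x - 1"
      using x assms by (intro ln_le_minus_one) simp
    then show "ln (a + real (k i)) \<le> ln x + (a - x) / x + 1 / x * real (k i)"
      using x assms by (simp add: ln_div field_simps)
  qed
  also have "\<dots> = (ln x + (a - x) / x) + 1 / x * (real m * v i)"
    unfolding multinomial_mean_add multinomial_mean_cmult
    unfolding multinomial_mean_const multinomial_mean_component[OF assms(1)] ..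
  also have "real m * v i = x - a" by (simp add: x_def)
  also have "ln x + (a - x) / x + 1 / x * (x - a) = ln x" using x by (simp add: field_simps)
  finally show ?thesis unfolding x_def .
qed

text \<open>
  Jensen, with Young's inequality as the tangent of \<open>y \<mapsto> y powr a\<close> at \<open>x\<close>.
\<close>

lemma multinomial_mean_powr_le:
  assumes i: "i < b" and a: "0 < a" "a \<le> 1" and x: "0 < x" "real m * v i \<le> x"
  shows "multinomial_mean b m v (\<lambda>k. real (k i) powr a) \<le> x powr a"
proof -
  have "multinomial_mean b m v (\<lambda>k. real (k i) powr a)
      \<le> multinomial_mean b m v (\<lambda>k. (1 - a) * x powr a + a * x powr (a - 1) * real (k i))"
  proof (rule multinomial_mean_mono[OF nonneg])
    fix k :: "nat \<Rightarrow> nat"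
    show "real (k i) powr a \<le> (1 - a) * x powr a + a * x powr (a - 1) * real (k i)"
    proof (cases "k i = 0")
      case True then show ?thesis using a by simp
    next
      case False
      define y where "y = real (k i)"
      have y: "y > 0" using False by (simp add: y_def)
      have "y powr a * x powr (1 - a) \<le> a * y + (1 - a) * x"
        using Youngs_inequality_0[of a "1 - a" y x] a x y by simp
      then have "y powr a * x powr (1 - a) * x powr (a - 1) \<le> (a * y + (1 - a) * x) * x powr (a - 1)"
        by (intro mult_right_mono) auto
      moreover have "x powr (1 - a) * x powr (a - 1) = 1"
        using x by (simp flip: powr_add)
      moreover have "x * x powr (a - 1) = x powr a"
        using x powr_mult_base[of x "a - 1"] by simp
      ultimately show ?thesis unfolding y_def[symmetric] by (simp add: algebra_simps)
    qed
  qed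
  also have "\<dots> = (1 - a) * x powr a + a * x powr (a - 1) * (real m * v i)"
    unfolding multinomial_mean_add multinomial_mean_cmult
    unfolding multinomial_mean_const multinomial_mean_component[OF i] ..
  also have "\<dots> \<le> (1 - a) * x powr a + a * x powr (a - 1) * x"
    using a x by (intro add_left_mono mult_left_mono) auto
  also have "\<dots> = x powr a"
    using x powr_mult_base[of x "a - 1"] by (simp add: algebra_simps)
  finally show ?thesis .
qed

end

section \<open>Averages over the split vector\<close>

lemma multinomial_prob_cong:
  assumes "\<And>i. i < b \<Longrightarrow> k i = l i"
  shows "multinomial_prob b m v k = multinomial_prob b m v l"
proof -
  have "(\<Sum>i<b. k i) = (\<Sum>i<b. l i)" "(\<Prod>i<b. fact (k i) :: real) = (\<Prod>i<b. fact (l i))"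
    "(\<Prod>i<b. v i ^ k i) = (\<Prod>i<b. v i ^ l i)"
    using assms by (auto intro!: sum.cong prod.cong)
  then show ?thesis unfolding multinomial_prob_def by (simp only:)
qed

text \<open>
  The \<open>s\<^sub>1\<close> balls that each child gets in advance shift the multinomial law of the remaining
  \<open>m - s\<^sub>0 - b s\<^sub>1\<close> balls.
\<close>

lemma split_prob_sum:
  fixes f :: "nat \<Rightarrow> real"
  assumes m: "s < m" and s1: "s0 + b * s1 \<le> m"
  shows "(\<Sum>k\<in>compositions b (m - s0). split_prob b s s0 s1 m v k * (\<Sum>i<b. f (k i)))
       = (\<Sum>i<b. multinomial_mean b (m - s0 - b * s1) v (\<lambda>j. f (j i + s1)))"
proof -
  define m' where "m' = m - s0 - b * s1"
  define T where "T = (\<lambda>j::nat \<Rightarrow> nat. \<lambda>i\<in>{..<b}. j i + s1)"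
  have inj: "inj_on T (compositions b m')"
  proof (rule inj_onI)
    fix j l assume j: "j \<in> compositions b m'" and l: "l \<in> compositions b m'" and eq: "T j = T l"
    show "j = l"
    proof (rule PiE_ext)
      show "j \<in> {..<b} \<rightarrow>\<^sub>E UNIV" "l \<in> {..<b} \<rightarrow>\<^sub>E UNIV" using j l unfolding compositions_def by blast+
      fix i assume "i \<in> {..<b}"
      then show "j i = l i" using fun_cong[OF eq, of i] by (simp add: T_def)
    qed
  qed
  have img: "T ` compositions b m' = {k \<in> compositions b (m - s0). \<forall>i<b. s1 \<le> k i}"
  proof (intro equalityI subsetI)
    fix k assume "k \<in> T ` compositions b m'"
    then obtain j where j: "j \<in> compositions b m'" "k = T j" by blast
    have "(\<Sum>i<b. T j i) = (\<Sum>i<b. j i + s1)" by (simp add: T_def)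
    also have "\<dots> = m' + b * s1" using j by (simp add: sum.distrib compositions_def)
    finally have "(\<Sum>i<b. k i) = m - s0" using s1 by (simp add: m'_def j)
    then show "k \<in> {k \<in> compositions b (m - s0). \<forall>i<b. s1 \<le> k i}"
      by (simp add: compositions_def j(2) T_def)
  next
    fix k assume k: "k \<in> {k \<in> compositions b (m - s0). \<forall>i<b. s1 \<le> k i}"
    define j where "j = (\<lambda>i\<in>{..<b}. k i - s1)"
    have ext: "k \<in> extensional {..<b}" and sum: "(\<Sum>i<b. k i) = m - s0"
      using k by (simp_all add: compositions_def PiE_iff)
    have "T j = k"
    proof
      fix i show "T j i = k i"
        using k extensional_arb[OF ext, of i] by (cases "i < b") (simp_all add: T_def j_def)
    qed
    moreover have "(\<Sum>i<b. j i + s1) = (\<Sum>i<b. k i)"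
      using k by (intro sum.cong) (simp_all add: j_def)
    then have "(\<Sum>i<b. j i) = m'" using sum by (simp add: sum.distrib m'_def)
    then have "j \<in> compositions b m'" by (simp add: compositions_def j_def)
    ultimately show "k \<in> T ` compositions b m'" by blast
  qed
  have "(\<Sum>k\<in>compositions b (m - s0). split_prob b s s0 s1 m v k * (\<Sum>i<b. f (k i)))
      = (\<Sum>k\<in>T ` compositions b m'. split_prob b s s0 s1 m v k * (\<Sum>i<b. f (k i)))"
    unfolding img using m
    by (intro sum.mono_neutral_right) (auto simp: finite_compositions split_prob_def)
  also have "\<dots> = (\<Sum>j\<in>compositions b m'. split_prob b s s0 s1 m v (T j) * (\<Sum>i<b. f (T j i)))"
    by (simp add: sum.reindex[OF inj])
  also have "\<dots> = (\<Sum>j\<in>compositions b m'. multinomial_prob b m' v j * (\<Sum>i<b. f (j i + s1)))"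
  proof (intro sum.cong refl)
    fix j
    have "split_prob b s s0 s1 m v (T j) = multinomial_prob b m' v (\<lambda>i. T j i - s1)"
      using m by (simp add: split_prob_def T_def m'_def)
    also have "\<dots> = multinomial_prob b m' v j"
      by (intro multinomial_prob_cong) (simp add: T_def)
    finally show "split_prob b s s0 s1 m v (T j) * (\<Sum>i<b. f (T j i))
        = multinomial_prob b m' v j * (\<Sum>i<b. f (j i + s1))" by (simp add: T_def)
  qed
  also have "\<dots> = multinomial_mean b m' v (\<lambda>j. \<Sum>i<b. f (j i + s1))"
    by (simp add: multinomial_mean_def)
  also have "\<dots> = (\<Sum>i<b. multinomial_mean b m' v (\<lambda>j. f (j i + s1)))"
    by (rule multinomial_mean_sum)
  finally show ?thesis unfolding m'_def .
qed

text \<open>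
  The hypotheses \<open>\<P>(V\<^sub>1 = 0) = \<P>(V\<^sub>1 = 1) = 0\<close> make \<open>\<mu>\<close> positive and \<open>b * E V\<^sub>1\<^sup>2 < 1\<close>.
\<close>

locale nondegenerate_split = split_parameters +
  assumes no_zero_split: "AE v in \<nu>. v 0 \<noteq> 0" and no_unit_split: "AE v in \<nu>. v 0 \<noteq> 1"
begin

sublocale split: prob_space \<nu> by (rule prob_space_split)

lemma component_measurable [measurable]: "i < b \<Longrightarrow> (\<lambda>v. v i) \<in> borel_measurable \<nu>"
  by (subst measurable_cong_sets[OF sets_split refl]) (rule measurable_component_singleton, simp)

text \<open>
  Properties of \<open>V\<^sub>1\<close> pass to every component because the components have the same law.
\<close>

lemma AE_component:
  assumes i: "i < b" and P: "{x. P x} \<in> sets borel" and ae: "AE v in \<nu>. P (v 0)"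
  shows "AE v in \<nu>. P (v i)"
proof -
  have 0: "0 < b" using b_ge_2 by simp
  have "AE x in distr \<nu> borel (\<lambda>v. v 0). P x"
    using ae P by (subst AE_distr_iff) (auto intro: component_measurable[OF 0])
  then have "AE x in distr \<nu> borel (\<lambda>v. v i). P x"
    unfolding split_identically_distributed[OF i] .
  then show ?thesis
    using P by (subst (asm) AE_distr_iff) (auto intro: component_measurable[OF i])
qed

lemma AE_proper_split:
  "AE v in \<nu>. (\<forall>i<b. 0 < v i \<and> v i < 1) \<and> (\<Sum>i<b. v i) = 1"
proof -
  have "AE v in \<nu>. \<forall>i\<in>{..<b}. v i \<noteq> 0 \<and> v i \<noteq> 1"
  proof (rule AE_finite_allI)
    fix i assume "i \<in> {..<b}"
    then have i: "i < b" by simp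
    have "AE v in \<nu>. v i \<noteq> 0" by (rule AE_component[OF i _ no_zero_split]) simp
    moreover have "AE v in \<nu>. v i \<noteq> 1" by (rule AE_component[OF i _ no_unit_split]) simp
    ultimately show "AE v in \<nu>. v i \<noteq> 0 \<and> v i \<noteq> 1" by eventually_elim simp
  qed simp
  then show ?thesis using split_nonneg split_sum
  proof eventually_elim
    fix v assume ne: "\<forall>i\<in>{..<b}. v i \<noteq> 0 \<and> v i \<noteq> 1" and nn: "\<forall>i<b. 0 \<le> v i"
      and sum: "(\<Sum>i<b. v i) = (1::real)"
    have "v i \<le> 1" if "i < b" for i
      unfolding sum[symmetric] using nn that by (intro member_le_sum) auto
    then show "(\<forall>i<b. 0 < v i \<and> v i < 1) \<and> (\<Sum>i<b. v i) = 1"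
      using ne nn sum by (auto simp: less_le)
  qed
qed

lemma integrable_component:
  assumes i: "i < b" and g: "g \<in> borel_measurable borel"
    and bound: "\<And>x. 0 < x \<Longrightarrow> x < 1 \<Longrightarrow> \<bar>g x\<bar> \<le> (c::real)"
  shows "integrable \<nu> (\<lambda>v. g (v i))"
proof (rule split.integrable_const_bound)
  show "AE v in \<nu>. norm (g (v i)) \<le> c"
    using AE_proper_split by eventually_elim (use i bound in auto)
  show "(\<lambda>v. g (v i)) \<in> borel_measurable \<nu>"
    using component_measurable[OF i] g by (rule measurable_compose)
qed

lemma integral_component_eq:
  assumes i: "i < b" and g: "(g :: real \<Rightarrow> real) \<in> borel_measurable borel"
  shows "(\<integral>v. g (v i) \<partial>\<nu>) = (\<integral>v. g (v 0) \<partial>\<nu>)"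
proof -
  have 0: "0 < b" using b_ge_2 by simp
  have "(\<integral>v. g (v i) \<partial>\<nu>) = (\<integral>x. g x \<partial>distr \<nu> borel (\<lambda>v. v i))"
    by (rule integral_distr[symmetric, OF component_measurable[OF i] g])
  also have "\<dots> = (\<integral>v. g (v 0) \<partial>\<nu>)"
    unfolding split_identically_distributed[OF i]
    by (rule integral_distr[OF component_measurable[OF 0] g])
  finally show ?thesis .
qed

lemma integral_component_sum:
  assumes g: "(g :: real \<Rightarrow> real) \<in> borel_measurable borel"
    and bound: "\<And>x. 0 < x \<Longrightarrow> x < 1 \<Longrightarrow> \<bar>g x\<bar> \<le> c"
  shows "integrable \<nu> (\<lambda>v. \<Sum>i<b. g (v i))"
    and "(\<integral>v. (\<Sum>i<b. g (v i)) \<partial>\<nu>) = real b * (\<integral>v. g (v 0) \<partial>\<nu>)"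
proof -
  have int: "integrable \<nu> (\<lambda>v. g (v i))" if "i < b" for i
    by (rule integrable_component[OF that g bound])
  then show "integrable \<nu> (\<lambda>v. \<Sum>i<b. g (v i))" by (intro Bochner_Integration.integrable_sum) simp
  have "(\<integral>v. (\<Sum>i<b. g (v i)) \<partial>\<nu>) = (\<Sum>i<b. \<integral>v. g (v i) \<partial>\<nu>)"
    using int by (intro Bochner_Integration.integral_sum) simp
  also have "\<dots> = (\<Sum>i<b. \<integral>v. g (v 0) \<partial>\<nu>)"
    by (intro sum.cong refl integral_component_eq g) simp
  finally show "(\<integral>v. (\<Sum>i<b. g (v i)) \<partial>\<nu>) = real b * (\<integral>v. g (v 0) \<partial>\<nu>)" by simp
qed

lemma integral_pos_component:
  assumes g: "(g :: real \<Rightarrow> real) \<in> borel_measurable borel"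
    and bound: "\<And>x. 0 < x \<Longrightarrow> x < 1 \<Longrightarrow> \<bar>g x\<bar> \<le> c"
    and pos: "\<And>x. 0 < x \<Longrightarrow> x < 1 \<Longrightarrow> 0 < g x"
  shows "0 < (\<integral>v. g (v 0) \<partial>\<nu>)"
proof -
  have 0: "0 < b" using b_ge_2 by simp
  have int: "integrable \<nu> (\<lambda>v. g (v 0))" by (rule integrable_component[OF 0 g bound])
  have ae: "AE v in \<nu>. 0 < g (v 0)" using AE_proper_split by eventually_elim (use 0 pos in auto)
  have nn: "AE v in \<nu>. 0 \<le> g (v 0)" using ae by eventually_elim simp
  have "(\<integral>v. g (v 0) \<partial>\<nu>) \<noteq> 0"
  proof
    assume "(\<integral>v. g (v 0) \<partial>\<nu>) = 0"
    then have "AE v in \<nu>. g (v 0) = 0"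
      using integral_nonneg_eq_0_iff_AE[OF int nn] by simp
    with ae have "AE v in \<nu>. False" by eventually_elim simp
    then show False by simp
  qed
  moreover have "0 \<le> (\<integral>v. g (v 0) \<partial>\<nu>)" by (rule integral_nonneg_AE[OF nn])
  ultimately show ?thesis by linarith
qed

end

text \<open>
  Makes the entropy integrand bounded, so that \<open>\<mu>\<close> is finite.
\<close>

lemma abs_mult_ln_le_1:
  fixes x :: real assumes "0 < x" "x < 1" shows "\<bar>x * ln x\<bar> \<le> 1"
proof -
  have "ln (1 / x) \<le> 1 / x - 1" using assms by (intro ln_le_minus_one) simp
  then have "- (x * ln x) \<le> 1 - x" using assms by (simp add: ln_div field_simps)
  moreover have "x * ln x \<le> 0" using assms by (simp add: mult_nonneg_nonpos)
  ultimately show ?thesis using assms by linarith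
qed

context nondegenerate_split begin

text \<open>
  The probability that a vertex with \<open>m\<close> balls passes on the counts \<open>k\<close> when its split vector has not been
  revealed; \<open>offspring_mean m f\<close> below is then the expected sum of \<open>f\<close> over the counts of the children.
\<close>

definition offspring_prob :: "nat \<Rightarrow> (nat \<Rightarrow> nat) \<Rightarrow> real" where
  "offspring_prob m k = (\<integral>v. split_prob b s s0 s1 m v k \<partial>\<nu>)"

definition offspring_mean :: "nat \<Rightarrow> (nat \<Rightarrow> real) \<Rightarrow> real" where
  "offspring_mean m f = (\<Sum>k\<in>compositions b (m - s0). offspring_prob m k * (\<Sum>i<b. f (k i)))"

lemma split_prob_nonneg:
  "(\<And>i. i < b \<Longrightarrow> 0 \<le> v i) \<Longrightarrow> 0 \<le> split_prob b s s0 s1 m v k"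
  by (auto simp: split_prob_def multinomial_prob_nonneg)

lemma offspring_prob_nonneg: "0 \<le> offspring_prob m k"
  unfolding offspring_prob_def
proof (rule integral_nonneg_AE)
  show "AE v in \<nu>. 0 \<le> split_prob b s s0 s1 m v k"
    using split_nonneg by eventually_elim (auto intro: split_prob_nonneg)
qed

lemma measurable_split_prob [measurable]: "(\<lambda>v. split_prob b s s0 s1 m v k) \<in> borel_measurable \<nu>"
  unfolding split_prob_def multinomial_prob_def
  by (intro measurable_If measurable_const borel_measurable_times borel_measurable_prod
        borel_measurable_power component_measurable) auto

lemma split_prob_le_fact:
  assumes "\<And>i. i < b \<Longrightarrow> 0 \<le> v i \<and> v i \<le> 1"
  shows "\<bar>split_prob b s s0 s1 m v k\<bar> \<le> fact m"
proof -
  have *: "\<bar>multinomial_prob b l v j\<bar> \<le> fact l" for l and j :: "nat \<Rightarrow> nat"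
  proof -
    have p: "(\<Prod>i<b. v i ^ j i) \<le> 1"
      using assms by (intro prod_le_1) (auto simp: power_le_one)
    have q: "0 \<le> (\<Prod>i<b. v i ^ j i)"
      by (rule prod_nonneg) (use assms in simp)
    have "(1::real) = (\<Prod>i<b. 1)" by simp
    also have "\<dots> \<le> (\<Prod>i<b. fact (j i) :: real)" by (rule prod_mono) (simp add: fact_ge_1)
    finally have r: "1 \<le> (\<Prod>i<b. fact (j i) :: real)" .
    have "fact l / (\<Prod>i<b. fact (j i)) * (\<Prod>i<b. v i ^ j i) \<le> fact l / 1 * 1"
      using p q r by (intro mult_mono divide_left_mono) auto
    moreover have "0 \<le> fact l / (\<Prod>i<b. fact (j i)) * (\<Prod>i<b. v i ^ j i)"
      using q r by (intro mult_nonneg_nonneg divide_nonneg_nonneg) auto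
    ultimately show ?thesis by (simp add: multinomial_prob_def)
  qed
  have "fact (m - s0 - b * s1) \<le> (fact m :: real)" by (intro fact_mono) simp
  then show ?thesis using order_trans[OF *[of "m - s0 - b * s1" "\<lambda>i. k i - s1"]]
    by (auto simp: split_prob_def fact_ge_1)
qed

lemma integrable_split_prob: "integrable \<nu> (\<lambda>v. split_prob b s s0 s1 m v k)"
proof (rule split.integrable_const_bound)
  show "AE v in \<nu>. norm (split_prob b s s0 s1 m v k) \<le> fact m"
    using AE_proper_split
    by eventually_elim (auto simp: less_imp_le intro!: split_prob_le_fact)
qed simp

lemma initial_balls_le: "s < m \<Longrightarrow> s0 + b * s1 \<le> m"
  using s1_le s0_le by simp

text \<open>
  Bounds that hold for a fixed split vector can be averaged over the vector.
\<close>

lemma offspring_mean_le: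
  assumes m: "s < m" and int: "integrable \<nu> g"
    and le: "\<And>v. (\<And>i. i < b \<Longrightarrow> 0 < v i \<and> v i < 1) \<Longrightarrow> (\<Sum>i<b. v i) = 1 \<Longrightarrow>
       (\<Sum>i<b. multinomial_mean b (m - s0 - b * s1) v (\<lambda>j. f (j i + s1))) \<le> g v"
  shows "offspring_mean m f \<le> (\<integral>v. g v \<partial>\<nu>)"
proof -
  have "offspring_mean m f
     = (\<integral>v. (\<Sum>k\<in>compositions b (m - s0). split_prob b s s0 s1 m v k * (\<Sum>i<b. f (k i))) \<partial>\<nu>)"
    unfolding offspring_mean_def offspring_prob_def
    by (subst Bochner_Integration.integral_sum) (auto intro: integrable_split_prob)
  also have "\<dots> \<le> (\<integral>v. g v \<partial>\<nu>)"
  proof (rule integral_mono_AE)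
    show "integrable \<nu> (\<lambda>v. \<Sum>k\<in>compositions b (m - s0).
        split_prob b s s0 s1 m v k * (\<Sum>i<b. f (k i)))"
      by (intro Bochner_Integration.integrable_sum integrable_mult_left integrable_split_prob)
    show "AE v in \<nu>. (\<Sum>k\<in>compositions b (m - s0).
        split_prob b s s0 s1 m v k * (\<Sum>i<b. f (k i))) \<le> g v"
      using AE_proper_split
      by eventually_elim (subst split_prob_sum[OF m initial_balls_le[OF m]], rule le, auto)
  qed (rule int)
  finally show ?thesis .
qed

lemma offspring_mean_mono:
  assumes "\<And>k. k \<le> m \<Longrightarrow> f k \<le> g k"
  shows "offspring_mean m f \<le> offspring_mean m g"
  unfolding offspring_mean_def
proof (intro sum_mono mult_left_mono offspring_prob_nonneg)
  fix k i assume k: "k \<in> compositions b (m - s0)" and i: "i \<in> {..<b}"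
  then have "k i \<le> m - s0" using component_le_sum_nat[of i b k] by (simp add: compositions_def)
  then show "f (k i) \<le> g (k i)" by (intro assms) simp
qed

lemma offspring_mean_cmult: "offspring_mean m (\<lambda>k. c * f k) = c * offspring_mean m f"
  unfolding offspring_mean_def sum_distrib_left[symmetric] mult.left_commute[of _ c] ..

lemma offspring_mean_add:
  "offspring_mean m (\<lambda>k. f k + g k) = offspring_mean m f + offspring_mean m g"
  unfolding offspring_mean_def by (simp add: sum.distrib distrib_left)

text \<open>
  All balls but the \<open>s\<^sub>0\<close> ones kept by the vertex are passed on.
\<close>

lemma offspring_mean_id:
  assumes m: "s < m" shows "offspring_mean m real \<le> real m - real s0"
proof -
  have "offspring_mean m real \<le> (\<integral>v. real m - real s0 \<partial>\<nu>)"
  proof (rule offspring_mean_le[OF m])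
    fix v :: "nat \<Rightarrow> real" assume v: "\<And>i. i < b \<Longrightarrow> 0 < v i \<and> v i < 1" and sum: "(\<Sum>i<b. v i) = 1"
    let ?m' = "m - s0 - b * s1"
    have nn: "\<And>i. i < b \<Longrightarrow> 0 \<le> v i" using v less_imp_le by blast
    have "multinomial_mean b ?m' v (\<lambda>j. real (j i + s1)) = real ?m' * v i + real s1" if "i < b" for i
      unfolding of_nat_add multinomial_mean_add
      by (simp only: multinomial_mean_const[OF nn sum] multinomial_mean_component[OF nn sum that])
    then have "(\<Sum>i<b. multinomial_mean b ?m' v (\<lambda>j. real (j i + s1)))
        = (\<Sum>i<b. real ?m' * v i + real s1)" by (intro sum.cong) simp_all
    also have "\<dots> = real ?m' + real b * real s1"
      by (simp add: sum.distrib sum flip: sum_distrib_left)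
    also have "\<dots> = real m - real s0" using initial_balls_le[OF m] by (simp add: of_nat_diff)
    finally show "(\<Sum>i<b. multinomial_mean b ?m' v (\<lambda>j. real (j i + s1))) \<le> real m - real s0" by simp
  qed simp
  then show ?thesis by (simp add: split.prob_space)
qed

text \<open>
  The probability \<open>E (V\<^sub>1\<^sup>2 + ... + V\<^sub>b\<^sup>2)\<close> that two balls take the same turn.
\<close>

definition mean_square :: real where "mean_square = real b * (\<integral>v. (v 0)\<^sup>2 \<partial>\<nu>)"

lemma mean_square_less_1: "mean_square < 1"
proof -
  have 0: "0 < b" using b_ge_2 by simp
  have bd: "\<bar>x - x\<^sup>2\<bar> \<le> 1" "0 < x - x\<^sup>2" "\<bar>x\<^sup>2\<bar> \<le> 1" if "0 < x" "x < 1" for x :: real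
  proof -
    have "x * x < x * 1" using that by (intro mult_strict_left_mono) auto
    then show "0 < x - x\<^sup>2" by (simp add: power2_eq_square)
    then show "\<bar>x - x\<^sup>2\<bar> \<le> 1" using that zero_le_power2[of x] unfolding abs_le_iff by linarith
    show "\<bar>x\<^sup>2\<bar> \<le> 1" using that by (simp add: power_le_one)
  qed
  have "0 < (\<integral>v. v 0 - (v 0)\<^sup>2 \<partial>\<nu>)"
    by (rule integral_pos_component[where g = "\<lambda>x. x - x\<^sup>2" and c = 1]) (use bd in auto)
  moreover have "(\<integral>v. v 0 - (v 0)\<^sup>2 \<partial>\<nu>) = (\<integral>v. v 0 \<partial>\<nu>) - (\<integral>v. (v 0)\<^sup>2 \<partial>\<nu>)"
    using integrable_component[OF 0, of "\<lambda>x. x" 1] integrable_component[OF 0, of "\<lambda>x. x\<^sup>2" 1] bd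
    by (intro Bochner_Integration.integral_diff) auto
  moreover have "real b * (\<integral>v. v 0 \<partial>\<nu>) = 1"
  proof -
    have "real b * (\<integral>v. v 0 \<partial>\<nu>) = (\<integral>v. (\<Sum>i<b. v i) \<partial>\<nu>)"
      by (rule integral_component_sum(2)[symmetric, where c = 1 and g = "\<lambda>x. x"]) auto
    also have "\<dots> = (\<integral>v. 1 \<partial>\<nu>)"
      using split_sum by (intro integral_cong_AE) (auto simp: borel_measurable_sum)
    finally show ?thesis by (simp add: split.prob_space)
  qed
  ultimately have lt: "(\<integral>v. (v 0)\<^sup>2 \<partial>\<nu>) < (\<integral>v. v 0 \<partial>\<nu>)" and "real b * (\<integral>v. v 0 \<partial>\<nu>) = 1"
    by simp_all
  moreover have "real b * (\<integral>v. (v 0)\<^sup>2 \<partial>\<nu>) < real b * (\<integral>v. v 0 \<partial>\<nu>)"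
    using 0 lt by (intro mult_strict_left_mono) auto
  ultimately show ?thesis by (simp add: mean_square_def)
qed

lemma split_mu_pos: "0 < split_mu b \<nu>"
proof -
  have "0 < (\<integral>v. - v 0 * ln (v 0) \<partial>\<nu>)"
  proof (rule integral_pos_component[where g = "\<lambda>x. - x * ln x" and c = 1])
    show "\<bar>- x * ln x\<bar> \<le> 1" if "0 < x" "x < 1" for x :: real
      using abs_mult_ln_le_1[OF that] by simp
    show "0 < - x * ln x" if "0 < x" "x < 1" for x :: real
      using that by (simp add: mult_pos_neg)
  qed simp
  then show ?thesis unfolding split_mu_def using b_ge_2 by (intro mult_pos_pos) auto
qed

end

section \<open>Offspring of a vertex: squares, entropy and fractional powers\<close>

text \<open>
  With \<open>c = s\<^sub>0 + b s\<^sub>1\<close> the vertex has \<open>m + c\<close> balls and the left side is the mean sum of the squared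
  counts of its children. If \<open>c \<ge> 1\<close>, the cross term \<open>2 m c\<close> of \<open>(m + c)\<^sup>2\<close> pays for the linear term \<open>m\<close>;
  otherwise at least two balls are distributed.
\<close>

lemma square_gap:
  fixes m c b s1 s0 q :: real
  assumes q: "0 \<le> q" "q \<le> 1" and c: "c = s0 + b * s1" and nn: "0 \<le> s0" "0 \<le> s1" "2 \<le> b" "0 \<le> m"
    and int: "(1 \<le> c) \<or> (c = 0 \<and> 2 \<le> m)"
  shows "m + m * (m - 1) * q + 2 * s1 * m + b * s1\<^sup>2 \<le> (m + c)\<^sup>2 * (1 - (1 - q) / 4)"
  using int
proof
  assume c1: "1 \<le> c"
  have bs: "2 * s1 \<le> c" using mult_right_mono[OF nn(3) nn(2)] nn by (simp add: c)
  have cm: "m \<le> m * c" using c1 nn by (simp add: mult_le_cancel_left1)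
  have a1: "2 * s1 * m \<le> c * m" using bs nn by (intro mult_right_mono) auto
  have "(b * s1) * (2 * s1) \<le> c * c"
    using bs nn c by (intro mult_mono) auto
  then have a2: "b * s1\<^sup>2 \<le> c\<^sup>2 / 2" by (simp add: power2_eq_square)
  have a3: "(1 - q) * (m + c)\<^sup>2 / 4 \<le> (1 - q) * (m\<^sup>2 + c\<^sup>2) / 2"
  proof -
    have "(m + c)\<^sup>2 \<le> 2 * (m\<^sup>2 + c\<^sup>2)"
      using zero_le_power2[of "m - c"] by (simp add: power2_eq_square algebra_simps)
    then have "(1 - q) * (m + c)\<^sup>2 \<le> (1 - q) * (2 * (m\<^sup>2 + c\<^sup>2))" using q by (intro mult_left_mono) auto
    also have "\<dots> = 2 * ((1 - q) * (m\<^sup>2 + c\<^sup>2))" by (rule mult.left_commute)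
    finally show ?thesis by linarith
  qed
  have a4: "(1 - q) * m \<le> m" using q nn mult_right_mono[of "1 - q" 1 m] by simp
  have a5: "(1 - q) * c\<^sup>2 \<le> c\<^sup>2" using q mult_right_mono[of "1 - q" 1 "c\<^sup>2"] by simp
  have a6: "0 \<le> (1 - q) * m\<^sup>2" using q by simp
  have a7: "m + m * (m - 1) * q = m\<^sup>2 - (1 - q) * m\<^sup>2 + (1 - q) * m"
    by (simp add: power2_eq_square algebra_simps)
  have a8: "(m + c)\<^sup>2 * (1 - (1 - q) / 4) = m\<^sup>2 + 2 * (m * c) + c\<^sup>2 - (1 - q) * (m + c)\<^sup>2 / 4"
  proof -
    have "X * (1 - (1 - q) / 4) = X - (1 - q) * X / 4" for X
      by (simp add: field_simps)
    then show ?thesis by (simp add: power2_sum)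
  qed
  have a9: "(1 - q) * (m\<^sup>2 + c\<^sup>2) / 2 = (1 - q) * m\<^sup>2 / 2 + (1 - q) * c\<^sup>2 / 2"
    by (simp add: distrib_left add_divide_distrib)
  have "c * m = m * c" by simp
  then show ?thesis unfolding a7 a8
    using a1 a2 a3[unfolded a9] a4 a5 a6 cm by linarith
next
  assume c0: "c = 0 \<and> 2 \<le> m"
  have "0 \<le> b * s1" using nn by simp
  then have "b * s1 = 0" using c c0 nn by linarith
  then have s1: "s1 = 0" using nn by simp
  have "0 \<le> (1 - q) * (m * (m * 3 / 4 - 1))"
    using q c0 by (intro mult_nonneg_nonneg) auto
  then show ?thesis using c0 s1 by (simp add: power2_eq_square field_simps)
qed

text \<open>
  Each unit step increases \<open>x powr a\<close> by at most one.
\<close>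

lemma powr_add_le:
  fixes a :: real assumes "0 < a" "a \<le> 1"
  shows "real (j + s) powr a \<le> real j powr a + real s"
proof (induction s)
  case (Suc s)
  have "real (j + Suc s) powr a \<le> real (j + s) powr a + 1"
  proof (cases "j + s = 0")
    case False
    define x where "x = real (j + s)"
    have x: "1 \<le> x" using False unfolding x_def by linarith
    have "x + 1 = x * (1 + 1 / x)" using x by (simp add: distrib_left)
    then have "(x + 1) powr a = x powr a * (1 + 1 / x) powr a"
      using x by (simp only: powr_mult)
    also have "\<dots> \<le> x powr a * (1 + 1 / x)"
      using x assms powr_mono[of a 1 "1 + 1 / x"] by (intro mult_left_mono) auto
    also have "\<dots> = x powr a + x powr a / x" by (simp add: distrib_left)
    also have "x powr a / x \<le> 1" using x assms powr_mono[of a 1 x] by simp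
    finally show ?thesis by (simp add: x_def add.commute)
  qed simp
  with Suc show ?case by simp
qed simp

text \<open>
  Second order expansion of \<open>x powr - d = exp (d l)\<close>, \<open>l = - ln x\<close>. Half of the factor
  \<open>x = exp (- l)\<close> absorbs \<open>exp (d l)\<close>, and the other half absorbs \<open>l\<^sup>2\<close> because \<open>l\<^sup>2 exp (- l / 2) \<le> 8\<close>.
\<close>

lemma powr_one_minus_le:
  fixes x d :: real assumes x: "0 < x" "x < 1" and d: "0 \<le> d" "d \<le> 1 / 2"
  shows "x powr (1 - d) \<le> x + d * (- x * ln x) + 8 * d\<^sup>2"
proof -
  define l where "l = - ln x"
  have l: "0 \<le> l" using x by (simp add: l_def)
  have xl: "x = exp (- l)" using x by (simp add: l_def)
  have *: "exp y \<le> 1 + y + y\<^sup>2 * exp y" if "0 \<le> y" for y :: real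
  proof -
    have "1 - y \<le> exp (- y)" using exp_ge_add_one_self[of "- y"] by simp
    then have "exp y * (1 - y) \<le> exp y * exp (- y)" by (intro mult_left_mono) auto
    then have 1: "exp y - 1 \<le> y * exp y" by (simp add: algebra_simps exp_minus)
    then have "y * (exp y - 1) \<le> y * (y * exp y)" using that by (intro mult_left_mono)
    with 1 show ?thesis by (simp add: power2_eq_square algebra_simps)
  qed
  have 8: "l\<^sup>2 * exp (- l / 2) \<le> 8"
  proof -
    have "1 + l / 2 + (l / 2)\<^sup>2 / 2 \<le> exp (l / 2)" using l by (intro exp_lower_Taylor_quadratic) simp
    then have "l\<^sup>2 \<le> 8 * exp (l / 2)" using l by (simp add: power2_eq_square)
    then have "l\<^sup>2 * exp (- l / 2) \<le> 8 * exp (l / 2) * exp (- l / 2)" by (intro mult_right_mono) auto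
    also have "\<dots> = 8" by (simp add: exp_minus)
    finally show ?thesis .
  qed
  have "x powr (1 - d) = exp (- l + d * l)"
    using x by (simp add: powr_def l_def algebra_simps)
  also have "\<dots> = x * exp (d * l)" by (simp only: exp_add xl)
  also have "\<dots> \<le> x * (1 + d * l + (d * l)\<^sup>2 * exp (d * l))"
    using x d l by (intro mult_left_mono * ) auto
  also have "\<dots> = x + d * (x * l) + d\<^sup>2 * (l\<^sup>2 * (exp (d * l) * exp (- l)))"
    by (simp add: xl power2_eq_square algebra_simps)
  also have "exp (d * l) * exp (- l) = exp (d * l - l)" by (simp add: exp_diff exp_minus field_simps)
  also have "d\<^sup>2 * (l\<^sup>2 * exp (d * l - l)) \<le> d\<^sup>2 * (l\<^sup>2 * exp (- l / 2))"
    using mult_right_mono[OF d(2) l] by (intro mult_left_mono) auto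
  also have "\<dots> \<le> d\<^sup>2 * 8" using 8 by (intro mult_left_mono) auto
  finally show ?thesis by (simp add: l_def mult.commute)
qed

context nondegenerate_split begin

text \<open>
  One split reduces the sum of squares by a fixed factor, uniformly in the number of balls.
\<close>

lemma offspring_mean_square:
  assumes m: "s < m"
  shows "offspring_mean m (\<lambda>k. (real k)\<^sup>2) \<le> (real m)\<^sup>2 * (1 - (1 - mean_square) / 4)"
proof -
  define m' where "m' = m - s0 - b * s1"
  have mm: "real m = real m' + (real s0 + real b * real s1)"
    using initial_balls_le[OF m] by (simp add: m'_def of_nat_diff)
  define g where "g = (\<lambda>v::nat \<Rightarrow> real. real m' + real m' * (real m' - 1) * (\<Sum>i<b. (v i)\<^sup>2)
      + 2 * real s1 * real m' + real b * (real s1)\<^sup>2)"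
  have bd: "\<bar>x\<^sup>2\<bar> \<le> 1" if "0 < x" "x < 1" for x :: real using that by (simp add: power_le_one)
  note sq = integral_component_sum[of "\<lambda>x. x\<^sup>2" 1, OF _ bd]
  have "offspring_mean m (\<lambda>k. (real k)\<^sup>2) \<le> (\<integral>v. g v \<partial>\<nu>)"
  proof (rule offspring_mean_le[OF m])
    show "integrable \<nu> g" unfolding g_def using sq(1) by simp
    fix v :: "nat \<Rightarrow> real" assume v: "\<And>i. i < b \<Longrightarrow> 0 < v i \<and> v i < 1" and sum: "(\<Sum>i<b. v i) = 1"
    have nn: "\<And>i. i < b \<Longrightarrow> 0 \<le> v i" using v less_imp_le by blast
    have "multinomial_mean b m' v (\<lambda>j. (real (j i + s1))\<^sup>2)
        = real m' * v i + real m' * (real m' - 1) * (v i)\<^sup>2 + 2 * real s1 * (real m' * v i) + (real s1)\<^sup>2"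
      if i: "i < b" for i
    proof -
      have "(\<lambda>j::nat \<Rightarrow> nat. (real (j i + s1))\<^sup>2)
          = (\<lambda>j. (real (j i))\<^sup>2 + 2 * real s1 * real (j i) + (real s1)\<^sup>2)"
        by (simp add: power2_eq_square algebra_simps fun_eq_iff)
      then show ?thesis
        by (simp only: multinomial_mean_add multinomial_mean_cmult multinomial_mean_const[OF nn sum]
            multinomial_mean_component[OF nn sum i] multinomial_mean_component_square[OF nn sum i])
    qed
    then have "(\<Sum>i<b. multinomial_mean b m' v (\<lambda>j. (real (j i + s1))\<^sup>2))
        = (\<Sum>i<b. real m' * v i + real m' * (real m' - 1) * (v i)\<^sup>2
             + 2 * real s1 * (real m' * v i) + (real s1)\<^sup>2)" by (intro sum.cong) simp_all
    also have "\<dots> = real m' * (\<Sum>i<b. v i) + real m' * (real m' - 1) * (\<Sum>i<b. (v i)\<^sup>2)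
        + 2 * real s1 * real m' * (\<Sum>i<b. v i) + real b * (real s1)\<^sup>2"
      by (simp add: sum.distrib sum_distrib_left mult.assoc)
    also have "\<dots> = g v" by (simp add: g_def sum)
    finally show "(\<Sum>i<b. multinomial_mean b (m - s0 - b * s1) v (\<lambda>j. (real (j i + s1))\<^sup>2)) \<le> g v"
      by (simp add: m'_def)
  qed
  also have "(\<integral>v. g v \<partial>\<nu>) = real m' + real m' * (real m' - 1) * mean_square
      + 2 * real s1 * real m' + real b * (real s1)\<^sup>2"
    unfolding g_def mean_square_def using sq by (simp add: split.prob_space)
  also have "\<dots> \<le> (real m' + (real s0 + real b * real s1))\<^sup>2 * (1 - (1 - mean_square) / 4)"
  proof (rule square_gap)
    show "0 \<le> mean_square" by (simp add: mean_square_def)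
    show "mean_square \<le> 1" using mean_square_less_1 by simp
    show "1 \<le> real s0 + real b * real s1 \<or> (real s0 + real b * real s1 = 0 \<and> 2 \<le> real m')"
    proof (cases "s0 + b * s1 = 0")
      case True
      then have "s0 = 0" "b * s1 = 0" by linarith+
      then have "m' = m" unfolding m'_def by linarith
      with m s_pos have "2 \<le> real m'" by simp
      moreover have "real s0 + real b * real s1 = real (s0 + b * s1)" by simp
      ultimately show ?thesis using True by simp
    next
      case False
      then have "1 \<le> real (s0 + b * s1)" by linarith
      then show ?thesis by simp
    qed
  qed (use b_ge_2 in auto)
  finally show ?thesis by (simp only: mm)
qed

text \<open>
  Size bias turns the factor \<open>j i\<close> into a logarithm, which Jensen bounds. The error is bounded
  uniformly in \<open>m\<close> because \<open>m v\<^sub>i (ln (m v\<^sub>i + r) - ln (m v\<^sub>i)) \<le> r\<close>.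
\<close>

lemma multinomial_mean_mult_ln_le:
  assumes v: "\<And>i. i < b \<Longrightarrow> 0 < v i \<and> v i < 1" and sum: "(\<Sum>i<b. v i) = 1" and i: "i < b"
    and m: "1 \<le> m" "real m = real m' + d" "0 \<le> d"
  shows "multinomial_mean b m' v (\<lambda>j. real (j i) * ln (real s1 + real (j i)))
       \<le> real m * ln (real m) * v i + real m * (v i * ln (v i)) + (real s1 + 1 + d)"
proof -
  have nn: "\<And>i. i < b \<Longrightarrow> 0 \<le> v i" using v less_imp_le by blast
  define x where "x = real m * v i"
  have x: "0 < x" using m v[OF i] by (simp add: x_def)
  have y: "0 \<le> real m' * v i" "real m' * v i \<le> x"
    using m v[OF i] by (auto simp: x_def intro!: mult_right_mono)
  have "multinomial_mean b m' v (\<lambda>j. real (j i) * ln (real s1 + real (j i)))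
      \<le> real m' * v i * ln (real s1 + 1 + x)"
  proof (cases m')
    case 0
    have "multinomial_mean b m' v (\<lambda>j. real (j i) * ln (real s1 + real (j i))) = multinomial_mean b m' v (\<lambda>j. 0)"
    proof (rule multinomial_mean_cong)
      fix j assume "j \<in> compositions b m'"
      then have "j i \<le> 0" using component_le_sum_nat[OF i, of j] 0 by (simp only: compositions_def) simp
      then show "real (j i) * ln (real s1 + real (j i)) = 0" by simp
    qed
    then show ?thesis using multinomial_mean_const[OF nn sum, of m' 0] by (simp add: 0)
  next
    case (Suc l)
    have "multinomial_mean b m' v (\<lambda>j. real (j i) * ln (real s1 + real (j i)))
        = real m' * v i * multinomial_mean b l v (\<lambda>j. ln (real s1 + real ((j(i := Suc (j i))) i)))"
      unfolding Suc by (rule multinomial_mean_size_bias[OF i])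
    also have "(\<lambda>j. ln (real s1 + real ((j(i := Suc (j i))) i))) = (\<lambda>j. ln ((real s1 + 1) + real (j i)))"
      by (simp add: fun_eq_iff add_ac)
    also have "multinomial_mean b l v \<dots> \<le> ln ((real s1 + 1) + real l * v i)"
      by (rule multinomial_mean_ln_le[OF nn sum i]) simp_all
    also have "\<dots> \<le> ln (real s1 + 1 + x)"
    proof (subst ln_le_cancel_iff)
      have l: "0 \<le> real l * v i" using v[OF i] by simp
      then show "0 < real s1 + 1 + real l * v i" by linarith
      show "0 < real s1 + 1 + x" using x by linarith
      have "real l * v i \<le> real m' * v i" using v[OF i] by (intro mult_right_mono) (auto simp: Suc)
      then show "real s1 + 1 + real l * v i \<le> real s1 + 1 + x" using y by linarith
    qed
    finally show ?thesis using v[OF i] by (simp add: mult_left_mono)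
  qed
  also have "\<dots> \<le> real m' * v i * (ln x + (real s1 + 1) / x)"
  proof (intro mult_left_mono y)
    have pos: "0 < real s1 + 1 + x" using x by linarith
    then have "ln ((real s1 + 1 + x) / x) \<le> (real s1 + 1 + x) / x - 1"
      using x by (intro ln_le_minus_one) simp
    moreover have "ln ((real s1 + 1 + x) / x) = ln (real s1 + 1 + x) - ln x"
      by (subst ln_div) (use x pos in auto)
    moreover have "(real s1 + 1 + x) / x - 1 = (real s1 + 1) / x"
      using x by (simp add: field_simps)
    ultimately show "ln (real s1 + 1 + x) \<le> ln x + (real s1 + 1) / x" by linarith
  qed
  also have "\<dots> = real m' * v i * ln x + real m' * v i / x * (real s1 + 1)"
    by (simp add: distrib_left add_divide_distrib)
  also have "real m' * v i / x * (real s1 + 1) \<le> 1 * (real s1 + 1)"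
    using x y by (intro mult_right_mono) auto
  also have "real m' * v i * ln x = real m' * (v i * ln (real m)) + real m' * (v i * ln (v i))"
    using m v[OF i] by (simp add: x_def ln_mult distrib_left)
  also have "real m' * (v i * ln (real m)) \<le> real m * (v i * ln (real m))"
    using m v[OF i] by (intro mult_right_mono mult_nonneg_nonneg) auto
  also have "real m' * (v i * ln (v i)) = real m * (v i * ln (v i)) + d * (- (v i * ln (v i)))"
    using m by (simp add: algebra_simps)
  also have "d * (- (v i * ln (v i))) \<le> d * 1"
    using m abs_mult_ln_le_1[of "v i"] v[OF i] by (intro mult_left_mono) auto
  finally show ?thesis by (simp add: mult_ac)
qed

text \<open>
  One split lowers \<open>m ln m\<close> by \<open>\<mu> m\<close> up to a logarithmic error: \<open>m ln m\<close> becomes the sum of the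
  \<open>m V\<^sub>i ln (m V\<^sub>i)\<close>. This is where \<open>\<mu>\<close> enters the typical depth.
\<close>

lemma offspring_mean_mult_ln:
  assumes m: "s < m"
  shows "offspring_mean m (\<lambda>k. real k * ln (real k))
     \<le> real m * ln (real m) - split_mu b \<nu> * real m
       + real b * (real s1 + 1 + (real s0 + real b * real s1)) + real b * real s1 * ln (real m)"
proof -
  define m' where "m' = m - s0 - b * s1"
  define d where "d = real s0 + real b * real s1"
  have mm: "real m = real m' + d"
    using initial_balls_le[OF m] by (simp add: m'_def d_def of_nat_diff)
  have m1: "1 \<le> m" using m by simp
  have d: "0 \<le> d" by (simp add: d_def)
  define g where "g = (\<lambda>v::nat \<Rightarrow> real. real m * ln (real m) + real m * (\<Sum>i<b. v i * ln (v i))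
      + real b * (real s1 + 1 + d) + real b * real s1 * ln (real m))"
  have bd: "\<bar>x * ln x\<bar> \<le> 1" if "0 < x" "x < 1" for x :: real using that by (rule abs_mult_ln_le_1)
  note ent = integral_component_sum[of "\<lambda>x. x * ln x" 1, OF _ bd]
  have "offspring_mean m (\<lambda>k. real k * ln (real k)) \<le> (\<integral>v. g v \<partial>\<nu>)"
  proof (rule offspring_mean_le[OF m])
    show "integrable \<nu> g" unfolding g_def using ent(1) by simp
    fix v :: "nat \<Rightarrow> real" assume v: "\<And>i. i < b \<Longrightarrow> 0 < v i \<and> v i < 1" and sum: "(\<Sum>i<b. v i) = 1"
    have nn: "\<And>i. i < b \<Longrightarrow> 0 \<le> v i" using v less_imp_le by blast
    have "multinomial_mean b m' v (\<lambda>j. real (j i + s1) * ln (real (j i + s1)))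
        \<le> real m * ln (real m) * v i + real m * (v i * ln (v i)) + (real s1 + 1 + d) + real s1 * ln (real m)"
      if i: "i < b" for i
    proof -
      have "multinomial_mean b m' v (\<lambda>j. real (j i + s1) * ln (real (j i + s1)))
         \<le> multinomial_mean b m' v (\<lambda>j. real (j i) * ln (real s1 + real (j i)) + real s1 * ln (real m))"
      proof (rule multinomial_mean_mono[OF nn])
        fix j assume j: "j \<in> compositions b m'"
        have "j i \<le> m'" using component_le_sum_nat[OF i, of j] j by (simp add: compositions_def)
        moreover have "1 * s1 \<le> b * s1" using b_ge_2 by (intro mult_right_mono) auto
        ultimately have "j i + s1 \<le> m" using initial_balls_le[OF m] unfolding m'_def by linarith
        then have "real s1 * ln (real (j i + s1)) \<le> real s1 * ln (real m)"
          by (cases "s1 = 0") (auto intro!: mult_left_mono simp: ln_le_cancel_iff)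
        then show "real (j i + s1) * ln (real (j i + s1))
            \<le> real (j i) * ln (real s1 + real (j i)) + real s1 * ln (real m)"
          by (simp add: algebra_simps)
      qed
      also have "\<dots> = multinomial_mean b m' v (\<lambda>j. real (j i) * ln (real s1 + real (j i))) + real s1 * ln (real m)"
        by (simp only: multinomial_mean_add multinomial_mean_const[OF nn sum])
      finally show ?thesis using multinomial_mean_mult_ln_le[OF v sum i m1 mm d] by linarith
    qed
    then have "(\<Sum>i<b. multinomial_mean b m' v (\<lambda>j. real (j i + s1) * ln (real (j i + s1))))
        \<le> (\<Sum>i<b. real m * ln (real m) * v i + real m * (v i * ln (v i)) + (real s1 + 1 + d)
              + real s1 * ln (real m))" by (intro sum_mono) simp
    also have "\<dots> = real m * ln (real m) * (\<Sum>i<b. v i) + real m * (\<Sum>i<b. v i * ln (v i))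
        + real b * (real s1 + 1 + d) + real b * (real s1 * ln (real m))"
      by (simp only: sum.distrib sum_distrib_left[symmetric] sum_constant card_lessThan)
         (simp add: algebra_simps)
    also have "\<dots> = g v" by (simp add: g_def sum)
    finally show "(\<Sum>i<b. multinomial_mean b (m - s0 - b * s1) v
        (\<lambda>j. real (j i + s1) * ln (real (j i + s1)))) \<le> g v"
      by (simp add: m'_def)
  qed
  also have "(\<integral>v. g v \<partial>\<nu>) = real m * ln (real m) + real m * (real b * (\<integral>v. v 0 * ln (v 0) \<partial>\<nu>))
      + real b * (real s1 + 1 + d) + real b * real s1 * ln (real m)"
    unfolding g_def using ent by (simp add: split.prob_space)
  also have "real b * (\<integral>v. v 0 * ln (v 0) \<partial>\<nu>) = - split_mu b \<nu>"
    by (simp add: split_mu_def)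
  finally show ?thesis by (simp add: d_def mult.commute)
qed

text \<open>
  The factor by which one split multiplies \<open>m powr a\<close>.
\<close>

definition powr_moment :: "real \<Rightarrow> real" where
  "powr_moment a = real b * (\<integral>v. v 0 powr a \<partial>\<nu>)"

lemma offspring_mean_powr:
  assumes m: "s < m" and a: "0 < a" "a \<le> 1"
  shows "offspring_mean m (\<lambda>k. real k powr a) \<le> real m powr a * powr_moment a + real b * real s1"
proof -
  define m' where "m' = m - s0 - b * s1"
  define g where "g = (\<lambda>v::nat \<Rightarrow> real. real m powr a * (\<Sum>i<b. v i powr a) + real b * real s1)"
  have bd: "\<bar>x powr a\<bar> \<le> 1" if "0 < x" "x < 1" for x :: real
    using that a by (simp add: powr_le1)
  note pw = integral_component_sum[of "\<lambda>x. x powr a" 1, OF _ bd]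
  have "offspring_mean m (\<lambda>k. real k powr a) \<le> (\<integral>v. g v \<partial>\<nu>)"
  proof (rule offspring_mean_le[OF m])
    show "integrable \<nu> g" unfolding g_def using pw(1) by simp
    fix v :: "nat \<Rightarrow> real" assume v: "\<And>i. i < b \<Longrightarrow> 0 < v i \<and> v i < 1" and sum: "(\<Sum>i<b. v i) = 1"
    have nn: "\<And>i. i < b \<Longrightarrow> 0 \<le> v i" using v less_imp_le by blast
    have "multinomial_mean b m' v (\<lambda>j. real (j i + s1) powr a) \<le> real m powr a * v i powr a + real s1"
      if i: "i < b" for i
    proof -
      have "multinomial_mean b m' v (\<lambda>j. real (j i + s1) powr a)
          \<le> multinomial_mean b m' v (\<lambda>j. real (j i) powr a + real s1)"
        by (intro multinomial_mean_mono[OF nn] powr_add_le a) auto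
      also have "\<dots> = multinomial_mean b m' v (\<lambda>j. real (j i) powr a) + real s1"
        by (simp only: multinomial_mean_add multinomial_mean_const[OF nn sum])
      also have "multinomial_mean b m' v (\<lambda>j. real (j i) powr a) \<le> (real m * v i) powr a"
      proof (rule multinomial_mean_powr_le[OF nn sum i a])
        show "0 < real m * v i" using m v[OF i] by simp
        show "real m' * v i \<le> real m * v i"
          using v[OF i] by (intro mult_right_mono) (auto simp: m'_def)
      qed
      also have "\<dots> = real m powr a * v i powr a" using v[OF i] by (simp add: powr_mult)
      finally show ?thesis by simp
    qed
    then have "(\<Sum>i<b. multinomial_mean b m' v (\<lambda>j. real (j i + s1) powr a))
        \<le> (\<Sum>i<b. real m powr a * v i powr a + real s1)" by (intro sum_mono) simp
    also have "\<dots> = g v" by (simp add: g_def sum.distrib sum_distrib_left)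
    finally show "(\<Sum>i<b. multinomial_mean b (m - s0 - b * s1) v (\<lambda>j. real (j i + s1) powr a)) \<le> g v"
      by (simp add: m'_def)
  qed
  also have "(\<integral>v. g v \<partial>\<nu>) = real m powr a * powr_moment a + real b * real s1"
    unfolding g_def powr_moment_def using pw by (simp add: split.prob_space)
  finally show ?thesis .
qed

text \<open>
  This is where \<open>\<mu>\<close> enters the decay of \<open>E p ^ (2 D)\<close>.
\<close>

lemma powr_moment_le:
  assumes d: "0 \<le> d" "d \<le> 1 / 2"
  shows "powr_moment (1 - d) \<le> 1 + d * split_mu b \<nu> + 8 * real b * d\<^sup>2"
proof -
  have 0: "0 < b" using b_ge_2 by simp
  have bd: "\<bar>x powr (1 - d)\<bar> \<le> 1" if "0 < x" "x < 1" for x :: real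
    using that d by (simp add: powr_le1)
  have bd2: "\<bar>x * ln x\<bar> \<le> 1" if "0 < x" "x < 1" for x :: real using that by (rule abs_mult_ln_le_1)
  note pw = integral_component_sum[of "\<lambda>x. x powr (1 - d)" 1, OF _ bd]
  note ent = integral_component_sum[of "\<lambda>x. x * ln x" 1, OF _ bd2]
  have "powr_moment (1 - d) = (\<integral>v. (\<Sum>i<b. v i powr (1 - d)) \<partial>\<nu>)"
    unfolding powr_moment_def using pw by simp
  also have "\<dots> \<le> (\<integral>v. 1 - d * (\<Sum>i<b. v i * ln (v i)) + 8 * real b * d\<^sup>2 \<partial>\<nu>)"
  proof (rule integral_mono_AE)
    show "integrable \<nu> (\<lambda>v. \<Sum>i<b. v i powr (1 - d))" using pw by simp
    show "integrable \<nu> (\<lambda>v. 1 - d * (\<Sum>i<b. v i * ln (v i)) + 8 * real b * d\<^sup>2)" using ent by simp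
    show "AE v in \<nu>. (\<Sum>i<b. v i powr (1 - d)) \<le> 1 - d * (\<Sum>i<b. v i * ln (v i)) + 8 * real b * d\<^sup>2"
      using AE_proper_split
    proof eventually_elim
      fix v :: "nat \<Rightarrow> real" assume v: "(\<forall>i<b. 0 < v i \<and> v i < 1) \<and> (\<Sum>i<b. v i) = 1"
      then have "(\<Sum>i<b. v i powr (1 - d)) \<le> (\<Sum>i<b. v i + d * (- v i * ln (v i)) + 8 * d\<^sup>2)"
        by (intro sum_mono powr_one_minus_le d) auto
      also have "\<dots> = (\<Sum>i<b. v i) - d * (\<Sum>i<b. v i * ln (v i)) + 8 * real b * d\<^sup>2"
        by (simp add: sum.distrib sum_distrib_left sum_negf sum_subtractf)
      finally show "(\<Sum>i<b. v i powr (1 - d)) \<le> 1 - d * (\<Sum>i<b. v i * ln (v i)) + 8 * real b * d\<^sup>2"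
        using v by simp
    qed
  qed
  also have "\<dots> = 1 - d * (real b * (\<integral>v. v 0 * ln (v 0) \<partial>\<nu>)) + 8 * real b * d\<^sup>2"
    using ent by (simp add: split.prob_space)
  also have "real b * (\<integral>v. v 0 * ln (v 0) \<partial>\<nu>) = - split_mu b \<nu>"
    by (simp add: split_mu_def)
  finally show ?thesis by simp
qed

end

section \<open>The joint law of the ball counts\<close>

text \<open>
  Both sides integrate \<open>f\<close> against the law of \<open>X\<close> restricted to \<open>D\<close>, which by assumption is
  \<open>prob D\<close> times the law of \<open>X\<close>.
\<close>

lemma (in prob_space) integral_indep_event:
  fixes f :: "'b \<Rightarrow> real"
  assumes D: "D \<in> events" and X: "X \<in> measurable M S"
    and indep: "\<And>A. A \<in> sets S \<Longrightarrow> prob (D \<inter> (X -` A \<inter> space M)) = prob D * prob (X -` A \<inter> space M)"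
    and f: "f \<in> borel_measurable S"
  shows "(\<integral>x\<in>D. f (X x) \<partial>M) = prob D * (\<integral>y. f y \<partial>distr M S X)"
proof -
  let ?I = "\<lambda>x. indicator D x :: real"
  have eq: "distr (density M ?I) S X = density (distr M S X) (\<lambda>_. ennreal (prob D))" (is "?L = ?R")
  proof (rule measure_eqI)
    fix A assume "A \<in> sets ?L"
    then have A: "A \<in> sets S" by simp
    have XA: "X -` A \<inter> space M \<in> events" using X A by (rule measurable_sets)
    have XD: "X \<in> measurable (density M ?I) S" using X by simp
    have "emeasure ?L A = emeasure (density M ?I) (X -` A \<inter> space M)"
      using A XD by (subst emeasure_distr) auto
    also have "\<dots> = (\<integral>\<^sup>+x. ennreal (?I x) * indicator (X -` A \<inter> space M) x \<partial>M)"
      using D XA by (subst emeasure_density) auto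
    also have "\<dots> = (\<integral>\<^sup>+x. indicator (D \<inter> (X -` A \<inter> space M)) x \<partial>M)"
      by (intro nn_integral_cong) (auto simp: indicator_def)
    also have "\<dots> = emeasure M (D \<inter> (X -` A \<inter> space M))"
      using D XA by (intro nn_integral_indicator) auto
    also have "\<dots> = ennreal (prob D) * emeasure M (X -` A \<inter> space M)"
      by (simp add: emeasure_eq_measure indep[OF A] ennreal_mult)
    also have "\<dots> = emeasure ?R A"
      using A X by (subst emeasure_density_const) (auto simp: emeasure_distr)
    finally show "emeasure ?L A = emeasure ?R A" .
  qed simp
  have fX: "(\<lambda>x. f (X x)) \<in> borel_measurable M" using X f by (rule measurable_compose)
  have XD: "X \<in> measurable (density M ?I) S" using X by simp
  have "(\<integral>x\<in>D. f (X x) \<partial>M) = (\<integral>x. f (X x) \<partial>density M ?I)"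
    unfolding set_lebesgue_integral_def using D fX by (subst integral_density) auto
  also have "\<dots> = (\<integral>y. f y \<partial>?L)" using XD f by (rule integral_distr[symmetric])
  also have "\<dots> = (\<integral>y. f y \<partial>?R)" by (simp only: eq)
  also have "\<dots> = prob D * (\<integral>y. f y \<partial>distr M S X)"
    using f by (subst integral_density) auto
  finally show ?thesis .
qed

text \<open>
  No ball is created or lost when \<open>m\<close> balls are split into the counts \<open>k\<close>.
\<close>

definition conserved :: "nat \<Rightarrow> nat \<Rightarrow> nat \<Rightarrow> nat \<Rightarrow> (nat \<Rightarrow> nat) \<Rightarrow> bool" where
  "conserved b s s0 m k \<longleftrightarrow> (if m \<le> s then \<forall>i<b. k i = 0 else s0 + (\<Sum>i<b. k i) = m)"

locale split_process = nondegenerate_split b s s0 s1 \<nu> + split_tree M b s s0 s1 \<nu> n V N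
  for b s s0 s1 \<nu> and M :: "'a measure" and n V N
begin

abbreviation count_is :: "nat list \<Rightarrow> nat \<Rightarrow> 'a set" where
  "count_is u m \<equiv> {x \<in> space M. N u x = m}"

abbreviation children_are :: "nat list \<Rightarrow> (nat \<Rightarrow> nat) \<Rightarrow> 'a set" where
  "children_are u k \<equiv> {x \<in> space M. \<forall>i<b. N (u @ [i]) x = k i}"

lemma child_vertex: "u \<in> vertices b \<Longrightarrow> i < b \<Longrightarrow> u @ [i] \<in> vertices b"
  by auto

lemma split_vector_measurable: "u \<in> vertices b \<Longrightarrow> V u \<in> measurable M (split_space b)"
  using split_indep unfolding indep_vars_def by auto

lemma count_event: "u \<in> vertices b \<Longrightarrow> {x \<in> space M. P (N u x)} \<in> events"
  using measurable_sets[OF count_measurable, of u "{m. P m}"]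
  by (simp add: vimage_def Int_def conj_commute)

lemma split_event:
  "u \<in> vertices b \<Longrightarrow> A \<in> sets (split_space b) \<Longrightarrow> V u -` A \<inter> space M \<in> events"
  by (rule measurable_sets[OF split_vector_measurable])

lemma children_event:
  assumes "u \<in> vertices b"
  shows "(children_are u k) \<in> events"
proof -
  have "{x \<in> space M. \<forall>i\<in>{..<b}. N (u @ [i]) x = k i} \<in> events"
    using assms by (intro sets.sets_Collect_finite_All count_event child_vertex) auto
  then show ?thesis by (simp only: Ball_def lessThan_iff)
qed

lemma history_sets_subset: "sets (split_history M b V N u) \<subseteq> events"
  and space_history: "space (split_history M b V N u) = space M"
  and history_split: "w \<in> vertices b \<Longrightarrow> A \<in> sets (split_space b) \<Longrightarrow>
    V w -` A \<inter> space M \<in> sets (split_history M b V N u)"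
  and history_count: "w \<in> vertices b \<Longrightarrow> \<not> strict_prefix u w \<Longrightarrow>
    {x \<in> space M. P (N w x)} \<in> sets (split_history M b V N u)"
proof -
  let ?G = "{V w -` A \<inter> space M | w A. w \<in> vertices b \<and> A \<in> sets (split_space b)} \<union>
      {N w -` A \<inter> space M | w A. w \<in> vertices b \<and> \<not> strict_prefix u w}"
  have G: "?G \<subseteq> events"
    using split_event measurable_sets[OF count_measurable] by auto
  then have P: "?G \<subseteq> Pow (space M)" using sets.sets_into_space by blast
  have S: "sets (split_history M b V N u) = sigma_sets (space M) ?G"
    unfolding split_history_def by (rule sets_measure_of[OF P])
  show "sets (split_history M b V N u) \<subseteq> events"
    unfolding S by (rule sets.sigma_sets_subset[OF G])
  show "space (split_history M b V N u) = space M"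
    unfolding split_history_def by (rule space_measure_of[OF P])
  show "V w -` A \<inter> space M \<in> sets (split_history M b V N u)"
    if "w \<in> vertices b" "A \<in> sets (split_space b)"
    unfolding S using that by (intro sigma_sets.Basic UnI1) blast
  show "{x \<in> space M. P (N w x)} \<in> sets (split_history M b V N u)"
    if "w \<in> vertices b" "\<not> strict_prefix u w"
  proof -
    have "{x \<in> space M. P (N w x)} = N w -` {m. P m} \<inter> space M" by auto
    then show ?thesis unfolding S using that by (intro sigma_sets.Basic UnI2) blast
  qed
qed

text \<open>
  The defining property of conditional expectation, on an event that fixes \<open>N u\<close>.
\<close>

lemma prob_children_given_history:
  assumes u: "u \<in> vertices b" and D: "D \<in> sets (split_history M b V N u)"
    and Dm: "\<And>x. x \<in> D \<Longrightarrow> N u x = m"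
  shows "prob (D \<inter> (children_are u k))
       = (\<integral>x\<in>D. split_prob b s s0 s1 m (V u x) k \<partial>M)"
proof -
  let ?C = "(children_are u k)"
  have sub: "subalgebra M (split_history M b V N u)"
    using history_sets_subset space_history by (simp add: subalgebra_def)
  interpret H: finite_measure_subalgebra M "split_history M b V N u"
    by unfold_locales (rule sub)
  have DM: "D \<in> events" using D history_sets_subset by auto
  have C: "?C \<in> events" by (rule children_event[OF u])
  have "emeasure M ?C < \<infinity>" by (simp add: emeasure_eq_measure)
  then have int: "integrable M (indicator ?C :: 'a \<Rightarrow> real)" by (rule integrable_real_indicator[OF C])
  have f: "(\<lambda>x. split_prob b s s0 s1 m (V u x) k) \<in> borel_measurable M"
  proof (rule measurable_compose[OF split_vector_measurable[OF u]])
    show "(\<lambda>v. split_prob b s s0 s1 m v k) \<in> borel_measurable (split_space b)"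
      using measurable_split_prob measurable_cong_sets[OF sets_split refl] by blast
  qed
  have "prob (D \<inter> ?C) = (\<integral>x. indicator (D \<inter> ?C) x \<partial>M)"
    by (simp only: Bochner_Integration.integral_indicator sets.Int_space_eq2[OF sets.Int[OF DM C]])
  also have "\<dots> = (\<integral>x\<in>D. indicator ?C x \<partial>M)"
    unfolding set_lebesgue_integral_def indicator_inter_arith real_scaleR_def ..
  also have "\<dots> = (\<integral>x\<in>D. real_cond_exp M (split_history M b V N u) (indicator ?C) x \<partial>M)"
    by (rule H.real_cond_exp_intA[OF int D])
  also have "\<dots> = (\<integral>x\<in>D. split_prob b s s0 s1 m (V u x) k \<partial>M)"
    unfolding set_lebesgue_integral_def
  proof (rule integral_cong_AE)
    show "AE x in M. indicator D x *\<^sub>R real_cond_exp M (split_history M b V N u) (indicator ?C) x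
        = indicator D x *\<^sub>R split_prob b s s0 s1 m (V u x) k"
      using split_cond[OF u, of k] by eventually_elim (auto simp: indicator_def Dm)
  qed (use DM f in \<open>auto intro!: borel_measurable_times\<close>)
  finally show ?thesis .
qed

lemma split_prob_eq_0:
  assumes "\<not> conserved b s s0 m k"
  shows "split_prob b s s0 s1 m v k = 0"
proof (cases "m \<le> s")
  case True
  then show ?thesis using assms by (simp add: split_prob_def conserved_def)
next
  case False
  then have ne: "s0 + (\<Sum>i<b. k i) \<noteq> m" using assms by (simp add: conserved_def)
  have "(\<Sum>i<b. k i - s1) \<noteq> m - s0 - b * s1" if "\<forall>i<b. s1 \<le> k i"
  proof
    assume eq: "(\<Sum>i<b. k i - s1) = m - s0 - b * s1"
    have "(\<Sum>i<b. k i) = (\<Sum>i<b. (k i - s1) + s1)"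
      using that by (intro sum.cong) auto
    also have "\<dots> = (\<Sum>i<b. k i - s1) + b * s1" by (simp only: sum.distrib) simp
    finally show False using eq ne initial_balls_le[of m] False by linarith
  qed
  then show ?thesis using False by (simp add: split_prob_def multinomial_prob_def)
qed

text \<open>
  The children counts take countably many values, and those violating conservation have conditional
  probability \<open>0\<close>.
\<close>

lemma AE_conserved:
  assumes u: "u \<in> vertices b"
  shows "AE x in M. conserved b s s0 (N u x) (\<lambda>i. N (u @ [i]) x)"
proof -
  let ?K = "{(m, k). k \<in> {..<b} \<rightarrow>\<^sub>E (UNIV::nat set) \<and> \<not> conserved b s s0 m k}"
  have "countable ((UNIV :: nat set) \<times> ({..<b} \<rightarrow>\<^sub>E (UNIV :: nat set)))"
    by (intro countable_SIGMA countable_PiE) auto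
  then have count: "countable ?K" by (rule countable_subset[rotated]) auto
  have "AE x in M. \<forall>mk\<in>?K. \<not> (N u x = fst mk \<and> (\<forall>i<b. N (u @ [i]) x = snd mk i))"
  proof (rule AE_ball_countable'[OF _ count])
    fix mk assume "mk \<in> ?K"
    then obtain m k where mk: "mk = (m, k)" and nc: "\<not> conserved b s s0 m k" by auto
    let ?D = "(count_is u m)"
    have ev: "{x \<in> space M. N u x = m \<and> (\<forall>i<b. N (u @ [i]) x = k i)} \<in> events"
      using sets.Int[OF count_event[OF u, of "\<lambda>j. j = m"] children_event[OF u, of k]]
      by (simp add: Int_def conj_ac cong: conj_cong)
    have "prob (?D \<inter> (children_are u k))
        = (\<integral>x\<in>?D. split_prob b s s0 s1 m (V u x) k \<partial>M)"
      by (rule prob_children_given_history[OF u]) (auto intro: history_count[OF u])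
    also have "\<dots> = 0" by (simp add: split_prob_eq_0[OF nc])
    also have "?D \<inter> (children_are u k)
       = {x \<in> space M. N u x = m \<and> (\<forall>i<b. N (u @ [i]) x = k i)}" by auto
    finally show "AE x in M. \<not> (N u x = fst mk \<and> (\<forall>i<b. N (u @ [i]) x = snd mk i))"
      using prob_Collect_eq_0[OF ev] by (simp add: mk)
  qed
  then show ?thesis
  proof eventually_elim
    fix x assume *: "\<forall>mk\<in>?K. \<not> (N u x = fst mk \<and> (\<forall>i<b. N (u @ [i]) x = snd mk i))"
    define k where "k = (\<lambda>i\<in>{..<b}. N (u @ [i]) x)"
    have "(N u x, k) \<notin> ?K"
    proof
      assume "(N u x, k) \<in> ?K"
      with * have "\<not> (N u x = fst (N u x, k) \<and> (\<forall>i<b. N (u @ [i]) x = snd (N u x, k) i))" by blast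
      then show False by (simp add: k_def)
    qed
    then have "conserved b s s0 (N u x) k" by (simp add: k_def)
    moreover have "(\<Sum>i<b. k i) = (\<Sum>i<b. N (u @ [i]) x)" by (intro sum.cong) (simp_all add: k_def)
    moreover have "(\<forall>i<b. k i = 0) \<longleftrightarrow> (\<forall>i<b. N (u @ [i]) x = 0)" by (simp add: k_def)
    ultimately show "conserved b s s0 (N u x) (\<lambda>i. N (u @ [i]) x)" by (simp only: conserved_def)
  qed
qed

lemma conserved_child_le: "conserved b s s0 m k \<Longrightarrow> i < b \<Longrightarrow> k i \<le> m"
  using component_le_sum_nat[of i b k] by (auto simp: conserved_def split: if_splits)

lemma AE_count_le: "u \<in> vertices b \<Longrightarrow> AE x in M. N u x \<le> n"
proof (induction u rule: rev_induct)
  case Nil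
  show ?case using count_root by eventually_elim simp
next
  case (snoc i u)
  then have u: "u \<in> vertices b" and i: "i < b" by auto
  show ?case using snoc.IH[OF u] AE_conserved[OF u]
    by eventually_elim (metis conserved_child_le[OF _ i] order_trans)
qed

text \<open>
  Since counts are almost surely at most \<open>n\<close>, finitely many values of the children counts suffice.
\<close>

definition configurations :: "(nat \<Rightarrow> nat) set" where
  "configurations = {..<b} \<rightarrow>\<^sub>E {..n}"

lemma finite_configurations: "finite configurations"
  unfolding configurations_def by (intro finite_PiE) auto

lemma prob_decompose:
  assumes u: "u \<in> vertices b" and B: "B \<in> events"
  shows "prob (B \<inter> {x \<in> space M. Q (N u x) (\<lambda>i\<in>{..<b}. N (u @ [i]) x)})
    = (\<Sum>m\<le>n. \<Sum>k | k \<in> configurations \<and> Q m k.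
         prob (B \<inter> (count_is u m) \<inter> (children_are u k)))"
proof -
  let ?S = "\<lambda>x. (N u x, \<lambda>i\<in>{..<b}. N (u @ [i]) x)"
  let ?I = "SIGMA m:{..n}. {k \<in> configurations. Q m k}"
  let ?A = "\<lambda>(m, k). B \<inter> (count_is u m) \<inter> (children_are u k)"
  have fin: "finite ?I" using finite_configurations by auto
  have A: "?A ` ?I \<subseteq> events"
  proof (rule image_subsetI)
    fix mk :: "nat \<times> (nat \<Rightarrow> nat)"
    show "?A mk \<in> events"
      unfolding split_def using B by (intro sets.Int count_event[OF u] children_event[OF u])
  qed
  have disj: "disjoint_family_on ?A ?I"
  proof (unfold disjoint_family_on_def, intro ballI impI)
    fix mk nl assume mk: "mk \<in> ?I" and nl: "nl \<in> ?I" and ne: "mk \<noteq> nl"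
    obtain m k l j where eq: "mk = (m, k)" "nl = (l, j)" by fastforce
    have "k = j" if "\<And>i. i < b \<Longrightarrow> k i = j i"
      using mk nl eq that unfolding configurations_def
      by (intro PiE_ext[of k "{..<b}" "\<lambda>_. {..n}" j]) auto
    then show "?A mk \<inter> ?A nl = {}" using ne eq by fastforce
  qed
  have "AE x in M. N u x \<le> n \<and> (\<forall>i\<in>{..<b}. N (u @ [i]) x \<le> n)"
    by (intro AE_conjI AE_count_le u AE_finite_allI child_vertex) auto
  then have ae: "AE x in M. x \<in> B \<inter> {x \<in> space M. Q (N u x) (\<lambda>i\<in>{..<b}. N (u @ [i]) x)}
      \<longleftrightarrow> x \<in> (\<Union>mk\<in>?I. ?A mk)"
  proof eventually_elim
    fix x assume le: "N u x \<le> n \<and> (\<forall>i\<in>{..<b}. N (u @ [i]) x \<le> n)"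
    have conf: "(\<lambda>i\<in>{..<b}. N (u @ [i]) x) \<in> configurations"
      using le by (auto simp: configurations_def)
    have uniq: "k = (\<lambda>i\<in>{..<b}. N (u @ [i]) x)"
      if "k \<in> configurations" "\<forall>i<b. N (u @ [i]) x = k i" for k
      using that conf unfolding configurations_def by (intro PiE_ext[of k "{..<b}" "\<lambda>_. {..n}"]) auto
    show "x \<in> B \<inter> {x \<in> space M. Q (N u x) (\<lambda>i\<in>{..<b}. N (u @ [i]) x)} \<longleftrightarrow> x \<in> (\<Union>mk\<in>?I. ?A mk)"
    proof
      assume x: "x \<in> B \<inter> {x \<in> space M. Q (N u x) (\<lambda>i\<in>{..<b}. N (u @ [i]) x)}"
      show "x \<in> (\<Union>mk\<in>?I. ?A mk)"
        by (rule UN_I[of "?S x"]) (use x conf le in auto)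
    next
      assume "x \<in> (\<Union>mk\<in>?I. ?A mk)"
      then show "x \<in> B \<inter> {x \<in> space M. Q (N u x) (\<lambda>i\<in>{..<b}. N (u @ [i]) x)}"
        using uniq by auto
    qed
  qed
  have meas: "B \<inter> {x \<in> space M. Q (N u x) (\<lambda>i\<in>{..<b}. N (u @ [i]) x)} \<in> events"
  proof -
    let ?f = "\<lambda>x. (N u x, \<lambda>i\<in>{..<b}. N (u @ [i]) x)"
    have cnt: "countable ((UNIV :: nat set) \<times> ({..<b} \<rightarrow>\<^sub>E (UNIV :: nat set)))"
      by (intro countable_SIGMA countable_PiE) auto
    let ?J = "{mk \<in> (UNIV :: nat set) \<times> ({..<b} \<rightarrow>\<^sub>E (UNIV :: nat set)). Q (fst mk) (snd mk)}"
    have cJ: "countable ?J" using cnt by (rule countable_subset[rotated]) auto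
    have "B \<inter> {x \<in> space M. Q (N u x) (\<lambda>i\<in>{..<b}. N (u @ [i]) x)}
        = (\<Union>mk\<in>?J. B \<inter> (count_is u (fst mk)) \<inter> (children_are u (snd mk)))"
    proof (intro equalityI subsetI)
      fix x assume x: "x \<in> B \<inter> {x \<in> space M. Q (N u x) (\<lambda>i\<in>{..<b}. N (u @ [i]) x)}"
      show "x \<in> (\<Union>mk\<in>?J. B \<inter> (count_is u (fst mk)) \<inter> (children_are u (snd mk)))"
        by (rule UN_I[of "?f x"]) (use x in auto)
    next
      fix x assume "x \<in> (\<Union>mk\<in>?J. B \<inter> (count_is u (fst mk)) \<inter> (children_are u (snd mk)))"
      then obtain m k where x: "x \<in> B" "x \<in> space M" "N u x = m" "\<forall>i<b. N (u @ [i]) x = k i"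
        and k: "k \<in> {..<b} \<rightarrow>\<^sub>E UNIV" "Q m k" by auto
      have "k = (\<lambda>i\<in>{..<b}. N (u @ [i]) x)"
        using x k by (intro PiE_ext[of k "{..<b}" "\<lambda>_. UNIV"]) auto
      then show "x \<in> B \<inter> {x \<in> space M. Q (N u x) (\<lambda>i\<in>{..<b}. N (u @ [i]) x)}" using x k by auto
    qed
    also have "\<dots> \<in> events"
      using B by (intro sets.countable_UN'' cJ sets.Int count_event[OF u] children_event[OF u])
    finally show ?thesis .
  qed
  have "prob (B \<inter> {x \<in> space M. Q (N u x) (\<lambda>i\<in>{..<b}. N (u @ [i]) x)}) = prob (\<Union>mk\<in>?I. ?A mk)"
    by (intro finite_measure_eq_AE ae meas) (use A fin in auto)
  also have "\<dots> = (\<Sum>mk\<in>?I. prob (?A mk))"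
    by (rule finite_measure_finite_Union[OF fin A disj])
  also have "\<dots> = (\<Sum>m\<le>n. \<Sum>k | k \<in> configurations \<and> Q m k. prob (?A (m, k)))"
    using finite_configurations by (subst sum.Sigma) (auto intro!: sum.cong)
  finally show ?thesis by simp
qed

text \<open>
  For finite \<open>J\<close> these events carry the induction below: independence of the counts from all of them
  suffices to integrate over one further split vector.
\<close>

definition split_box :: "nat list set \<Rightarrow> (nat list \<Rightarrow> (nat \<Rightarrow> real) set) \<Rightarrow> 'a set" where
  "split_box J A = {x \<in> space M. \<forall>j\<in>J. V j x \<in> A j}"

lemma split_box_history:
  assumes "finite J" "J \<subseteq> vertices b" "\<And>j. j \<in> J \<Longrightarrow> A j \<in> sets (split_space b)"
  shows "split_box J A \<in> sets (split_history M b V N u)"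
proof -
  let ?H = "split_history M b V N u"
  have "{x \<in> space ?H. V j x \<in> A j} \<in> sets ?H" if "j \<in> J" for j
  proof -
    have "V j -` A j \<inter> space M \<in> sets ?H" using that assms by (intro history_split) auto
    then show ?thesis unfolding space_history by (simp add: vimage_def Int_def conj_commute)
  qed
  then have "{x \<in> space ?H. \<forall>j\<in>J. V j x \<in> A j} \<in> sets ?H"
    using assms(1) by (intro sets.sets_Collect_finite_All) auto
  then show ?thesis unfolding split_box_def space_history .
qed

lemma split_box_event:
  assumes "finite J" "J \<subseteq> vertices b" "\<And>j. j \<in> J \<Longrightarrow> A j \<in> sets (split_space b)"
  shows "split_box J A \<in> events"
  by (rule subsetD[OF history_sets_subset[of "[]"] split_box_history[OF assms]])

lemma prob_split_box_insert:
  assumes J: "finite J" "J \<subseteq> vertices b" "\<And>j. j \<in> J \<Longrightarrow> A j \<in> sets (split_space b)"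
    and u: "u \<in> vertices b" "u \<notin> J" "B \<in> sets (split_space b)"
  shows "prob (split_box (insert u J) (A(u := B))) = prob (V u -` B \<inter> space M) * prob (split_box J A)"
proof (cases "J = {}")
  case True
  have "split_box (insert u J) (A(u := B)) = V u -` B \<inter> space M" "split_box J A = space M"
    by (auto simp: True split_box_def)
  then show ?thesis by (simp add: prob_space)
next
  case False
  have box: "split_box K C = (\<Inter>j\<in>K. V j -` C j \<inter> space M)" if "K \<noteq> {}" for K C
    using that by (auto simp: split_box_def)
  have "prob (split_box (insert u J) (A(u := B)))
     = (\<Prod>j\<in>insert u J. prob (V j -` (A(u := B)) j \<inter> space M))"
    unfolding box[OF insert_not_empty] using J u
    by (intro indep_varsD[OF split_indep]) auto
  also have "\<dots> = prob (V u -` B \<inter> space M) * (\<Prod>j\<in>J. prob (V j -` (A(u := B)) j \<inter> space M))"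
    using J u by simp
  also have "(\<Prod>j\<in>J. prob (V j -` (A(u := B)) j \<inter> space M)) = (\<Prod>j\<in>J. prob (V j -` A j \<inter> space M))"
    using u by (intro prod.cong) auto
  also have "\<dots> = prob (split_box J A)"
    unfolding box[OF False] using J False by (intro indep_varsD[OF split_indep, symmetric]) auto
  finally show ?thesis .
qed

text \<open>
  Induction along the path from the root to \<open>u\<close> shows that \<open>N u\<close> is independent of finitely many split
  vectors \<open>V j\<close> as long as no \<open>j\<close> lies strictly above \<open>u\<close>. In the induction step the children counts of
  \<open>u\<close> have to be integrated over \<open>V u\<close>; this is possible because \<open>u\<close> itself is among the admissible \<open>j\<close>,
  so \<open>V u\<close> is independent of \<open>N u\<close> together with the other vectors.
\<close>

lemma prob_children_and_splits:
  assumes u: "u \<in> vertices b" "u \<notin> J"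
    and J: "finite J" "J \<subseteq> vertices b" "\<And>j. j \<in> J \<Longrightarrow> \<not> strict_prefix j u"
      "\<And>j. j \<in> J \<Longrightarrow> A j \<in> sets (split_space b)"
  shows "prob ((count_is u m) \<inter> split_box J A \<inter> (children_are u k))
       = prob (count_is u m) * prob (split_box J A) * offspring_prob m k"
proof -
  have joint: "prob ((count_is u m) \<inter> split_box J A \<inter> (children_are u k))
       = prob (count_is u m) * prob (split_box J A) * offspring_prob m k"
    if IH: "\<And>J A. finite J \<Longrightarrow> J \<subseteq> vertices b \<Longrightarrow> (\<And>j. j \<in> J \<Longrightarrow> \<not> strict_prefix j u) \<Longrightarrow>
        (\<And>j. j \<in> J \<Longrightarrow> A j \<in> sets (split_space b)) \<Longrightarrow>
        prob ((count_is u m) \<inter> split_box J A)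
          = prob (count_is u m) * prob (split_box J A)"
      and u: "u \<in> vertices b" "u \<notin> J"
      and J: "finite J" "J \<subseteq> vertices b" "\<And>j. j \<in> J \<Longrightarrow> \<not> strict_prefix j u"
        "\<And>j. j \<in> J \<Longrightarrow> A j \<in> sets (split_space b)"
    for u J A m k
  proof -
    let ?D = "(count_is u m) \<inter> split_box J A"
    have D: "?D \<in> sets (split_history M b V N u)"
      using J u by (intro sets.Int history_count split_box_history) auto
    have DM: "?D \<in> events" using D history_sets_subset by auto
    have "prob (?D \<inter> (children_are u k))
        = (\<integral>x\<in>?D. split_prob b s s0 s1 m (V u x) k \<partial>M)"
      by (rule prob_children_given_history[OF u(1) D]) auto
    also have "\<dots> = prob ?D * (\<integral>v. split_prob b s s0 s1 m v k \<partial>distr M (split_space b) (V u))"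
    proof (rule integral_indep_event[OF DM split_vector_measurable[OF u(1)]])
      show "(\<lambda>v. split_prob b s s0 s1 m v k) \<in> borel_measurable (split_space b)"
        using measurable_split_prob measurable_cong_sets[OF sets_split refl] by blast
      fix B assume B: "B \<in> sets (split_space b)"
      have "?D \<inter> (V u -` B \<inter> space M) = (count_is u m) \<inter> split_box (insert u J) (A(u := B))"
        using u(2) by (auto simp: split_box_def)
      also have "prob \<dots> = prob (count_is u m) * prob (split_box (insert u J) (A(u := B)))"
        using J u B by (intro IH) auto
      also have "\<dots> = prob (count_is u m) * prob (split_box J A) * prob (V u -` B \<inter> space M)"
        using prob_split_box_insert[OF J(1,2,4) u B] by simp
      also have "prob (count_is u m) * prob (split_box J A) = prob ?D"
        using J by (intro IH[symmetric]) auto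
      finally show "prob (?D \<inter> (V u -` B \<inter> space M)) = prob ?D * prob (V u -` B \<inter> space M)" .
    qed
    also have "distr M (split_space b) (V u) = \<nu>" by (rule split_law[OF u(1)])
    also have "prob ?D = prob (count_is u m) * prob (split_box J A)"
      using J by (intro IH) auto
    finally show ?thesis unfolding offspring_prob_def .
  qed
  have main: "prob ((count_is u m) \<inter> split_box J A)
       = prob (count_is u m) * prob (split_box J A)"
    if "u \<in> vertices b" "finite J" "J \<subseteq> vertices b" "\<And>j. j \<in> J \<Longrightarrow> \<not> strict_prefix j u"
      "\<And>j. j \<in> J \<Longrightarrow> A j \<in> sets (split_space b)" for u J A m
    using that
  proof (induction u arbitrary: J A m rule: rev_induct)
    case Nil
    have ev: "(count_is [] m) \<in> events" by (rule count_event) simp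
    have box: "split_box J A \<in> events" using Nil by (intro split_box_event) auto
    show ?case
    proof (cases "m = n")
      case True
      have "AE x in M. x \<in> (count_is [] m) \<inter> split_box J A \<longleftrightarrow> x \<in> split_box J A"
        using count_root AE_space by eventually_elim (simp add: True)
      then have "prob ((count_is [] m) \<inter> split_box J A) = prob (split_box J A)"
        using ev box by (intro finite_measure_eq_AE) auto
      moreover have "prob (count_is [] m) = 1"
        unfolding prob_Collect_eq_1[OF ev] using count_root by eventually_elim (simp add: True)
      ultimately show ?thesis by simp
    next
      case False
      have 0: "prob (count_is [] m) = 0"
        unfolding prob_Collect_eq_0[OF ev] using count_root by eventually_elim (use False in simp)
      moreover have "prob ((count_is [] m) \<inter> split_box J A) \<le> prob (count_is [] m)"
        using ev by (intro finite_measure_mono) auto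
      ultimately show ?thesis using measure_nonneg[of M] by (simp add: order_antisym)
    qed
  next
    case (snoc i u)
    have u: "u \<in> vertices b" and i: "i < b" using snoc.prems(1) by auto
    have sp: "\<not> strict_prefix j u" if "j \<in> J" for j
      using snoc.prems(4)[OF that] prefix_order.less_le_trans[of j u "u @ [i]"] by auto
    have uJ: "u \<notin> J" using snoc.prems(4)[of u] by (auto simp: strict_prefix_def)
    define W where "W = (\<Sum>l\<le>n. \<Sum>k | k \<in> configurations \<and> k i = m.
        prob (count_is u l) * offspring_prob l k)"
    have *: "prob (split_box K C \<inter> (count_is (u @ [i]) m)) = prob (split_box K C) * W"
      if "finite K" "K \<subseteq> vertices b" "\<And>j. j \<in> K \<Longrightarrow> \<not> strict_prefix j u" "u \<notin> K"
        "\<And>j. j \<in> K \<Longrightarrow> C j \<in> sets (split_space b)" for K C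
    proof -
      have "prob (split_box K C \<inter> (count_is (u @ [i]) m))
          = prob (split_box K C \<inter> {x \<in> space M. (\<lambda>i\<in>{..<b}. N (u @ [i]) x) i = m})"
        using i by simp
      also have "\<dots> = (\<Sum>l\<le>n. \<Sum>k | k \<in> configurations \<and> k i = m.
         prob (split_box K C \<inter> (count_is u l) \<inter> (children_are u k)))"
        using that by (intro prob_decompose[OF u] split_box_event) auto
      also have "\<dots> = (\<Sum>l\<le>n. \<Sum>k | k \<in> configurations \<and> k i = m.
         prob (split_box K C) * (prob (count_is u l) * offspring_prob l k))"
      proof (intro sum.cong refl)
        fix l k
        have "prob ((count_is u l) \<inter> split_box K C \<inter> (children_are u k))
            = prob (count_is u l) * prob (split_box K C) * offspring_prob l k"
          by (rule joint[OF snoc.IH[OF u] u that(4) that(1,2,3,5)])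
        then show "prob (split_box K C \<inter> (count_is u l) \<inter> (children_are u k))
            = prob (split_box K C) * (prob (count_is u l) * offspring_prob l k)"
          by (simp add: Int_commute mult_ac)
      qed
      also have "\<dots> = prob (split_box K C) * W" unfolding W_def by (simp add: sum_distrib_left)
      finally show ?thesis .
    qed
    have "prob (count_is (u @ [i]) m) = W"
      using *[of "{}" A] prob_space by (simp add: split_box_def Int_def conj_ac)
    moreover have "prob (split_box J A \<inter> (count_is (u @ [i]) m)) = prob (split_box J A) * W"
      using snoc.prems sp uJ by (intro *) auto
    ultimately show ?case by (simp add: Int_commute mult.commute)
  qed
  show ?thesis
  proof (rule joint[OF _ u J])
    fix K C assume "finite K" "K \<subseteq> vertices b" "\<And>j. j \<in> K \<Longrightarrow> \<not> strict_prefix j u"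
      "\<And>j. j \<in> K \<Longrightarrow> C j \<in> sets (split_space b)"
    then show "prob ((count_is u m) \<inter> split_box K C)
        = prob (count_is u m) * prob (split_box K C)" by (rule main[OF u(1)])
  qed
qed

text \<open>
  The transition probabilities from a vertex to its children. From here on the split vectors enter only
  through averages over their law.
\<close>

theorem offspring_law:
  assumes u: "u \<in> vertices b"
  shows "prob {x \<in> space M. N u x = m \<and> (\<forall>i<b. N (u @ [i]) x = k i)}
       = prob (count_is u m) * offspring_prob m k"
proof -
  have "prob ((count_is u m) \<inter> split_box {} (\<lambda>_. {}) \<inter> (children_are u k))
       = prob (count_is u m) * prob (split_box {} (\<lambda>_. {})) * offspring_prob m k"
    by (rule prob_children_and_splits[OF u]) simp_all
  moreover have "split_box {} (\<lambda>_. {}) = space M" by (simp add: split_box_def)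
  moreover have "(count_is u m) \<inter> space M \<inter> (children_are u k)
      = {x \<in> space M. N u x = m \<and> (\<forall>i<b. N (u @ [i]) x = k i)}" by auto
  ultimately show ?thesis by (simp add: prob_space)
qed

end

section \<open>Supersolutions of the splitting recursion\<close>

context nondegenerate_split begin

text \<open>
  A function that dominates its own one-step recursion: the charge \<open>\<phi> m\<close> of a vertex with \<open>m\<close> balls plus
  \<open>q\<close> times the expected sum of \<open>f\<close> over its children. At leaves \<open>m \<le> s\<close>, which have no balls to pass on,
  only \<open>\<phi> m \<le> f m\<close> is asked, and \<open>f 0 = 0\<close> makes the empty subtrees free.
\<close>

definition supersolution :: "real \<Rightarrow> (nat \<Rightarrow> real) \<Rightarrow> (nat \<Rightarrow> real) \<Rightarrow> bool" where
  "supersolution q \<phi> f \<longleftrightarrow> 0 \<le> q \<and> (\<forall>m. 0 \<le> \<phi> m \<and> \<phi> m \<le> f m) \<and> f 0 = 0 \<and>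
     (\<forall>m>s. \<phi> m + q * offspring_mean m f \<le> f m)"

definition square_const :: real where "square_const = 4 / (1 - mean_square)"

lemma square_const_ge_1: "1 \<le> square_const"
proof -
  have "0 \<le> mean_square" by (simp add: mean_square_def)
  then show ?thesis using mean_square_less_1 by (simp add: square_const_def field_simps)
qed

lemma offspring_mean_square_le:
  assumes "s < m"
  shows "square_const * offspring_mean m (\<lambda>k. (real k)\<^sup>2) \<le> square_const * (real m)\<^sup>2 - (real m)\<^sup>2"
proof -
  have "square_const * offspring_mean m (\<lambda>k. (real k)\<^sup>2)
      \<le> square_const * ((real m)\<^sup>2 * (1 - (1 - mean_square) / 4))"
    using offspring_mean_square[OF assms] square_const_ge_1 by (intro mult_left_mono) auto
  also have "\<dots> = square_const * (real m)\<^sup>2 - (real m)\<^sup>2 * (square_const * ((1 - mean_square) / 4))"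
    by (simp add: algebra_simps)
  also have "square_const * ((1 - mean_square) / 4) = 1"
    using mean_square_less_1 by (simp add: square_const_def)
  finally show ?thesis by simp
qed

text \<open>
  The sum of squares decays geometrically over the generations, so its total over the tree is a
  multiple of the first term.
\<close>

lemma supersolution_square:
  "supersolution 1 (\<lambda>m. (real m)\<^sup>2) (\<lambda>m. square_const * (real m)\<^sup>2)"
proof -
  have "(real m)\<^sup>2 \<le> square_const * (real m)\<^sup>2" for m
    using mult_right_mono[OF square_const_ge_1, of "(real m)\<^sup>2"] by simp
  moreover have "(real m)\<^sup>2 + offspring_mean m (\<lambda>m. square_const * (real m)\<^sup>2) \<le> square_const * (real m)\<^sup>2"
    if "s < m" for m
    using offspring_mean_square_le[OF that] unfolding offspring_mean_cmult by linarith
  ultimately show ?thesis by (simp add: supersolution_def)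
qed

text \<open>
  For \<open>m > K\<close> the drift \<open>- \<mu> m\<close> of \<open>m ln m\<close>, multiplied by \<open>(1 + e) / \<mu>\<close>, pays the charge \<open>m\<close> and the
  surplus \<open>e m\<close> pays the logarithmic error. For \<open>m \<le> K\<close> that error may be too large; there
  \<open>m ln m\<close> at least does not grow, as \<open>ln k \<le> ln m\<close> for the count \<open>k\<close> of a child, and the decay of
  \<open>m\<^sup>2\<close> pays the charge. Cutting off \<open>m\<^sup>2\<close> at \<open>K m\<close> makes the correction linear in the end, and a split
  does not increase linear functions.
\<close>

lemma supersolution_path_length:
  assumes e: "0 < e"
  obtains K :: nat where
    "supersolution 1 real (\<lambda>m. (1 + e) / split_mu b \<nu> * (real m * ln (real m))
        + square_const * min ((real m)\<^sup>2) (real K * real m))"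
proof -
  define \<mu> where "\<mu> = split_mu b \<nu>"
  have mu: "0 < \<mu>" using split_mu_pos by (simp add: \<mu>_def)
  define C1 where "C1 = real b * (real s1 + 1 + (real s0 + real b * real s1))"
  define C2 where "C2 = real b * real s1"
  have "\<forall>\<^sub>F m in sequentially. (1 + e) / \<mu> * (C1 + C2 * ln (real m)) \<le> e * real m"
  proof -
    have "(\<lambda>m. (1 + e) / \<mu> * (C1 * (1 / real m) + C2 * (ln (real m) / real m)))
        \<longlonglongrightarrow> (1 + e) / \<mu> * (C1 * 0 + C2 * 0)"
      by (intro tendsto_intros lim_1_over_n lim_ln_over_n)
    then have "\<forall>\<^sub>F m in sequentially. (1 + e) / \<mu> * (C1 * (1 / real m) + C2 * (ln (real m) / real m)) < e"
      by (rule order_tendstoD) (use e in simp)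
    then show ?thesis using eventually_gt_at_top[of 0]
    proof eventually_elim
      fix m :: nat
      assume lt: "(1 + e) / \<mu> * (C1 * (1 / real m) + C2 * (ln (real m) / real m)) < e" and m: "0 < m"
      have "(1 + e) / \<mu> * (C1 + C2 * ln (real m))
          = (1 + e) / \<mu> * (C1 * (1 / real m) + C2 * (ln (real m) / real m)) * real m"
        using m by (simp add: distrib_left distrib_right add_divide_distrib)
      also have "\<dots> \<le> e * real m" using lt by (intro mult_right_mono) auto
      finally show "(1 + e) / \<mu> * (C1 + C2 * ln (real m)) \<le> e * real m" .
    qed
  qed
  then obtain K0 where K0: "\<And>m. K0 \<le> m \<Longrightarrow> (1 + e) / \<mu> * (C1 + C2 * ln (real m)) \<le> e * real m"
    by (auto simp: eventually_sequentially)
  define K where "K = Suc K0"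
  let ?g = "\<lambda>m. real m * ln (real m)" and ?h = "\<lambda>m. min ((real m)\<^sup>2) (real K * real m)"
  have msq: "real m \<le> (real m)\<^sup>2" for m
    by (cases m) (simp_all add: power2_eq_square)
  have A: "1 \<le> square_const" by (rule square_const_ge_1)
  have le: "real m \<le> (1 + e) / \<mu> * ?g m + square_const * ?h m" for m
  proof -
    have "1 * real m \<le> real K * real m" unfolding K_def by (intro mult_right_mono) auto
    then have "real m \<le> ?h m" using msq[of m] by simp
    also have "\<dots> \<le> square_const * ?h m" using A mult_right_mono[OF A, of "?h m"] by simp
    also have "0 \<le> (1 + e) / \<mu> * ?g m"
      using e mu by (cases m) auto
    then have "square_const * ?h m \<le> (1 + e) / \<mu> * ?g m + square_const * ?h m" by simp
    finally show ?thesis .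
  qed
  have step: "real m + offspring_mean m (\<lambda>m. (1 + e) / \<mu> * ?g m + square_const * ?h m)
      \<le> (1 + e) / \<mu> * ?g m + square_const * ?h m" if m: "s < m" for m
  proof (cases "m \<le> K")
    case True
    have m1: "0 \<le> ln (real m)" using m by simp
    have "offspring_mean m ?g \<le> offspring_mean m (\<lambda>k. ln (real m) * real k)"
    proof (rule offspring_mean_mono)
      fix k assume "k \<le> m"
      then show "real k * ln (real k) \<le> ln (real m) * real k"
        by (cases k) (auto simp: mult.commute intro!: mult_left_mono simp del: of_nat_Suc)
    qed
    also have "\<dots> \<le> ln (real m) * real m"
      unfolding offspring_mean_cmult using offspring_mean_id[OF m] m1 by (intro mult_left_mono) auto
    finally have 1: "(1 + e) / \<mu> * offspring_mean m ?g \<le> (1 + e) / \<mu> * ?g m"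
      using e mu by (intro mult_left_mono) (auto simp: mult.commute)
    have "offspring_mean m ?h \<le> offspring_mean m (\<lambda>k. (real k)\<^sup>2)"
      by (rule offspring_mean_mono) simp
    then have "square_const * offspring_mean m ?h \<le> square_const * offspring_mean m (\<lambda>k. (real k)\<^sup>2)"
      using A by (intro mult_left_mono) auto
    then have 2: "square_const * offspring_mean m ?h \<le> square_const * (real m)\<^sup>2 - real m"
      using offspring_mean_square_le[OF m] msq[of m] by linarith
    have "(real m)\<^sup>2 \<le> real K * real m"
      using True by (simp add: power2_eq_square mult_right_mono)
    then have "?h m = (real m)\<^sup>2" by simp
    then show ?thesis using 1 2
      unfolding offspring_mean_add offspring_mean_cmult by linarith
  next
    case False
    have "real K * real m \<le> (real m)\<^sup>2"
      using False by (simp add: power2_eq_square mult_right_mono)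
    then have h: "?h m = real K * real m" by simp
    have "offspring_mean m ?h \<le> offspring_mean m (\<lambda>k. real K * real k)"
      by (rule offspring_mean_mono) simp
    also have "\<dots> \<le> real K * real m"
      unfolding offspring_mean_cmult using offspring_mean_id[OF m] by (intro mult_left_mono) auto
    finally have 2: "square_const * offspring_mean m ?h \<le> square_const * (real K * real m)"
      using A by (intro mult_left_mono) auto
    have "offspring_mean m ?g \<le> ?g m - \<mu> * real m + C1 + C2 * ln (real m)"
      using offspring_mean_mult_ln[OF m] by (simp add: C1_def C2_def \<mu>_def)
    then have "(1 + e) / \<mu> * offspring_mean m ?g \<le> (1 + e) / \<mu> * (?g m - \<mu> * real m + C1 + C2 * ln (real m))"
      using e mu by (intro mult_left_mono) auto
    also have "\<dots> = (1 + e) / \<mu> * ?g m - (1 + e) * real m + (1 + e) / \<mu> * (C1 + C2 * ln (real m))"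
      using mu by (simp add: field_simps)
    also have "(1 + e) / \<mu> * (C1 + C2 * ln (real m)) \<le> e * real m"
      using False by (intro K0) (simp add: K_def)
    finally have 1: "(1 + e) / \<mu> * offspring_mean m ?g \<le> (1 + e) / \<mu> * ?g m - real m"
      by (simp add: algebra_simps)
    show ?thesis using 1 2 unfolding offspring_mean_add offspring_mean_cmult h by linarith
  qed
  have "supersolution 1 real (\<lambda>m. (1 + e) / \<mu> * ?g m + square_const * ?h m)"
    unfolding supersolution_def using le step by simp
  then show ?thesis using that unfolding \<mu>_def by blast
qed

text \<open>
  Up to \<open>K\<close> the function is the identity, a supersolution by conservation of balls. Above \<open>K\<close> it is a
  multiple of \<open>m powr (1 - d)\<close>, which one split multiplies by \<open>q * powr_moment (1 - d) \<le> 1\<close>; the gap to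
  \<open>1\<close> is assumed large enough to pay for the constant \<open>s\<^sub>0 + b s\<^sub>1\<close> from \<open>m = K\<close> on. The minimum of the two
  is at most each of them at every child, so no matching condition arises at \<open>K\<close>.
\<close>

lemma supersolution_powr:
  assumes q: "0 \<le> q" "q \<le> 1" and d: "0 \<le> d" "d < 1" and K: "1 \<le> K" "real s \<le> K"
    and pos: "q * powr_moment (1 - d) \<le> 1"
    and gap: "real s0 + real b * real s1 \<le> K powr (1 - d) * (1 - q * powr_moment (1 - d))"
  shows "supersolution q (\<lambda>m. real (balls_at s s0 m)) (\<lambda>m. min (real m) (K powr d * real m powr (1 - d)))"
proof -
  let ?H = "\<lambda>m::nat. min (real m) (K powr d * real m powr (1 - d))"
  have Kd: "1 \<le> K powr d" using K d by (intro ge_one_powr_ge_zero) auto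
  have split: "x = x powr d * x powr (1 - d)" if "0 \<le> x" for x :: real
    using that by (cases "x = 0") (auto simp flip: powr_add)
  have small: "real m \<le> K powr d * real m powr (1 - d)" if "real m \<le> K" for m
  proof -
    have "real m = real m powr d * real m powr (1 - d)" by (rule split) simp
    also have "\<dots> \<le> K powr d * real m powr (1 - d)"
      using that d by (intro mult_right_mono powr_mono2) auto
    finally show ?thesis .
  qed
  have large: "K powr d * real m powr (1 - d) \<le> real m" if "K \<le> real m" for m
  proof -
    have "K powr d * real m powr (1 - d) \<le> real m powr d * real m powr (1 - d)"
      using that d K by (intro mult_right_mono powr_mono2) auto
    also have "\<dots> = real m" by (rule split[symmetric]) simp
    finally show ?thesis .
  qed
  have bal: "real (balls_at s s0 m) \<le> ?H m" for m
  proof (cases "real m \<le> K")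
    case True
    have "balls_at s s0 m \<le> m" using s0_le by (auto simp: balls_at_def)
    then show ?thesis using small[OF True] by simp
  next
    case False
    have "K = K powr d * K powr (1 - d)" using K by (intro split) simp
    also have "\<dots> \<le> K powr d * real m powr (1 - d)"
      using False d K by (intro mult_left_mono powr_mono2) auto
    finally have "K \<le> ?H m" using False by simp
    moreover have "balls_at s s0 m \<le> s" using s0_le by (auto simp: balls_at_def)
    ultimately show ?thesis using K by simp
  qed
  have nn: "0 \<le> offspring_mean m ?H" for m
    unfolding offspring_mean_def by (intro sum_nonneg mult_nonneg_nonneg offspring_prob_nonneg) auto
  have step: "real (balls_at s s0 m) + q * offspring_mean m ?H \<le> ?H m" if m: "s < m" for m
  proof (cases "real m \<le> K")
    case True
    have "offspring_mean m ?H \<le> offspring_mean m real" by (rule offspring_mean_mono) simp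
    then have "q * offspring_mean m ?H \<le> real m - real s0"
      using offspring_mean_id[OF m] mult_left_le_one_le[OF nn q, of m] by linarith
    then show ?thesis using small[OF True] m by (simp add: balls_at_def)
  next
    case False
    have "offspring_mean m ?H \<le> offspring_mean m (\<lambda>k. K powr d * real k powr (1 - d))"
      by (rule offspring_mean_mono) simp
    also have "\<dots> \<le> K powr d * (real m powr (1 - d) * powr_moment (1 - d) + real b * real s1)"
      unfolding offspring_mean_cmult using offspring_mean_powr[OF m, of "1 - d"] d
      by (intro mult_left_mono) auto
    finally have "q * offspring_mean m ?H
        \<le> q * (K powr d * (real m powr (1 - d) * powr_moment (1 - d) + real b * real s1))"
      using q by (intro mult_left_mono)
    also have "\<dots> = K powr d * (real m powr (1 - d) * (q * powr_moment (1 - d)) + q * (real b * real s1))"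
      by (simp add: algebra_simps)
    also have "\<dots> \<le> K powr d * (real m powr (1 - d) * (q * powr_moment (1 - d)) + real b * real s1)"
      using q by (intro mult_left_mono add_left_mono mult_left_le_one_le) auto
    finally have 1: "q * offspring_mean m ?H
        \<le> K powr d * (real m powr (1 - d) * (q * powr_moment (1 - d)) + real b * real s1)" .
    have "real s0 \<le> K powr d * real s0" using mult_right_mono[OF Kd, of "real s0"] by simp
    with 1 have 2: "real s0 + q * offspring_mean m ?H
        \<le> K powr d * (real m powr (1 - d) * (q * powr_moment (1 - d)) + (real s0 + real b * real s1))"
      by (simp add: distrib_left)
    have "K powr (1 - d) * (1 - q * powr_moment (1 - d))
        \<le> real m powr (1 - d) * (1 - q * powr_moment (1 - d))"
      using False d K pos by (intro mult_right_mono powr_mono2) auto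
    then have "real m powr (1 - d) * (q * powr_moment (1 - d)) + (real s0 + real b * real s1)
        \<le> real m powr (1 - d)"
      using gap by (simp add: algebra_simps)
    then have "K powr d * (real m powr (1 - d) * (q * powr_moment (1 - d)) + (real s0 + real b * real s1))
        \<le> K powr d * real m powr (1 - d)" by (intro mult_left_mono) auto
    with 2 have "real s0 + q * offspring_mean m ?H \<le> K powr d * real m powr (1 - d)" by linarith
    moreover have "?H m = K powr d * real m powr (1 - d)" using large[of m] False by simp
    ultimately show ?thesis using m by (simp add: balls_at_def)
  qed
  show ?thesis unfolding supersolution_def using bal step q by simp
qed

end

lemma measurable_nn_integral_count_space:
  fixes f :: "'i \<Rightarrow> 'a \<Rightarrow> ennreal"
  assumes f: "\<And>i. i \<in> I \<Longrightarrow> f i \<in> borel_measurable M" and I: "countable I"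
  shows "(\<lambda>x. \<integral>\<^sup>+i. f i x \<partial>count_space I) \<in> borel_measurable M"
proof (cases "finite I")
  case True
  then show ?thesis using f by (simp add: nn_integral_count_space_finite borel_measurable_sum)
next
  case False
  have bij: "bij_betw (from_nat_into I) UNIV I" by (rule bij_betw_from_nat_into[OF I False])
  have "(\<lambda>x. \<integral>\<^sup>+i. f i x \<partial>count_space I) = (\<lambda>x. \<Sum>k. f (from_nat_into I k) x)"
    by (simp add: nn_integral_bij_count_space[OF bij, symmetric] nn_integral_count_space_nat)
  also have "\<dots> \<in> borel_measurable M"
    using False by (intro borel_measurable_suminf_order f from_nat_into) auto
  finally show ?thesis .
qed

definition generation :: "nat \<Rightarrow> nat \<Rightarrow> nat list set" where
  "generation b j = {u \<in> vertices b. length u = j}"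

lemma generation_0: "generation b 0 = {[]}"
  by (auto simp: generation_def)

lemma generation_Suc: "generation b (Suc j) = (\<lambda>(u, i). u @ [i]) ` (generation b j \<times> {..<b})"
proof (intro equalityI subsetI)
  fix w assume w: "w \<in> generation b (Suc j)"
  then obtain u i where "w = u @ [i]" by (cases w rule: rev_cases) (auto simp: generation_def)
  then show "w \<in> (\<lambda>(u, i). u @ [i]) ` (generation b j \<times> {..<b})"
    using w by (auto simp: generation_def intro!: image_eqI[of _ _ "(u, i)"])
qed (auto simp: generation_def)

lemma finite_generation: "finite (generation b j)"
  by (induction j) (auto simp: generation_0 generation_Suc)

lemma sum_generation_Suc:
  "(\<Sum>w\<in>generation b (Suc j). h w) = (\<Sum>u\<in>generation b j. \<Sum>i<b. h (u @ [i]))"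
  unfolding generation_Suc
  by (subst sum.reindex) (auto simp: inj_on_def sum.cartesian_product case_prod_unfold)

lemma countable_vertices: "countable (vertices b)"
  by (rule countable_subset[OF subset_UNIV]) simp

context split_process begin

lemma count_measurable_borel: "u \<in> vertices b \<Longrightarrow> (\<lambda>x. g (N u x)) \<in> borel_measurable M"
  by (rule measurable_compose[OF count_measurable]) auto

definition count_mean :: "nat list \<Rightarrow> (nat \<Rightarrow> real) \<Rightarrow> real" where
  "count_mean u g = expectation (\<lambda>x. g (N u x))"

lemma count_integrable:
  assumes u: "u \<in> vertices b" shows "integrable M (\<lambda>x. g (N u x) :: real)"
proof (rule integrable_const_bound)
  show "AE x in M. norm (g (N u x)) \<le> Max ((\<lambda>m. \<bar>g m\<bar>) ` {..n})"
    using AE_count_le[OF u] by eventually_elim (auto intro!: Max_ge)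
qed (rule count_measurable_borel[OF u])

lemma count_mean_eq:
  assumes u: "u \<in> vertices b"
  shows "count_mean u g = (\<Sum>m\<le>n. prob (count_is u m) * g m)"
proof -
  have "count_mean u g = expectation (\<lambda>x. \<Sum>m\<le>n. indicator (count_is u m) x * g m)"
    unfolding count_mean_def
  proof (rule integral_cong_AE)
    show "AE x in M. g (N u x) = (\<Sum>m\<le>n. indicator (count_is u m) x * g m)"
      using AE_count_le[OF u] AE_space
    proof eventually_elim
      fix x assume x: "N u x \<le> n" "x \<in> space M"
      have "(\<Sum>m\<le>n. indicator (count_is u m) x * g m) = (\<Sum>m\<le>n. if N u x = m then g m else 0)"
        using x by (intro sum.cong) (auto simp: indicator_def)
      also have "\<dots> = g (N u x)" using x by simp
      finally show "g (N u x) = (\<Sum>m\<le>n. indicator (count_is u m) x * g m)" by simp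
    qed
    show "(\<lambda>x. \<Sum>m\<le>n. indicator (count_is u m) x * g m) \<in> borel_measurable M"
      by (intro borel_measurable_sum borel_measurable_times borel_measurable_indicator count_event u) auto
  qed (rule count_measurable_borel[OF u])
  also have "\<dots> = (\<Sum>m\<le>n. prob (count_is u m) * g m)"
  proof (subst Bochner_Integration.integral_sum)
    show "integrable M (\<lambda>x. indicator (count_is u m) x * g m)" for m
      using count_event[OF u, of "\<lambda>j. j = m"]
      by (intro integrable_mult_left integrable_real_indicator) (auto simp: emeasure_eq_measure)
    show "(\<Sum>m\<le>n. expectation (\<lambda>x. indicator (count_is u m) x * g m))
        = (\<Sum>m\<le>n. prob (count_is u m) * g m)"
      using count_event[OF u] by (intro sum.cong) auto
  qed
  finally show ?thesis .
qed

lemma offspring_prob_eq_0: "\<not> conserved b s s0 m k \<Longrightarrow> offspring_prob m k = 0"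
  by (simp add: offspring_prob_def split_prob_eq_0)

text \<open>
  Averaging \<open>offspring_law\<close> over the value of \<open>N u\<close>.
\<close>

lemma children_mean_le:
  assumes u: "u \<in> vertices b" and f: "\<And>m. 0 \<le> f m" "f 0 = 0"
    and R: "\<And>m. 0 \<le> R m" "\<And>m. s < m \<Longrightarrow> offspring_mean m f \<le> R m"
  shows "(\<Sum>i<b. count_mean (u @ [i]) f) \<le> count_mean u R"
proof -
  let ?A = "\<lambda>m k. {x \<in> space M. N u x = m \<and> (\<forall>i<b. N (u @ [i]) x = k i)}"
  have A: "?A m k \<in> events" for m k
  proof -
    have "?A m k = (count_is u m) \<inter> (children_are u k)" by auto
    also have "\<dots> \<in> events" by (intro sets.Int count_event[OF u] children_event[OF u])
    finally show ?thesis .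
  qed
  have "(\<Sum>i<b. count_mean (u @ [i]) f) = expectation (\<lambda>x. \<Sum>i<b. f (N (u @ [i]) x))"
    unfolding count_mean_def using u
    by (intro Bochner_Integration.integral_sum[symmetric] count_integrable child_vertex) auto
  also have "\<dots> = expectation (\<lambda>x. \<Sum>m\<le>n. \<Sum>k\<in>configurations. indicator (?A m k) x * (\<Sum>i<b. f (k i)))"
  proof (rule integral_cong_AE)
    have "AE x in M. N u x \<le> n \<and> (\<forall>i\<in>{..<b}. N (u @ [i]) x \<le> n)"
      by (intro AE_conjI AE_count_le u AE_finite_allI child_vertex) auto
    then show "AE x in M. (\<Sum>i<b. f (N (u @ [i]) x))
        = (\<Sum>m\<le>n. \<Sum>k\<in>configurations. indicator (?A m k) x * (\<Sum>i<b. f (k i)))"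
      using AE_space
    proof eventually_elim
      fix x assume le: "N u x \<le> n \<and> (\<forall>i\<in>{..<b}. N (u @ [i]) x \<le> n)" and x: "x \<in> space M"
      define k0 where "k0 = (\<lambda>i\<in>{..<b}. N (u @ [i]) x)"
      have k0: "k0 \<in> configurations" using le by (auto simp: configurations_def k0_def)
      have iff: "x \<in> ?A m k \<longleftrightarrow> m = N u x \<and> k = k0" if "k \<in> configurations" for m k
      proof -
        have "k = k0" if "\<forall>i<b. N (u @ [i]) x = k i"
          using that \<open>k \<in> configurations\<close> k0 unfolding configurations_def
          by (intro PiE_ext[of k "{..<b}" "\<lambda>_. {..n}"]) (auto simp: k0_def)
        then show ?thesis using x by (auto simp: k0_def)
      qed
      have "(\<Sum>m\<le>n. \<Sum>k\<in>configurations. indicator (?A m k) x * (\<Sum>i<b. f (k i)))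
         = (\<Sum>m\<le>n. \<Sum>k\<in>configurations. if m = N u x then (if k = k0 then (\<Sum>i<b. f (k i)) else 0) else 0)"
      proof (intro sum.cong refl)
        fix m k assume "k \<in> configurations"
        then show "indicator (?A m k) x * (\<Sum>i<b. f (k i))
            = (if m = N u x then (if k = k0 then (\<Sum>i<b. f (k i)) else 0) else 0)"
          unfolding indicator_def iff[OF \<open>k \<in> configurations\<close>] by auto
      qed
      also have "\<dots> = (\<Sum>m\<le>n. if m = N u x then (\<Sum>i<b. f (k0 i)) else 0)"
        using k0 finite_configurations by (intro sum.cong refl) simp
      also have "\<dots> = (\<Sum>i<b. f (k0 i))" using le by simp
      also have "\<dots> = (\<Sum>i<b. f (N (u @ [i]) x))" by (intro sum.cong) (simp_all add: k0_def)
      finally show "(\<Sum>i<b. f (N (u @ [i]) x))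
        = (\<Sum>m\<le>n. \<Sum>k\<in>configurations. indicator (?A m k) x * (\<Sum>i<b. f (k i)))" by simp
    qed
    show "(\<lambda>x. \<Sum>i<b. f (N (u @ [i]) x)) \<in> borel_measurable M"
      using u by (intro borel_measurable_sum count_measurable_borel child_vertex) auto
    show "(\<lambda>x. \<Sum>m\<le>n. \<Sum>k\<in>configurations. indicator (?A m k) x * (\<Sum>i<b. f (k i))) \<in> borel_measurable M"
      by (intro borel_measurable_sum borel_measurable_times borel_measurable_indicator A) auto
  qed
  also have "\<dots> = (\<Sum>m\<le>n. \<Sum>k\<in>configurations. prob (?A m k) * (\<Sum>i<b. f (k i)))"
  proof -
    have int: "integrable M (\<lambda>x. indicator (?A m k) x * (\<Sum>i<b. f (k i)))" for m k
      using A by (intro integrable_mult_left integrable_real_indicator) (auto simp: emeasure_eq_measure)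
    have "expectation (\<lambda>x. \<Sum>m\<le>n. \<Sum>k\<in>configurations. indicator (?A m k) x * (\<Sum>i<b. f (k i)))
        = (\<Sum>m\<le>n. expectation (\<lambda>x. \<Sum>k\<in>configurations. indicator (?A m k) x * (\<Sum>i<b. f (k i))))"
      by (intro Bochner_Integration.integral_sum Bochner_Integration.integrable_sum int)
    also have "\<dots> = (\<Sum>m\<le>n. \<Sum>k\<in>configurations. expectation (\<lambda>x. indicator (?A m k) x * (\<Sum>i<b. f (k i))))"
      by (intro sum.cong refl Bochner_Integration.integral_sum int)
    also have "\<dots> = (\<Sum>m\<le>n. \<Sum>k\<in>configurations. prob (?A m k) * (\<Sum>i<b. f (k i)))"
      by (intro sum.cong refl)
         (simp only: integral_mult_left_zero Bochner_Integration.integral_indicator sets.Int_space_eq2[OF A])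
    finally show ?thesis .
  qed
  also have "\<dots> = (\<Sum>m\<le>n. prob (count_is u m) *
      (\<Sum>k\<in>configurations. offspring_prob m k * (\<Sum>i<b. f (k i))))"
    unfolding offspring_law[OF u] by (simp add: sum_distrib_left mult.assoc)
  also have "\<dots> \<le> (\<Sum>m\<le>n. prob (count_is u m) * R m)"
  proof (intro sum_mono mult_left_mono measure_nonneg)
    fix m
    have F: "0 \<le> offspring_prob m k * (\<Sum>i<b. f (k i))" for k
      by (intro mult_nonneg_nonneg offspring_prob_nonneg sum_nonneg f)
    show "(\<Sum>k\<in>configurations. offspring_prob m k * (\<Sum>i<b. f (k i))) \<le> R m"
    proof (cases "m \<le> s")
      case True
      have "offspring_prob m k * (\<Sum>i<b. f (k i)) = 0" for k
      proof (cases "conserved b s s0 m k")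
        case c: True
        then have "(\<Sum>i<b. f (k i)) = (\<Sum>i<b. 0)" using True f by (intro sum.cong) (auto simp: conserved_def)
        then show ?thesis by simp
      qed (simp add: offspring_prob_eq_0)
      then show ?thesis using R(1)[of m] by (simp only: sum.neutral_const)
    next
      case False
      have "(\<Sum>k\<in>configurations. offspring_prob m k * (\<Sum>i<b. f (k i)))
          = (\<Sum>k\<in>{k \<in> configurations. conserved b s s0 m k}. offspring_prob m k * (\<Sum>i<b. f (k i)))"
        by (intro sum.mono_neutral_right finite_configurations) (auto simp: offspring_prob_eq_0)
      also have "\<dots> \<le> (\<Sum>k\<in>compositions b (m - s0). offspring_prob m k * (\<Sum>i<b. f (k i)))"
        using False
        by (intro sum_mono2 finite_compositions F) (auto simp: configurations_def compositions_def conserved_def PiE_iff)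
      also have "\<dots> \<le> R m" using R(2)[of m] False by (simp add: offspring_mean_def)
      finally show ?thesis .
    qed
  qed
  also have "\<dots> = count_mean u R" by (rule count_mean_eq[OF u, symmetric])
  finally show ?thesis .
qed

text \<open>
  Telescoping over the generations: the supersolution property moves the expected potential of generation
  \<open>J\<close> to its charge and the potential of generation \<open>J + 1\<close>.
\<close>

lemma supersolution_generations:
  assumes ss: "supersolution q \<phi> f"
  shows "(\<Sum>j<J. q ^ j * (\<Sum>u\<in>generation b j. count_mean u \<phi>))
       + q ^ J * (\<Sum>u\<in>generation b J. count_mean u f) \<le> f n"
proof (induction J)
  case 0
  have "count_mean [] f = expectation (\<lambda>x. f n)"
    unfolding count_mean_def
    by (rule integral_cong_AE) (use count_root count_measurable_borel[of "[]" f] in auto)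
  then show ?case by (simp add: generation_0 prob_space)
next
  case (Suc J)
  have q: "0 \<le> q" and pos: "\<And>m. 0 \<le> \<phi> m" "\<And>m. \<phi> m \<le> f m" and f0: "f 0 = 0"
    and step: "\<And>m. s < m \<Longrightarrow> \<phi> m + q * offspring_mean m f \<le> f m"
    using ss by (auto simp: supersolution_def)
  have f: "0 \<le> f m" for m using pos[of m] by linarith
  have "q * (\<Sum>w\<in>generation b (Suc J). count_mean w f) + (\<Sum>u\<in>generation b J. count_mean u \<phi>)
      = (\<Sum>u\<in>generation b J. (\<Sum>i<b. count_mean (u @ [i]) (\<lambda>m. q * f m)) + count_mean u \<phi>)"
    unfolding sum_generation_Suc by (simp add: sum_distrib_left sum.distrib count_mean_def)
  also have "\<dots> \<le> (\<Sum>u\<in>generation b J. count_mean u f)"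
  proof (rule sum_mono)
    fix u assume "u \<in> generation b J"
    then have u: "u \<in> vertices b" by (simp add: generation_def)
    have "(\<Sum>i<b. count_mean (u @ [i]) (\<lambda>m. q * f m)) \<le> count_mean u (\<lambda>m. f m - \<phi> m)"
    proof (rule children_mean_le[OF u])
      show "offspring_mean m (\<lambda>m. q * f m) \<le> f m - \<phi> m" if "s < m" for m
        using step[OF that] unfolding offspring_mean_cmult by linarith
    qed (use q f f0 pos in auto)
    also have "\<dots> = count_mean u f - count_mean u \<phi>"
      unfolding count_mean_def by (intro Bochner_Integration.integral_diff count_integrable u)
    finally show "(\<Sum>i<b. count_mean (u @ [i]) (\<lambda>m. q * f m)) + count_mean u \<phi> \<le> count_mean u f"
      by linarith
  qed
  finally have "q ^ J * (q * (\<Sum>w\<in>generation b (Suc J). count_mean w f) + (\<Sum>u\<in>generation b J. count_mean u \<phi>))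
      \<le> q ^ J * (\<Sum>u\<in>generation b J. count_mean u f)"
    using q by (intro mult_left_mono) auto
  then show ?case using Suc.IH by (simp add: algebra_simps)
qed

text \<open>
  Monotone convergence over the generations reduces the infinite tree to finite sums.
\<close>

theorem supersolution_bound_vertexwise:
  assumes ss: "supersolution q \<phi> f"
  shows "(\<integral>\<^sup>+u. \<integral>\<^sup>+x. ennreal (q ^ length u * \<phi> (N u x)) \<partial>M \<partial>count_space (vertices b)) \<le> ennreal (f n)"
proof -
  have q: "0 \<le> q" and pos: "\<And>m. 0 \<le> \<phi> m" "\<And>m. \<phi> m \<le> f m"
    using ss by (auto simp: supersolution_def)
  have f: "0 \<le> f m" for m using pos[of m] by linarith
  have cm: "0 \<le> count_mean u \<phi>" "0 \<le> count_mean u f" for u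
    unfolding count_mean_def using pos f by (auto intro!: integral_nonneg_AE)
  let ?g = "\<lambda>u. q ^ length u * count_mean u \<phi>"
  have "(\<integral>\<^sup>+u. \<integral>\<^sup>+x. ennreal (q ^ length u * \<phi> (N u x)) \<partial>M \<partial>count_space (vertices b))
      = (\<integral>\<^sup>+u. ennreal (?g u) \<partial>count_space (vertices b))"
  proof (rule nn_integral_cong)
    fix u assume "u \<in> space (count_space (vertices b))"
    then have u: "u \<in> vertices b" by simp
    have "(\<integral>\<^sup>+x. ennreal (q ^ length u * \<phi> (N u x)) \<partial>M) = ennreal (expectation (\<lambda>x. q ^ length u * \<phi> (N u x)))"
      using q pos by (intro nn_integral_eq_integral integrable_mult_right count_integrable u) auto
    then show "(\<integral>\<^sup>+x. ennreal (q ^ length u * \<phi> (N u x)) \<partial>M) = ennreal (?g u)"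
      by (simp add: count_mean_def)
  qed
  also have "\<dots> = (\<integral>\<^sup>+u. (SUP J. ennreal (?g u) * indicator {u. length u < J} u) \<partial>count_space (vertices b))"
  proof (rule nn_integral_cong)
    fix u
    show "ennreal (?g u) = (SUP J. ennreal (?g u) * indicator {u. length u < J} u)"
    proof (rule antisym)
      show "ennreal (?g u) \<le> (SUP J. ennreal (?g u) * indicator {u. length u < J} u)"
        by (rule SUP_upper2[of "Suc (length u)"]) auto
      show "(SUP J. ennreal (?g u) * indicator {u. length u < J} u) \<le> ennreal (?g u)"
        by (rule SUP_least) (auto simp: indicator_def)
    qed
  qed
  also have "\<dots> = (SUP J. \<integral>\<^sup>+u. ennreal (?g u) * indicator {u. length u < J} u \<partial>count_space (vertices b))"
    by (rule nn_integral_monotone_convergence_SUP)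
       (auto simp: incseq_def le_fun_def indicator_def)
  also have "\<dots> \<le> ennreal (f n)"
  proof (rule SUP_least)
    fix J
    let ?V = "\<Union>j<J. generation b j"
    have fin: "finite ?V" by (simp add: finite_generation)
    have "(\<integral>\<^sup>+u. ennreal (?g u) * indicator {u. length u < J} u \<partial>count_space (vertices b))
        = (\<Sum>u\<in>?V. ennreal (?g u) * indicator {u. length u < J} u)"
      by (rule nn_integral_count_space'[OF fin]) (auto simp: generation_def indicator_def)
    also have "\<dots> = (\<Sum>u\<in>?V. ennreal (?g u))"
      by (intro sum.cong) (auto simp: generation_def)
    also have "\<dots> = ennreal (\<Sum>u\<in>?V. ?g u)"
      using q cm by (intro sum_ennreal) auto
    also have "(\<Sum>u\<in>?V. ?g u) = (\<Sum>j<J. \<Sum>u\<in>generation b j. ?g u)"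
    proof (rule sum.UNION_disjoint)
      show "\<forall>j\<in>{..<J}. finite (generation b j)" by (simp add: finite_generation)
      show "\<forall>i\<in>{..<J}. \<forall>j\<in>{..<J}. i \<noteq> j \<longrightarrow> generation b i \<inter> generation b j = {}"
        by (auto simp: generation_def)
    qed simp
    also have "\<dots> = (\<Sum>j<J. q ^ j * (\<Sum>u\<in>generation b j. count_mean u \<phi>))"
      by (simp add: sum_distrib_left generation_def)
    also have "ennreal \<dots> \<le> ennreal (f n)"
    proof (rule ennreal_leI)
      have "0 \<le> q ^ J * (\<Sum>u\<in>generation b J. count_mean u f)"
        using q cm by (intro mult_nonneg_nonneg sum_nonneg) auto
      then show "(\<Sum>j<J. q ^ j * (\<Sum>u\<in>generation b j. count_mean u \<phi>)) \<le> f n"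
        using supersolution_generations[OF ss, of J] by linarith
    qed
    finally show "(\<integral>\<^sup>+u. ennreal (?g u) * indicator {u. length u < J} u \<partial>count_space (vertices b))
        \<le> ennreal (f n)" .
  qed
  finally show ?thesis .
qed

lemma supersolution_bound:
  assumes "supersolution q \<phi> f"
  shows "(\<integral>\<^sup>+x. \<integral>\<^sup>+u. ennreal (q ^ length u * \<phi> (N u x)) \<partial>count_space (vertices b) \<partial>M) \<le> ennreal (f n)"
proof (subst nn_integral_count_space_nn_integral[OF countable_vertices])
  show "(\<lambda>x. ennreal (q ^ length u * \<phi> (N u x))) \<in> borel_measurable M" if "u \<in> vertices b" for u
    using count_measurable_borel[OF that, of \<phi>] by simp
qed (rule supersolution_bound_vertexwise[OF assms])

text \<open>
  The sum of the \<open>(N u)\<^sup>2\<close> has finite mean, and each vertex of the tree contributes at least one to it.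
\<close>

lemma AE_finite_tree: "AE x in M. finite (tree_vertices b (\<lambda>u. N u x))"
proof -
  let ?Z = "\<lambda>x. \<integral>\<^sup>+u. ennreal ((real (N u x))\<^sup>2) \<partial>count_space (vertices b)"
  have fin: "(\<integral>\<^sup>+x. ?Z x \<partial>M) \<noteq> \<infinity>"
    using supersolution_bound[OF supersolution_square] by (auto simp: top_unique)
  have meas: "?Z \<in> borel_measurable M"
  proof (rule measurable_nn_integral_count_space)
    show "(\<lambda>x. ennreal ((real (N u x))\<^sup>2)) \<in> borel_measurable M" if "u \<in> vertices b" for u
      using count_measurable_borel[OF that, of real] by simp
  qed (rule countable_vertices)
  have "AE x in M. ?Z x \<noteq> \<infinity>" by (rule nn_integral_PInf_AE[OF meas fin])
  then show ?thesis
  proof eventually_elim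
    fix x assume Z: "?Z x \<noteq> \<infinity>"
    let ?T = "tree_vertices b (\<lambda>u. N u x)"
    have "emeasure (count_space (vertices b)) ?T = (\<integral>\<^sup>+u. indicator ?T u \<partial>count_space (vertices b))"
      by (rule nn_integral_indicator[symmetric]) (auto simp: tree_vertices_def)
    also have "\<dots> \<le> ?Z x"
    proof (rule nn_integral_mono)
      fix u
      have "(1::real) \<le> (real (N u x))\<^sup>2" if "0 < N u x" using that by simp
      then show "indicator ?T u \<le> ennreal ((real (N u x))\<^sup>2)"
        by (auto simp: indicator_def tree_vertices_def)
    qed
    finally have "emeasure (count_space (vertices b)) ?T \<noteq> \<infinity>" using Z by (auto simp: top_unique)
    then show "finite ?T" by (auto simp: emeasure_count_space tree_vertices_def split: if_splits)
  qed
qed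

end

section \<open>Clusters of a finite tree\<close>

text \<open>
  The root is left out, so that \<open>ancestors u\<close> corresponds to the edges on the path from the root to \<open>u\<close>.
\<close>

definition ancestors :: "nat list \<Rightarrow> nat list set" where
  "ancestors u = {v. v \<noteq> [] \<and> prefix v u}"

lemma ancestors_eq: "ancestors u = (\<lambda>k. take k u) ` {1..length u}"
proof (intro equalityI subsetI)
  fix v assume v: "v \<in> ancestors u"
  then have "v = take (length v) u" by (auto simp: ancestors_def prefix_def)
  moreover have "length v \<in> {1..length u}"
    using v by (auto simp: ancestors_def prefix_length_le Suc_le_eq)
  ultimately show "v \<in> (\<lambda>k. take k u) ` {1..length u}" by (rule image_eqI)
qed (auto simp: ancestors_def take_is_prefix)

lemma finite_ancestors: "finite (ancestors u)"
  by (simp add: ancestors_eq)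

lemma card_ancestors: "card (ancestors u) = length u"
proof -
  have "inj_on (\<lambda>k. take k u) {1..length u}"
  proof (rule inj_onI)
    fix k l assume k: "k \<in> {1..length u}" and l: "l \<in> {1..length u}" and eq: "take k u = take l u"
    have "length (take k u) = length (take l u)" by (simp only: eq)
    then show "k = l" using k l by simp
  qed
  then show ?thesis unfolding ancestors_eq by (subst card_image) auto
qed

lemma ancestors_vertices: "u \<in> vertices b \<Longrightarrow> ancestors u \<subseteq> vertices b - {[]}"
  by (auto simp: ancestors_def prefix_def)

text \<open>
  Describes the ranked sizes without sorting: the second entry reaches \<open>t\<close> exactly if at least two
  entries do.
\<close>

lemma second_largest_ge_iff:
  fixes f :: "'i \<Rightarrow> nat"
  assumes I: "finite I"
  defines "L \<equiv> rev (sorted_list_of_multiset (image_mset f (mset_set I)))"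
  assumes len: "2 \<le> length L"
  shows "t \<le> L ! 1 \<longleftrightarrow> (\<exists>a\<in>I. \<exists>c\<in>I. a \<noteq> c \<and> t \<le> f a \<and> t \<le> f c)"
proof -
  obtain x y r where L: "L = x # y # r"
    using len by (cases L; cases "tl L") auto
  have "sorted (rev L)" by (simp add: L_def)
  then have sorted: "sorted_wrt (\<ge>) L" by (simp add: sorted_wrt_rev)
  have "length (filter (\<lambda>z. t \<le> z) L) = size (filter_mset (\<lambda>z. t \<le> z) (mset L))"
    by (simp flip: mset_filter)
  also have "mset L = image_mset f (mset_set I)" by (simp add: L_def)
  also have "size (filter_mset (\<lambda>z. t \<le> z) (image_mset f (mset_set I))) = card {a \<in> I. t \<le> f a}"
    by (simp add: filter_mset_image_mset o_def filter_mset_mset_set[OF I])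
  finally have cnt: "length (filter (\<lambda>z. t \<le> z) L) = card {a \<in> I. t \<le> f a}" .
  have "t \<le> L ! 1 \<longleftrightarrow> \<not> length (filter (\<lambda>z. t \<le> z) L) \<le> Suc 0"
  proof
    assume "t \<le> L ! 1"
    moreover have "y \<le> x" using sorted by (simp add: L)
    ultimately show "\<not> length (filter (\<lambda>z. t \<le> z) L) \<le> Suc 0" by (simp add: L)
  next
    assume *: "\<not> length (filter (\<lambda>z. t \<le> z) L) \<le> Suc 0"
    show "t \<le> L ! 1"
    proof (rule ccontr)
      assume "\<not> t \<le> L ! 1"
      then have "\<not> t \<le> y" by (simp add: L)
      moreover from this have "filter (\<lambda>z. t \<le> z) r = []"
        using sorted by (auto simp: L filter_empty_conv)
      ultimately have "filter (\<lambda>z. t \<le> z) L = filter (\<lambda>z. t \<le> z) [x]" by (simp add: L)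
      then have "length (filter (\<lambda>z. t \<le> z) L) \<le> Suc 0" by simp
      with * show False by contradiction
    qed
  qed
  also have "\<dots> \<longleftrightarrow> (\<exists>a\<in>I. \<exists>c\<in>I. a \<noteq> c \<and> t \<le> f a \<and> t \<le> f c)"
    unfolding cnt using I by (subst card_le_Suc0_iff_eq) auto
  finally show ?thesis .
qed

lemma equiv_connection: "equiv (tree_vertices b N) (connection b N E)"
proof (rule equivI)
  let ?K = "kept_edges b N E \<union> (kept_edges b N E)\<inverse>"
  show "connection b N E \<subseteq> tree_vertices b N \<times> tree_vertices b N" by (auto simp: connection_def)
  show "refl_on (tree_vertices b N) (connection b N E)" by (auto simp: refl_on_def connection_def)
  have "sym (?K\<^sup>*)" by (intro sym_rtrancl) (auto simp: sym_def)
  then show "sym (connection b N E)" unfolding sym_def connection_def by auto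
  show "trans (connection b N E)" unfolding trans_def connection_def by (auto intro: rtrancl_trans)
qed

text \<open>
  Removing the edge above \<open>v\<close> separates the descendants of \<open>v\<close> from all other vertices.
\<close>

lemma connected_kept:
  assumes "(u, w) \<in> connection b N E" and v: "v \<in> ancestors u" "v \<notin> ancestors w"
  shows "E v"
proof (rule ccontr)
  assume nE: "\<not> E v"
  let ?K = "kept_edges b N E \<union> (kept_edges b N E)\<inverse>"
  have edge: "prefix v a \<longleftrightarrow> prefix v c" if "(a, c) \<in> kept_edges b N E" for a c
    using that nE by (auto simp: kept_edges_def prefix_snoc)
  have "(u, w) \<in> ?K\<^sup>*" using assms(1) by (simp add: connection_def)
  then have "prefix v u \<longleftrightarrow> prefix v w"
    by (induction rule: rtrancl_induct) (use edge in auto)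
  with v show False by (simp add: ancestors_def)
qed

text \<open>
  Almost every realisation of the counts satisfies these three properties.
\<close>

locale realised_tree =
  fixes b s s0 n :: nat and N :: "nat list \<Rightarrow> nat"
  assumes root_count: "N [] = n"
    and count_conserved: "\<And>u. u \<in> vertices b \<Longrightarrow> conserved b s s0 (N u) (\<lambda>i. N (u @ [i]))"
    and finite_tree: "finite (tree_vertices b N)"
begin

abbreviation T :: "nat list set" where "T \<equiv> tree_vertices b N"

abbreviation bal :: "nat list \<Rightarrow> nat" where "bal u \<equiv> balls_at s s0 (N u)"

lemma T_vertices: "u \<in> T \<Longrightarrow> u \<in> vertices b"
  by (simp add: tree_vertices_def)

lemma child_count_le: "u \<in> vertices b \<Longrightarrow> i < b \<Longrightarrow> N (u @ [i]) \<le> N u"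
  using count_conserved[of u] component_le_sum_nat[of i b "\<lambda>i. N (u @ [i])"]
  by (auto simp: conserved_def split: if_splits)

lemma count_append_le: "u @ r \<in> vertices b \<Longrightarrow> N (u @ r) \<le> N u"
proof (induction r rule: rev_induct)
  case (snoc i r)
  then have "u @ r \<in> vertices b" "i < b" by auto
  then show ?case using snoc.IH child_count_le[of "u @ r" i] by (simp only: append_assoc) simp
qed simp

lemma T_prefix: "w \<in> T \<Longrightarrow> prefix u w \<Longrightarrow> u \<in> T"
proof -
  assume w: "w \<in> T" and "prefix u w"
  then obtain r where r: "w = u @ r" by (auto simp: prefix_def)
  have "N w \<le> N u" unfolding r by (rule count_append_le) (use T_vertices[OF w] r in \<open>simp only:\<close>)
  moreover have "0 < N w" "w \<in> vertices b" using w by (simp_all add: tree_vertices_def)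
  ultimately show "u \<in> T" using r by (simp add: tree_vertices_def)
qed

lemma ancestors_T: "u \<in> T \<Longrightarrow> ancestors u \<subseteq> T"
  using T_prefix by (auto simp: ancestors_def)

lemma descendants_split:
  assumes u: "u \<in> T"
  shows "{w \<in> T. prefix u w} = insert u (\<Union>i<b. {w \<in> T. prefix (u @ [i]) w})"
proof (intro equalityI subsetI)
  fix w assume w: "w \<in> {w \<in> T. prefix u w}"
  then obtain r where r: "w = u @ r" by (auto simp: prefix_def)
  show "w \<in> insert u (\<Union>i<b. {w \<in> T. prefix (u @ [i]) w})"
  proof (cases r)
    case (Cons i r')
    have "i < b" using w r Cons by (auto simp: tree_vertices_def)
    then show ?thesis using w r Cons by (auto simp: prefix_def)
  qed (use r in simp)
next
  fix w assume "w \<in> insert u (\<Union>i<b. {w \<in> T. prefix (u @ [i]) w})"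
  then show "w \<in> {w \<in> T. prefix u w}" using u by (auto intro: append_prefixD)
qed

text \<open>
  Induction on the distance to a depth that the finite tree does not reach.
\<close>

lemma subtree_sum:
  assumes "u \<in> vertices b"
  shows "(\<Sum>w | w \<in> T \<and> prefix u w. bal w) = N u"
proof -
  obtain D where D: "\<And>w. w \<in> T \<Longrightarrow> length w < D"
    using finite_tree finite_nat_set_iff_bounded[of "length ` T"] by auto
  have "u \<in> vertices b \<Longrightarrow> D \<le> length u + k \<Longrightarrow> (\<Sum>w | w \<in> T \<and> prefix u w. bal w) = N u" for k u
  proof (induction k arbitrary: u)
    case 0
    have nT: "u \<notin> T" using D[of u] 0 by auto
    then have "{w. w \<in> T \<and> prefix u w} = {}" using T_prefix by blast
    moreover have "N u = 0" using nT 0 by (simp add: tree_vertices_def)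
    ultimately show ?case by (simp only: sum.empty)
  next
    case (Suc k)
    show ?case
    proof (cases "u \<in> T")
      case False
      then have "{w. w \<in> T \<and> prefix u w} = {}" using T_prefix by blast
      moreover have "N u = 0" using False Suc.prems by (simp add: tree_vertices_def)
      ultimately show ?thesis by (simp only: sum.empty)
    next
      case True
      have IH: "(\<Sum>w | w \<in> T \<and> prefix (u @ [i]) w. bal w) = N (u @ [i])" if "i < b" for i
        by (rule Suc.IH) (use Suc.prems that in auto)
      let ?U = "\<Union>i<b. {w \<in> T. prefix (u @ [i]) w}"
      have fin: "finite ?U" using finite_tree by (auto intro: finite_subset)
      have uU: "u \<notin> ?U" by auto
      have "(\<Sum>w | w \<in> T \<and> prefix u w. bal w) = (\<Sum>w\<in>insert u ?U. bal w)"
        unfolding descendants_split[OF True] ..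
      also have "\<dots> = bal u + (\<Sum>w\<in>?U. bal w)" by (rule sum.insert[OF fin uU])
      also have "(\<Sum>w\<in>?U. bal w) = (\<Sum>i<b. \<Sum>w | w \<in> T \<and> prefix (u @ [i]) w. bal w)"
      proof (rule sum.UNION_disjoint)
        show "\<forall>i\<in>{..<b}. finite {w \<in> T. prefix (u @ [i]) w}" using finite_tree by auto
        show "\<forall>i\<in>{..<b}. \<forall>j\<in>{..<b}. i \<noteq> j \<longrightarrow>
            {w \<in> T. prefix (u @ [i]) w} \<inter> {w \<in> T. prefix (u @ [j]) w} = {}"
          by (auto simp: prefix_def)
      qed simp
      also have "\<dots> = (\<Sum>i<b. N (u @ [i]))" by (intro sum.cong refl IH) simp
      also have "bal u + \<dots> = N u"
        using count_conserved[of u] Suc.prems by (auto simp: conserved_def balls_at_def split: if_splits)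
      finally show ?thesis .
    qed
  qed
  from this[of u D] assms show ?thesis by simp
qed

lemma total_balls: "(\<Sum>u\<in>T. bal u) = n"
  using subtree_sum[of "[]"] by (simp add: root_count)

text \<open>
  Each ball at \<open>u\<close> is counted once in \<open>N v\<close> for every ancestor \<open>v\<close> of \<open>u\<close>.
\<close>

lemma path_length_le: "(\<Sum>u\<in>T. length u * bal u) \<le> (\<Sum>v\<in>T. N v)"
proof -
  have "(\<Sum>u\<in>T. length u * bal u) = (\<Sum>u\<in>T. \<Sum>v\<in>T. if v \<in> ancestors u then bal u else 0)"
  proof (intro sum.cong refl)
    fix u assume u: "u \<in> T"
    have "(\<Sum>v\<in>T. if v \<in> ancestors u then bal u else 0) = (\<Sum>v\<in>T \<inter> ancestors u. bal u)"
      by (rule sum.inter_restrict[OF finite_tree, symmetric])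
    also have "T \<inter> ancestors u = ancestors u" using ancestors_T[OF u] by auto
    finally show "length u * bal u = (\<Sum>v\<in>T. if v \<in> ancestors u then bal u else 0)"
      by (simp add: card_ancestors)
  qed
  also have "\<dots> = (\<Sum>v\<in>T. \<Sum>u\<in>T. if v \<in> ancestors u then bal u else 0)" by (rule sum.swap)
  also have "\<dots> \<le> (\<Sum>v\<in>T. N v)"
  proof (rule sum_mono)
    fix v assume v: "v \<in> T"
    have "(\<Sum>u\<in>T. if v \<in> ancestors u then bal u else 0) \<le> (\<Sum>u\<in>T. if prefix v u then bal u else 0)"
      by (rule sum_mono) (auto simp: ancestors_def)
    also have "\<dots> = (\<Sum>u | u \<in> T \<and> prefix v u. bal u)"
      using finite_tree by (simp add: sum.inter_filter)
    also have "\<dots> = N v" by (rule subtree_sum[OF T_vertices[OF v]])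
    finally show "(\<Sum>u\<in>T. if v \<in> ancestors u then bal u else 0) \<le> N v" .
  qed
  finally show ?thesis .
qed

text \<open>
  A pair of balls is counted once in \<open>(N v)\<^sup>2\<close> for every common ancestor \<open>v\<close>.
\<close>

lemma common_ancestors_le:
  "(\<Sum>u\<in>T. \<Sum>w\<in>T. bal u * bal w * card (ancestors u \<inter> ancestors w)) \<le> (\<Sum>v\<in>T. (N v)\<^sup>2)"
proof -
  let ?a = "\<lambda>v u. if v \<in> ancestors u then bal u else 0"
  have "(\<Sum>u\<in>T. \<Sum>w\<in>T. bal u * bal w * card (ancestors u \<inter> ancestors w))
      = (\<Sum>u\<in>T. \<Sum>w\<in>T. \<Sum>v\<in>T. ?a v u * ?a v w)"
  proof (intro sum.cong refl)
    fix u w assume u: "u \<in> T" and w: "w \<in> T"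
    have "(\<Sum>v\<in>T. ?a v u * ?a v w) = (\<Sum>v\<in>T. if v \<in> ancestors u \<inter> ancestors w then bal u * bal w else 0)"
      by (intro sum.cong) auto
    also have "\<dots> = (\<Sum>v\<in>T \<inter> (ancestors u \<inter> ancestors w). bal u * bal w)"
      by (rule sum.inter_restrict[OF finite_tree, symmetric])
    also have "T \<inter> (ancestors u \<inter> ancestors w) = ancestors u \<inter> ancestors w"
      using ancestors_T[OF u] by auto
    finally show "bal u * bal w * card (ancestors u \<inter> ancestors w) = (\<Sum>v\<in>T. ?a v u * ?a v w)"
      by (simp add: mult.commute)
  qed
  also have "\<dots> = (\<Sum>v\<in>T. \<Sum>u\<in>T. \<Sum>w\<in>T. ?a v u * ?a v w)"
    by (subst sum.swap[of _ T]) (subst (2) sum.swap[of _ T], rule refl)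
  also have "\<dots> = (\<Sum>v\<in>T. (\<Sum>u\<in>T. ?a v u)\<^sup>2)"
    by (simp only: power2_eq_square sum_product)
  also have "\<dots> \<le> (\<Sum>v\<in>T. (N v)\<^sup>2)"
  proof (intro sum_mono power_mono)
    fix v assume v: "v \<in> T"
    have "(\<Sum>u\<in>T. ?a v u) \<le> (\<Sum>u\<in>T. if prefix v u then bal u else 0)"
      by (rule sum_mono) (auto simp: ancestors_def)
    also have "\<dots> = (\<Sum>u | u \<in> T \<and> prefix v u. bal u)"
      using finite_tree by (simp add: sum.inter_filter)
    also have "\<dots> = N v" by (rule subtree_sum[OF T_vertices[OF v]])
    finally show "(\<Sum>u\<in>T. ?a v u) \<le> N v" .
  qed simp
  finally show ?thesis .
qed

lemma finite_clusters: "finite (clusters b N E)"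
  unfolding clusters_def by (rule finite_quotient[OF finite_tree]) (auto simp: connection_def)

lemma cluster_subset: "C \<in> clusters b N E \<Longrightarrow> C \<subseteq> T"
  unfolding clusters_def by (rule in_quotient_imp_subset[OF equiv_connection])

lemma sum_cluster_squares:
  "(\<Sum>C\<in>clusters b N E. (cluster_size s s0 N C)\<^sup>2)
     = (\<Sum>u\<in>T. \<Sum>w\<in>T. if (u, w) \<in> connection b N E then bal u * bal w else 0)"
proof -
  let ?R = "connection b N E"
  have "(cluster_size s s0 N C)\<^sup>2 = (\<Sum>u\<in>C. \<Sum>w\<in>T. if (u, w) \<in> ?R then bal u * bal w else 0)"
    if C: "C \<in> clusters b N E" for C
  proof -
    have "(\<Sum>w\<in>T. if (u, w) \<in> ?R then bal u * bal w else 0) = (\<Sum>w\<in>C. bal u * bal w)" if u: "u \<in> C" for u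
    proof -
      obtain x where x: "C = ?R `` {x}"
        using C unfolding clusters_def by (rule quotientE)
      then have "(x, u) \<in> ?R" using u by blast
      then have "C = ?R `` {u}" unfolding x by (rule equiv_class_eq[OF equiv_connection])
      then have eq: "{w \<in> T. (u, w) \<in> ?R} = C" using cluster_subset[OF C] by blast
      have "(\<Sum>w\<in>T. if (u, w) \<in> ?R then bal u * bal w else 0) = (\<Sum>w | w \<in> T \<and> (u, w) \<in> ?R. bal u * bal w)"
        by (rule sum.inter_filter[OF finite_tree, symmetric])
      then show ?thesis by (simp only: eq)
    qed
    then have "(\<Sum>u\<in>C. \<Sum>w\<in>T. if (u, w) \<in> ?R then bal u * bal w else 0) = (\<Sum>u\<in>C. \<Sum>w\<in>C. bal u * bal w)"
      by (rule sum.cong[OF refl])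
    then show ?thesis by (simp only: cluster_size_def power2_eq_square sum_product)
  qed
  then have "(\<Sum>C\<in>clusters b N E. (cluster_size s s0 N C)\<^sup>2)
      = (\<Sum>C\<in>clusters b N E. \<Sum>u\<in>C. \<Sum>w\<in>T. if (u, w) \<in> ?R then bal u * bal w else 0)"
    by (intro sum.cong) auto
  also have "\<dots> = (\<Sum>u\<in>\<Union>(clusters b N E). \<Sum>w\<in>T. if (u, w) \<in> ?R then bal u * bal w else 0)"
  proof (subst sum.Union_disjoint)
    show "\<forall>C\<in>clusters b N E. finite C" using cluster_subset finite_tree by (auto intro: finite_subset)
    show "\<forall>C\<in>clusters b N E. \<forall>D\<in>clusters b N E. C \<noteq> D \<longrightarrow> C \<inter> D = {}"
      unfolding clusters_def using quotient_disj[OF equiv_connection] by blast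
  qed simp
  also have "\<Union>(clusters b N E) = T"
    unfolding clusters_def by (rule Union_quotient[OF equiv_connection])
  finally show ?thesis .
qed

lemma root_cluster_kept:
  assumes "u \<in> T" "\<And>v. v \<in> ancestors u \<Longrightarrow> E v"
  shows "([], u) \<in> connection b N E"
  using assms
proof (induction u rule: rev_induct)
  case Nil
  then show ?case by (simp add: connection_def)
next
  case (snoc i u)
  have u: "u \<in> T" using T_prefix[OF snoc.prems(1), of u] by simp
  have "ancestors u \<subseteq> ancestors (u @ [i])" by (auto simp: ancestors_def)
  then have c: "([], u) \<in> connection b N E" using snoc.prems(2) by (intro snoc.IH u) auto
  have "E (u @ [i])" by (rule snoc.prems(2)) (simp add: ancestors_def)
  then have "(u, u @ [i]) \<in> kept_edges b N E" using u snoc.prems(1) by (auto simp: kept_edges_def)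
  then have "(u, u @ [i]) \<in> (kept_edges b N E \<union> (kept_edges b N E)\<inverse>)\<^sup>*" by auto
  then show ?case using c snoc.prems(1) unfolding connection_def by (auto intro: rtrancl_trans)
qed

lemma root_cluster_size_eq:
  "root_cluster_size b s s0 N E = (\<Sum>u\<in>T. if ([], u) \<in> connection b N E then bal u else 0)"
proof -
  have "connection b N E `` {[]} = {u \<in> T. ([], u) \<in> connection b N E}" by (auto simp: connection_def)
  then have "root_cluster_size b s s0 N E = (\<Sum>u | u \<in> T \<and> ([], u) \<in> connection b N E. bal u)"
    by (simp only: root_cluster_size_def cluster_size_def)
  also have "\<dots> = (\<Sum>u\<in>T. if ([], u) \<in> connection b N E then bal u else 0)"
    by (rule sum.inter_filter[OF finite_tree])
  finally show ?thesis .
qed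

lemma cluster_size_le: "C \<subseteq> T \<Longrightarrow> cluster_size s s0 N C \<le> n"
  unfolding cluster_size_def total_balls[symmetric] by (intro sum_mono2 finite_tree) auto

lemma root_cluster_size_le: "root_cluster_size b s s0 N E \<le> n"
  unfolding root_cluster_size_def by (rule cluster_size_le) (auto simp: connection_def)

lemma second_cluster_witness:
  assumes "second_cluster_size b s s0 N E \<noteq> 0"
  obtains C D where "C \<in> clusters b N E" "D \<in> clusters b N E" "C \<noteq> D"
    "second_cluster_size b s s0 N E \<le> cluster_size s s0 N C"
    "second_cluster_size b s s0 N E \<le> cluster_size s s0 N D"
proof -
  define L where "L = rev (sorted_list_of_multiset
      (image_mset (cluster_size s s0 N) (mset_set (clusters b N E))))"
  have S: "second_cluster_size b s s0 N E = (if length L < 2 then 0 else L ! 1)"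
    by (simp add: second_cluster_size_def L_def)
  with assms have len: "2 \<le> length L" by (auto split: if_splits)
  with S have "second_cluster_size b s s0 N E \<le> L ! 1" by simp
  then show ?thesis
    using that second_largest_ge_iff[OF finite_clusters, of "cluster_size s s0 N" E "second_cluster_size b s s0 N E"] len
    unfolding L_def by blast
qed

lemma second_cluster_size_le: "second_cluster_size b s s0 N E \<le> n"
proof (cases "second_cluster_size b s s0 N E = 0")
  case False
  then obtain C where "C \<in> clusters b N E" "second_cluster_size b s s0 N E \<le> cluster_size s s0 N C"
    using second_cluster_witness[OF False] by metis
  then show ?thesis using cluster_size_le[OF cluster_subset] by (meson order_trans)
qed simp

text \<open>
  If the root cluster is not the largest one, the largest one takes the place of the second; either way
  some cluster other than that of the root is at least as large as the second largest.
\<close>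

lemma two_largest_squares:
  assumes "0 < n"
  shows "(root_cluster_size b s s0 N E)\<^sup>2 + (second_cluster_size b s s0 N E)\<^sup>2
     \<le> (\<Sum>C\<in>clusters b N E. (cluster_size s s0 N C)\<^sup>2)"
proof -
  let ?R = "connection b N E `` {[]}" and ?S = "second_cluster_size b s s0 N E"
  let ?sq = "\<lambda>C. (cluster_size s s0 N C)\<^sup>2"
  have "[] \<in> T" using assms root_count by (simp add: tree_vertices_def)
  then have R: "?R \<in> clusters b N E" unfolding clusters_def by (rule quotientI)
  show ?thesis
  proof (cases "?S = 0")
    case True
    have "?sq ?R \<le> (\<Sum>C\<in>clusters b N E. ?sq C)"
      by (rule member_le_sum[OF R]) (simp_all add: finite_clusters)
    then show ?thesis by (simp add: True root_cluster_size_def)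
  next
    case False
    obtain C D where CD: "C \<in> clusters b N E" "D \<in> clusters b N E" "C \<noteq> D"
      "?S \<le> cluster_size s s0 N C" "?S \<le> cluster_size s s0 N D"
      by (rule second_cluster_witness[OF False])
    then obtain F where F: "F \<in> clusters b N E" "F \<noteq> ?R" "?S \<le> cluster_size s s0 N F"
      by (cases "C = ?R") auto
    have "?sq ?R + ?S\<^sup>2 \<le> ?sq ?R + ?sq F" using F(3) by (simp add: power_mono)
    also have "\<dots> = (\<Sum>C\<in>{?R, F}. ?sq C)" using F(2) by (subst sum.insert) auto
    also have "\<dots> \<le> (\<Sum>C\<in>clusters b N E. ?sq C)"
      using R F(1) by (intro sum_mono2 finite_clusters) auto
    finally show ?thesis by (simp add: root_cluster_size_def)
  qed
qed

end

section \<open>Moments of the cluster sizes\<close>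

locale percolated_process = split_process b s s0 s1 \<nu> M n V N +
    percolated_split_tree M b s s0 s1 \<nu> n V N p E
  for b s s0 s1 \<nu> and M :: "'a measure" and n V N p E
begin

abbreviation root_size :: "'a \<Rightarrow> nat" where
  "root_size x \<equiv> root_cluster_size b s s0 (\<lambda>u. N u x) (\<lambda>u. E u x)"

abbreviation second_size :: "'a \<Rightarrow> nat" where
  "second_size x \<equiv> second_cluster_size b s s0 (\<lambda>u. N u x) (\<lambda>u. E u x)"

lemma AE_realised: "AE x in M. realised_tree b s s0 n (\<lambda>u. N u x)"
proof -
  have "AE x in M. \<forall>u\<in>vertices b. conserved b s s0 (N u x) (\<lambda>i. N (u @ [i]) x)"
    by (rule AE_ball_countable'[OF AE_conserved countable_vertices])
  then show ?thesis using count_root AE_finite_tree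
    by eventually_elim (unfold realised_tree_def, blast)
qed

definition kept :: "nat list set \<Rightarrow> 'a set" where
  "kept W = {x \<in> space M. \<forall>v\<in>W. E v x}"

lemma edge_measurable: "v \<in> vertices b - {[]} \<Longrightarrow> E v \<in> measurable M (count_space UNIV)"
  using edge_indep unfolding indep_vars_def by blast

lemma edge_event: "v \<in> vertices b - {[]} \<Longrightarrow> E v -` {True} \<inter> space M \<in> events"
  by (rule measurable_sets[OF edge_measurable]) simp_all

lemma kept_event:
  assumes "finite W" "W \<subseteq> vertices b - {[]}"
  shows "kept W \<in> events"
  unfolding kept_def
proof (rule sets.sets_Collect_finite_All[OF _ assms(1)])
  fix v assume "v \<in> W"
  then have "v \<in> vertices b - {[]}" using assms(2) by blast
  moreover have "{x \<in> space M. E v x} = E v -` {True} \<inter> space M" by blast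
  ultimately show "{x \<in> space M. E v x} \<in> events" using edge_event by (simp only:)
qed

lemma prob_kept:
  assumes W: "finite W" "W \<subseteq> vertices b - {[]}"
  shows "prob (kept W) = p ^ card W"
proof (cases "W = {}")
  case True
  then show ?thesis by (simp add: kept_def prob_space)
next
  case False
  have "kept W = (\<Inter>v\<in>W. E v -` {True} \<inter> space M)" using False by (auto simp: kept_def)
  then have "prob (kept W) = (\<Prod>v\<in>W. prob (E v -` {True} \<inter> space M))"
    using indep_varsD[OF edge_indep False W(1) W(2), of "\<lambda>_. {True}"] by simp
  also have "\<dots> = (\<Prod>v\<in>W. p)"
  proof (intro prod.cong refl)
    fix v assume "v \<in> W"
    then have "v \<in> vertices b - {[]}" using W(2) by blast
    moreover have "E v -` {True} \<inter> space M = {x \<in> space M. E v x}" by blast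
    ultimately show "prob (E v -` {True} \<inter> space M) = p" using edge_prob by (simp only:)
  qed
  finally show ?thesis by simp
qed

lemma kept_indep_counts:
  assumes W: "finite W" "W \<subseteq> vertices b - {[]}" and u: "u \<in> vertices b" "w \<in> vertices b"
  shows "prob (kept W \<inter> ((\<lambda>x. (N u x, N w x)) -` A \<inter> space M))
       = prob (kept W) * prob ((\<lambda>x. (N u x, N w x)) -` A \<inter> space M)"
proof -
  let ?GN = "{N u -` A \<inter> space M | u A. u \<in> vertices b}"
  let ?GE = "{E u -` A \<inter> space M | u A. u \<in> vertices b - {[]}}"
  let ?FN = "sigma (space M) ?GN" and ?FE = "sigma (space M) ?GE"
  have PN: "?GN \<subseteq> Pow (space M)" and PE: "?GE \<subseteq> Pow (space M)" by blast+
  have SN: "sets ?FN = sigma_sets (space M) ?GN" "space ?FN = space M"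
    using PN by (simp_all add: sets_measure_of space_measure_of)
  have SE: "sets ?FE = sigma_sets (space M) ?GE" "space ?FE = space M"
    using PE by (simp_all add: sets_measure_of space_measure_of)
  have edge: "{x \<in> space ?FE. E v x} \<in> sets ?FE" if "v \<in> W" for v
  proof -
    have "{x \<in> space M. E v x} = E v -` {True} \<inter> space M" by blast
    also have "\<dots> \<in> sigma_sets (space M) ?GE"
      by (rule sigma_sets.Basic)
         (intro CollectI exI[of _ v] exI[of _ "{True}"] conjI refl subsetD[OF W(2) that])
    finally show ?thesis unfolding SE .
  qed
  have "{x \<in> space ?FE. \<forall>v\<in>W. E v x} \<in> sets ?FE"
    by (rule sets.sets_Collect_finite_All[OF edge W(1)])
  then have 1: "kept W \<in> sigma_sets (space M) ?GE" unfolding SE kept_def .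
  have count: "{x \<in> space ?FN. N v x = i} \<in> sets ?FN" if "v \<in> vertices b" for v i
  proof -
    have "{x \<in> space M. N v x = i} = N v -` {i} \<inter> space M" by blast
    also have "\<dots> \<in> sigma_sets (space M) ?GN"
      by (rule sigma_sets.Basic) (intro CollectI exI[of _ v] exI[of _ "{i}"] conjI refl that)
    finally show ?thesis unfolding SN .
  qed
  have cA: "countable A" by (rule countable_subset[OF subset_UNIV]) simp
  have "(\<lambda>x. (N u x, N w x)) -` A \<inter> space M
      = (\<Union>(i, j)\<in>A. {x \<in> space ?FN. N u x = i} \<inter> {x \<in> space ?FN. N w x = j})"
    unfolding SN by auto
  also have "\<dots> \<in> sets ?FN"
  proof (rule sets.countable_UN''[OF cA])
    fix ij :: "nat \<times> nat"
    show "(case ij of (i, j) \<Rightarrow> {x \<in> space ?FN. N u x = i} \<inter> {x \<in> space ?FN. N w x = j}) \<in> sets ?FN"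
      unfolding split_def by (intro sets.Int count u)
  qed
  finally have 2: "(\<lambda>x. (N u x, N w x)) -` A \<inter> space M \<in> sigma_sets (space M) ?GN" unfolding SN .
  show ?thesis
    using indep_setD[OF edge_indep_tree 2 1] by (simp only: Int_commute mult.commute)
qed

text \<open>
  The edges are independent of the counts, so requiring all edges of \<open>W\<close> to be kept multiplies the
  expectation by \<open>p ^ card W\<close>.
\<close>

lemma counts_on_kept:
  fixes g :: "nat \<Rightarrow> nat \<Rightarrow> real"
  assumes W: "finite W" "W \<subseteq> vertices b - {[]}" and u: "u \<in> vertices b" "w \<in> vertices b"
    and g: "\<And>i j. 0 \<le> g i j" "\<And>i j. g i j \<le> C" and p: "0 < p"
  shows "(\<integral>\<^sup>+x. ennreal (g (N u x) (N w x)) * indicator (kept W) x \<partial>M)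
       = (\<integral>\<^sup>+x. ennreal (p ^ card W * g (N u x) (N w x)) \<partial>M)"
proof -
  let ?X = "\<lambda>x. (N u x, N w x)"
  have X: "?X \<in> measurable M (count_space UNIV)"
  proof (subst measurable_count_space_eq2_countable)
    show "?X \<in> space M \<rightarrow> UNIV \<and> (\<forall>a\<in>UNIV. ?X -` {a} \<inter> space M \<in> events)"
    proof (intro conjI ballI)
      fix a :: "nat \<times> nat"
      have "?X -` {a} \<inter> space M = {x \<in> space M. N u x = fst a} \<inter> {x \<in> space M. N w x = snd a}" by auto
      also have "\<dots> \<in> events" by (intro sets.Int count_event u)
      finally show "?X -` {a} \<inter> space M \<in> events" .
    qed simp
  qed
  have K: "kept W \<in> events" by (rule kept_event[OF W])
  have gm: "(\<lambda>x. g (N u x) (N w x)) \<in> borel_measurable M"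
    using measurable_compose[OF X, of "\<lambda>ij. g (fst ij) (snd ij)" borel] by simp
  have int: "integrable M (\<lambda>x. g (N u x) (N w x))"
    by (rule integrable_const_bound[where B = C]) (use g gm in auto)
  have intK: "integrable M (\<lambda>x. indicator (kept W) x *\<^sub>R g (N u x) (N w x))"
    by (rule integrable_mult_indicator[OF K int])
  have "(\<integral>\<^sup>+x. ennreal (g (N u x) (N w x)) * indicator (kept W) x \<partial>M)
      = (\<integral>\<^sup>+x. ennreal (indicator (kept W) x *\<^sub>R g (N u x) (N w x)) \<partial>M)"
    by (intro nn_integral_cong) (simp add: indicator_def)
  also have "\<dots> = ennreal (\<integral>x\<in>kept W. g (N u x) (N w x) \<partial>M)"
    unfolding set_lebesgue_integral_def
    by (rule nn_integral_eq_integral[OF intK]) (simp add: g)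
  also have "(\<integral>x\<in>kept W. g (N u x) (N w x) \<partial>M)
      = (\<integral>x\<in>kept W. (\<lambda>ij. g (fst ij) (snd ij)) (?X x) \<partial>M)" by (simp only: fst_conv snd_conv)
  also have "\<dots> = prob (kept W) * (\<integral>ij. g (fst ij) (snd ij) \<partial>distr M (count_space UNIV) ?X)"
    by (rule integral_indep_event[OF K X kept_indep_counts[OF W u]]) simp
  also have "(\<integral>ij. g (fst ij) (snd ij) \<partial>distr M (count_space UNIV) ?X) = expectation (\<lambda>x. g (N u x) (N w x))"
    by (subst integral_distr[OF X]) simp_all
  also have "prob (kept W) * \<dots> = expectation (\<lambda>x. p ^ card W * g (N u x) (N w x))"
    unfolding prob_kept[OF W] by simp
  also have "ennreal \<dots> = (\<integral>\<^sup>+x. ennreal (p ^ card W * g (N u x) (N w x)) \<partial>M)"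
    using p by (intro nn_integral_eq_integral[symmetric] integrable_mult_right int) (simp add: g)
  finally show ?thesis .
qed

lemma balls_at_le: "balls_at s s0 m \<le> s"
  using s0_le by (simp add: balls_at_def)

abbreviation balls :: "nat list \<Rightarrow> 'a \<Rightarrow> real" where
  "balls u x \<equiv> real (balls_at s s0 (N u x))"

lemma balls_measurable: "u \<in> vertices b \<Longrightarrow> balls u \<in> borel_measurable M"
  by (rule count_measurable_borel)

text \<open>
  An edge lies on the path between \<open>u\<close> and \<open>w\<close> if it lies above exactly one of them.
\<close>

definition path_edges :: "nat list \<Rightarrow> nat list \<Rightarrow> nat list set" where
  "path_edges u w = (ancestors u - ancestors w) \<union> (ancestors w - ancestors u)"

lemma card_path_edges:
  "card (path_edges u w) + 2 * card (ancestors u \<inter> ancestors w) = length u + length w"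
proof -
  have "card (path_edges u w) = card (ancestors u - ancestors w) + card (ancestors w - ancestors u)"
    unfolding path_edges_def by (rule card_Un_disjoint) (auto simp: finite_ancestors)
  moreover have "card (ancestors u - ancestors w) + card (ancestors u \<inter> ancestors w) = length u"
    using card_Diff_subset_Int[of "ancestors u" "ancestors w"] card_mono[OF finite_ancestors Int_lower1, of u "ancestors w"]
    by (simp add: finite_ancestors card_ancestors)
  moreover have "card (ancestors w - ancestors u) + card (ancestors u \<inter> ancestors w) = length w"
    using card_Diff_subset_Int[of "ancestors w" "ancestors u"] card_mono[OF finite_ancestors Int_lower1, of w "ancestors u"]
    by (simp add: finite_ancestors card_ancestors Int_commute)
  ultimately show ?thesis by linarith
qed

lemma path_edges_vertices:
  "u \<in> vertices b \<Longrightarrow> w \<in> vertices b \<Longrightarrow> path_edges u w \<subseteq> vertices b - {[]}"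
  using ancestors_vertices by (auto simp: path_edges_def)

lemma finite_path_edges: "finite (path_edges u w)"
  by (simp add: path_edges_def finite_ancestors)

end

text \<open>
  Bernoulli's inequality removes the \<open>2 k\<close> missing factors at the price \<open>2 k (1 - p)\<close>, and the rest is the
  inequality of the geometric and the arithmetic mean.
\<close>

lemma power_path_le:
  fixes p :: real
  assumes p: "0 \<le> p" "p \<le> 1" and c: "c + 2 * k = l + m"
  shows "p ^ c \<le> ((p\<^sup>2) ^ l + (p\<^sup>2) ^ m) / 2 + 2 * (1 - p) * real k"
proof -
  have "1 + real (2 * k) * (p - 1) \<le> (1 + (p - 1)) ^ (2 * k)"
    by (rule Bernoulli_inequality) (use p in simp)
  then have B: "1 - p ^ (2 * k) \<le> 2 * (1 - p) * real k" by (simp add: algebra_simps)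
  have "p ^ (2 * k) \<le> 1" using p by (simp add: power_le_one)
  then have "p ^ c * (1 - p ^ (2 * k)) \<le> 1 * (1 - p ^ (2 * k))"
    using p by (intro mult_right_mono) (simp_all add: power_le_one)
  then have "p ^ c \<le> p ^ (c + 2 * k) + 2 * (1 - p) * real k"
    using B by (simp add: algebra_simps power_add)
  also have "p ^ (c + 2 * k) = p ^ l * p ^ m" by (simp add: c power_add)
  also have "p ^ l * p ^ m \<le> ((p ^ l)\<^sup>2 + (p ^ m)\<^sup>2) / 2"
    using zero_le_power2[of "p ^ l - p ^ m"] by (simp add: power2_diff)
  also have "((p ^ l)\<^sup>2 + (p ^ m)\<^sup>2) / 2 = ((p\<^sup>2) ^ l + (p\<^sup>2) ^ m) / 2"
    by (simp add: mult.commute flip: power_mult)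
  finally show ?thesis by simp
qed

text \<open>
  The tangent of the convex function \<open>k \<mapsto> p ^ k\<close> at \<open>d\<close>, with the negative terms moved to the other
  side so that it can be integrated in \<^typ>\<open>ennreal\<close>.
\<close>

lemma power_tangent_le:
  fixes p d :: real assumes "0 < p"
  shows "p powr d * (1 - d * ln p) \<le> p ^ k + p powr d * (- ln p) * real k"
proof -
  have "p ^ k = p powr d * p powr (real k - d)"
    using assms by (simp add: powr_realpow flip: powr_add)
  also have "p powr (real k - d) = exp ((real k - d) * ln p)" using assms by (simp add: powr_def)
  finally have pk: "p ^ k = p powr d * exp ((real k - d) * ln p)" .
  have "p powr d * (1 + (real k - d) * ln p) \<le> p ^ k"
    unfolding pk by (intro mult_left_mono exp_ge_add_one_self) simp
  then show ?thesis by (simp add: algebra_simps)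
qed

context realised_tree begin

lemma nn_integral_tree:
  fixes g :: "nat list \<Rightarrow> real"
  assumes zero: "\<And>u. N u = 0 \<Longrightarrow> g u = 0" and nn: "\<And>u. 0 \<le> g u"
  shows "(\<integral>\<^sup>+u. ennreal (g u) \<partial>count_space (vertices b)) = ennreal (\<Sum>u\<in>T. g u)"
proof -
  have "(\<integral>\<^sup>+u. ennreal (g u) \<partial>count_space (vertices b)) = (\<Sum>u\<in>T. ennreal (g u))"
  proof (rule nn_integral_count_space'[OF finite_tree])
    show "T \<subseteq> vertices b" using T_vertices by blast
    fix u assume "u \<in> vertices b" "u \<notin> T"
    then have "N u = 0" by (simp add: tree_vertices_def)
    then show "ennreal (g u) = 0" by (simp add: zero)
  qed
  also have "\<dots> = ennreal (\<Sum>u\<in>T. g u)" by (rule sum_ennreal) (rule nn)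
  finally show ?thesis .
qed

lemma nn_integral_tree_pairs:
  fixes g :: "nat list \<Rightarrow> nat list \<Rightarrow> real"
  assumes zero: "\<And>u w. N u = 0 \<or> N w = 0 \<Longrightarrow> g u w = 0"
    and nn: "\<And>u w. 0 \<le> g u w"
  shows "(\<integral>\<^sup>+z. ennreal (g (fst z) (snd z)) \<partial>count_space (vertices b \<times> vertices b))
       = ennreal (\<Sum>u\<in>T. \<Sum>w\<in>T. g u w)"
proof -
  have "(\<integral>\<^sup>+z. ennreal (g (fst z) (snd z)) \<partial>count_space (vertices b \<times> vertices b))
      = (\<Sum>z\<in>T \<times> T. ennreal (g (fst z) (snd z)))"
  proof (rule nn_integral_count_space')
    show "finite (T \<times> T)" using finite_tree by simp
    show "T \<times> T \<subseteq> vertices b \<times> vertices b" using T_vertices by blast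
    fix z assume "z \<in> vertices b \<times> vertices b" "z \<notin> T \<times> T"
    then have "N (fst z) = 0 \<or> N (snd z) = 0" by (auto simp: mem_Times_iff tree_vertices_def)
    then have "g (fst z) (snd z) = 0" by (rule zero)
    then show "ennreal (g (fst z) (snd z)) = 0" by simp
  qed
  also have "\<dots> = ennreal (\<Sum>z\<in>T \<times> T. g (fst z) (snd z))" by (rule sum_ennreal) (rule nn)
  also have "(\<Sum>z\<in>T \<times> T. g (fst z) (snd z)) = (\<Sum>u\<in>T. \<Sum>w\<in>T. g u w)"
    by (simp add: sum.cartesian_product split_def)
  finally show ?thesis .
qed

end

context percolated_process begin

text \<open>
  The sum of the squared cluster sizes counts the pairs of balls in a common cluster, and for those all edges
  between them are kept.
\<close>

lemma squares_le_connected_pairs: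
  assumes n: "0 < n"
  shows "AE x in M. ennreal ((real (root_size x))\<^sup>2
        + (real (second_size x))\<^sup>2)
     \<le> (\<integral>\<^sup>+z. ennreal (balls (fst z) x * balls (snd z) x) * indicator (kept (path_edges (fst z) (snd z))) x
          \<partial>count_space (vertices b \<times> vertices b))"
  using AE_realised AE_space
proof eventually_elim
  fix x assume "realised_tree b s s0 n (\<lambda>u. N u x)" and x: "x \<in> space M"
  then interpret R: realised_tree b s s0 n "\<lambda>u. N u x" by simp
  let ?E = "\<lambda>u. E u x"
  let ?k = "\<lambda>u w. indicator (kept (path_edges u w)) x :: real"
  have "(root_cluster_size b s s0 (\<lambda>u. N u x) ?E)\<^sup>2 + (second_cluster_size b s s0 (\<lambda>u. N u x) ?E)\<^sup>2
      \<le> (\<Sum>u\<in>R.T. \<Sum>w\<in>R.T. if (u, w) \<in> connection b (\<lambda>u. N u x) ?E then R.bal u * R.bal w else 0)"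
    using R.two_largest_squares[OF n, of ?E] unfolding R.sum_cluster_squares .
  then have "real ((root_cluster_size b s s0 (\<lambda>u. N u x) ?E)\<^sup>2 + (second_cluster_size b s s0 (\<lambda>u. N u x) ?E)\<^sup>2)
      \<le> real (\<Sum>u\<in>R.T. \<Sum>w\<in>R.T. if (u, w) \<in> connection b (\<lambda>u. N u x) ?E then R.bal u * R.bal w else 0)"
    by (rule of_nat_mono)
  also have "\<dots> \<le> (\<Sum>u\<in>R.T. \<Sum>w\<in>R.T. balls u x * balls w x * ?k u w)"
    unfolding of_nat_sum
  proof (intro sum_mono)
    fix u w
    have "x \<in> kept (path_edges u w)" if "(u, w) \<in> connection b (\<lambda>u. N u x) ?E"
    proof -
      have "(w, u) \<in> connection b (\<lambda>u. N u x) ?E"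
        using that equiv_connection[of b "\<lambda>u. N u x" ?E] by (blast elim: equivE dest: symD)
      then show ?thesis using x connected_kept[OF that] connected_kept[of w u]
        unfolding kept_def path_edges_def by blast
    qed
    then show "real (if (u, w) \<in> connection b (\<lambda>u. N u x) ?E then R.bal u * R.bal w else 0)
        \<le> balls u x * balls w x * ?k u w"
      by (auto simp: indicator_def)
  qed
  finally have le: "(real (root_cluster_size b s s0 (\<lambda>u. N u x) ?E))\<^sup>2
        + (real (second_cluster_size b s s0 (\<lambda>u. N u x) ?E))\<^sup>2
      \<le> (\<Sum>u\<in>R.T. \<Sum>w\<in>R.T. balls u x * balls w x * ?k u w)"
    by simp
  have "(\<integral>\<^sup>+z. ennreal (balls (fst z) x * balls (snd z) x) * indicator (kept (path_edges (fst z) (snd z))) x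
          \<partial>count_space (vertices b \<times> vertices b))
      = (\<integral>\<^sup>+z. ennreal (balls (fst z) x * balls (snd z) x * ?k (fst z) (snd z))
          \<partial>count_space (vertices b \<times> vertices b))"
    by (intro nn_integral_cong) (simp add: indicator_def)
  also have "\<dots> = ennreal (\<Sum>u\<in>R.T. \<Sum>w\<in>R.T. balls u x * balls w x * ?k u w)"
  proof (rule R.nn_integral_tree_pairs[where g = "\<lambda>u w. balls u x * balls w x * ?k u w"])
    fix u w assume "N u x = 0 \<or> N w x = 0"
    then show "balls u x * balls w x * ?k u w = 0" by (elim disjE) (simp_all add: balls_at_def)
  next
    fix u w show "0 \<le> balls u x * balls w x * ?k u w"
      by (intro mult_nonneg_nonneg of_nat_0_le_iff indicator_pos_le)
  qed
  finally have eq: "(\<integral>\<^sup>+z. ennreal (balls (fst z) x * balls (snd z) x) * indicator (kept (path_edges (fst z) (snd z))) x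
          \<partial>count_space (vertices b \<times> vertices b))
      = ennreal (\<Sum>u\<in>R.T. \<Sum>w\<in>R.T. balls u x * balls w x * ?k u w)" .
  show "ennreal ((real (root_cluster_size b s s0 (\<lambda>u. N u x) ?E))\<^sup>2
        + (real (second_cluster_size b s s0 (\<lambda>u. N u x) ?E))\<^sup>2)
     \<le> (\<integral>\<^sup>+z. ennreal (balls (fst z) x * balls (snd z) x) * indicator (kept (path_edges (fst z) (snd z))) x
          \<partial>count_space (vertices b \<times> vertices b))"
    unfolding eq by (rule ennreal_leI[OF le])
qed

text \<open>
  Expectation of the previous bound: first over the edges, which turns kept paths into powers of \<open>p\<close>, and
  then over the counts, where \<open>power_path_le\<close> separates the two balls.
\<close>

lemma second_moment_le:
  assumes n: "0 < n" and p: "0 < p" "p \<le> 1"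
    and ss: "supersolution (p\<^sup>2) (\<lambda>m. real (balls_at s s0 m)) H"
  shows "(\<integral>\<^sup>+x. ennreal ((real (root_size x))\<^sup>2
        + (real (second_size x))\<^sup>2) \<partial>M)
     \<le> ennreal (real n * H n + 2 * (1 - p) * (square_const * (real n)\<^sup>2))"
proof -
  let ?VV = "count_space (vertices b \<times> vertices b)"
  let ?c = "\<lambda>z. card (path_edges (fst z) (snd z))"
  let ?P2 = "\<lambda>x. \<integral>\<^sup>+u. ennreal ((p\<^sup>2) ^ length u * balls u x) \<partial>count_space (vertices b)"
  let ?Q = "\<lambda>x. \<integral>\<^sup>+u. ennreal (1 ^ length u * (real (N u x))\<^sup>2) \<partial>count_space (vertices b)"
  let ?W = "\<lambda>x. \<integral>\<^sup>+z. ennreal (p ^ ?c z * (balls (fst z) x * balls (snd z) x)) \<partial>?VV"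
  have cVV: "countable (vertices b \<times> vertices b)" by (intro countable_SIGMA countable_vertices)
  have bm: "(\<lambda>x. ennreal (c * (balls (fst z) x * balls (snd z) x))) \<in> borel_measurable M"
    if "z \<in> vertices b \<times> vertices b" for z c
    using that balls_measurable[of "fst z"] balls_measurable[of "snd z"]
    by (intro measurable_compose[OF _ measurable_ennreal] borel_measurable_times borel_measurable_const) (auto simp: mem_Times_iff)
  have "(\<integral>\<^sup>+x. ennreal ((real (root_size x))\<^sup>2
        + (real (second_size x))\<^sup>2) \<partial>M)
     \<le> (\<integral>\<^sup>+x. \<integral>\<^sup>+z. ennreal (balls (fst z) x * balls (snd z) x) * indicator (kept (path_edges (fst z) (snd z))) x
          \<partial>?VV \<partial>M)"
    by (rule nn_integral_mono_AE[OF squares_le_connected_pairs[OF n]])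
  also have "\<dots> = (\<integral>\<^sup>+z. \<integral>\<^sup>+x. ennreal (balls (fst z) x * balls (snd z) x) * indicator (kept (path_edges (fst z) (snd z))) x
          \<partial>M \<partial>?VV)"
  proof (rule nn_integral_count_space_nn_integral[OF cVV])
    fix z assume z: "z \<in> vertices b \<times> vertices b"
    show "(\<lambda>x. ennreal (balls (fst z) x * balls (snd z) x) * indicator (kept (path_edges (fst z) (snd z))) x)
        \<in> borel_measurable M"
      using bm[OF z, of 1] z
      by (intro borel_measurable_times_ennreal borel_measurable_indicator kept_event finite_path_edges path_edges_vertices)
         (auto simp: mem_Times_iff)
  qed
  also have "\<dots> = (\<integral>\<^sup>+z. \<integral>\<^sup>+x. ennreal (p ^ ?c z * (balls (fst z) x * balls (snd z) x)) \<partial>M \<partial>?VV)"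
  proof (rule nn_integral_cong)
    fix z assume "z \<in> space ?VV"
    then have z: "fst z \<in> vertices b" "snd z \<in> vertices b" by (auto simp: mem_Times_iff)
    show "(\<integral>\<^sup>+x. ennreal (balls (fst z) x * balls (snd z) x) * indicator (kept (path_edges (fst z) (snd z))) x \<partial>M)
       = (\<integral>\<^sup>+x. ennreal (p ^ ?c z * (balls (fst z) x * balls (snd z) x)) \<partial>M)"
    proof (rule counts_on_kept[OF finite_path_edges path_edges_vertices[OF z] z _ _ p(1)])
      show "real (balls_at s s0 i) * real (balls_at s s0 j) \<le> real s * real s" for i j
        using balls_at_le by (intro mult_mono) auto
    qed simp
  qed
  also have "\<dots> = (\<integral>\<^sup>+x. \<integral>\<^sup>+z. ennreal (p ^ ?c z * (balls (fst z) x * balls (snd z) x)) \<partial>?VV \<partial>M)"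
    by (rule nn_integral_count_space_nn_integral[OF cVV bm, symmetric])
  also have "\<dots> \<le> (\<integral>\<^sup>+x. ennreal (real n) * ?P2 x
       + ennreal (2 * (1 - p)) * ?Q x \<partial>M)"
  proof (rule nn_integral_mono_AE)
    show "AE x in M. ?W x
      \<le> ennreal (real n) * ?P2 x
       + ennreal (2 * (1 - p)) * ?Q x"
      using AE_realised
    proof eventually_elim
      fix x assume "realised_tree b s s0 n (\<lambda>u. N u x)"
      then interpret R: realised_tree b s s0 n "\<lambda>u. N u x" by simp
      let ?P = "\<lambda>u. (p\<^sup>2) ^ length u * balls u x"
      let ?k = "\<lambda>u w. real (card (ancestors u \<inter> ancestors w))"
      have tot: "(\<Sum>u\<in>R.T. balls u x) = real n" unfolding of_nat_sum[symmetric] R.total_balls ..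
      have "?W x
          = ennreal (\<Sum>u\<in>R.T. \<Sum>w\<in>R.T. p ^ card (path_edges u w) * (balls u x * balls w x))"
        by (rule R.nn_integral_tree_pairs[where g = "\<lambda>u w. p ^ card (path_edges u w) * (balls u x * balls w x)"]) (use p in \<open>auto simp: balls_at_def\<close>)
      also have "\<dots> \<le> ennreal (real n * (\<Sum>u\<in>R.T. ?P u) + 2 * (1 - p) * (\<Sum>v\<in>R.T. (real (N v x))\<^sup>2))"
      proof (rule ennreal_leI)
        have "(\<Sum>u\<in>R.T. \<Sum>w\<in>R.T. p ^ card (path_edges u w) * (balls u x * balls w x))
           \<le> (\<Sum>u\<in>R.T. \<Sum>w\<in>R.T. (((p\<^sup>2) ^ length u + (p\<^sup>2) ^ length w) / 2 + 2 * (1 - p) * ?k u w)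
                 * (balls u x * balls w x))"
          using p card_path_edges by (intro sum_mono mult_right_mono power_path_le) auto
        also have "\<dots> = (\<Sum>u\<in>R.T. \<Sum>w\<in>R.T. ?P u * balls w x / 2 + balls u x * ?P w / 2
              + 2 * (1 - p) * (balls u x * balls w x * ?k u w))"
          by (intro sum.cong refl) (simp add: algebra_simps add_divide_distrib)
        also have "\<dots> = (\<Sum>u\<in>R.T. ?P u) * (\<Sum>w\<in>R.T. balls w x) / 2 + (\<Sum>u\<in>R.T. balls u x) * (\<Sum>w\<in>R.T. ?P w) / 2
              + 2 * (1 - p) * (\<Sum>u\<in>R.T. \<Sum>w\<in>R.T. balls u x * balls w x * ?k u w)"
          by (simp only: sum.distrib sum_product sum_divide_distrib) (simp only: sum_distrib_left)
        also have "\<dots> = real n * (\<Sum>u\<in>R.T. ?P u) + 2 * (1 - p) * (\<Sum>u\<in>R.T. \<Sum>w\<in>R.T. balls u x * balls w x * ?k u w)"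
          unfolding tot by simp
        also have "(\<Sum>u\<in>R.T. \<Sum>w\<in>R.T. balls u x * balls w x * ?k u w)
            = real (\<Sum>u\<in>R.T. \<Sum>w\<in>R.T. R.bal u * R.bal w * card (ancestors u \<inter> ancestors w))"
          by simp
        also have "2 * (1 - p) * \<dots> \<le> 2 * (1 - p) * real (\<Sum>v\<in>R.T. (N v x)\<^sup>2)"
          using p R.common_ancestors_le by (intro mult_left_mono of_nat_mono) auto
        finally show "(\<Sum>u\<in>R.T. \<Sum>w\<in>R.T. p ^ card (path_edges u w) * (balls u x * balls w x))
          \<le> real n * (\<Sum>u\<in>R.T. ?P u) + 2 * (1 - p) * (\<Sum>v\<in>R.T. (real (N v x))\<^sup>2)" by simp
      qed
      also have "\<dots> = ennreal (real n) * ennreal (\<Sum>u\<in>R.T. ?P u)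
          + ennreal (2 * (1 - p)) * ennreal (\<Sum>v\<in>R.T. (real (N v x))\<^sup>2)"
        using p by (simp add: ennreal_plus ennreal_mult sum_nonneg)
      also have "ennreal (\<Sum>u\<in>R.T. ?P u) = (\<integral>\<^sup>+u. ennreal (?P u) \<partial>count_space (vertices b))"
        by (rule R.nn_integral_tree[symmetric]) (auto simp: balls_at_def)
      also have "ennreal (\<Sum>v\<in>R.T. (real (N v x))\<^sup>2) = ?Q x"
        by (subst R.nn_integral_tree) auto
      finally show "?W x
        \<le> ennreal (real n) * ?P2 x
         + ennreal (2 * (1 - p)) * ?Q x" .
    qed
  qed
  also have "\<dots> = ennreal (real n) * (\<integral>\<^sup>+x. ?P2 x \<partial>M)
       + ennreal (2 * (1 - p)) * (\<integral>\<^sup>+x. ?Q x \<partial>M)"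
  proof -
    have m: "(\<lambda>x. \<integral>\<^sup>+u. ennreal (q ^ length u * \<phi> (N u x)) \<partial>count_space (vertices b)) \<in> borel_measurable M"
      for q and \<phi> :: "nat \<Rightarrow> real"
      by (rule measurable_nn_integral_count_space[OF _ countable_vertices])
         (intro measurable_compose[OF _ measurable_ennreal] borel_measurable_times borel_measurable_const count_measurable_borel)
    note m1 = m[of "p\<^sup>2" "\<lambda>m. real (balls_at s s0 m)"] and m2 = m[of 1 "\<lambda>m. (real m)\<^sup>2"]
    show ?thesis
      by (subst nn_integral_add) (use m1 m2 in \<open>auto simp: nn_integral_cmult intro!: borel_measurable_times\<close>)
  qed
  also have "\<dots> \<le> ennreal (real n) * ennreal (H n) + ennreal (2 * (1 - p)) * ennreal (square_const * (real n)\<^sup>2)"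
    by (intro add_mono mult_left_mono supersolution_bound[OF ss] supersolution_bound[OF supersolution_square]) auto
  also have "\<dots> = ennreal (real n * H n + 2 * (1 - p) * (square_const * (real n)\<^sup>2))"
  proof -
    have "0 \<le> H n" using ss unfolding supersolution_def by (meson order_trans)
    then show ?thesis using p square_const_ge_1 by (simp add: ennreal_plus ennreal_mult)
  qed
  finally show ?thesis .
qed

text \<open>
  The tangent at \<open>d\<close> gives \<open>E p ^ D \<ge> p powr d * (1 + (E D - d) ln p)\<close>, and the bracket is at least \<open>1\<close>
  because \<open>E D \<le> d\<close> and \<open>ln p \<le> 0\<close>. The total depth of the balls is at most the sum of all counts, which
  the supersolution bounds by \<open>n d\<close>.
\<close>

lemma first_moment_ge:
  assumes p: "0 < p" "p \<le> 1" and ss: "supersolution 1 real f" and d: "f n \<le> real n * d" "0 \<le> d"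
  shows "ennreal (real n * p powr d)
     \<le> (\<integral>\<^sup>+x. ennreal (real (root_size x)) \<partial>M)"
proof -
  let ?V = "count_space (vertices b)"
  let ?t = "p powr d * (- ln p)"
  let ?A = "\<lambda>x. \<integral>\<^sup>+u. ennreal (p ^ length u * balls u x) \<partial>?V"
  let ?Z = "\<lambda>x. \<integral>\<^sup>+u. ennreal (1 ^ length u * real (N u x)) \<partial>?V"
  have t: "0 \<le> ?t" using p by (intro mult_nonneg_nonneg) auto
  have bm: "(\<lambda>x. ennreal (c * balls u x)) \<in> borel_measurable M" if "u \<in> vertices b" for u c
    by (intro measurable_compose[OF _ measurable_ennreal] borel_measurable_times borel_measurable_const balls_measurable that)
  have "ennreal (real n * p powr d + ?t * (real n * d))
      = (\<integral>\<^sup>+x. ennreal (real n * p powr d + ?t * (real n * d)) \<partial>M)"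
    by (simp add: emeasure_space_1)
  also have "\<dots> \<le> (\<integral>\<^sup>+x. ?A x
      + ennreal ?t * ?Z x \<partial>M)"
  proof (rule nn_integral_mono_AE)
    show "AE x in M. ennreal (real n * p powr d + ?t * (real n * d))
       \<le> ?A x
        + ennreal ?t * ?Z x"
      using AE_realised
    proof eventually_elim
      fix x assume "realised_tree b s s0 n (\<lambda>u. N u x)"
      then interpret R: realised_tree b s s0 n "\<lambda>u. N u x" by simp
      have tot: "(\<Sum>u\<in>R.T. balls u x) = real n" unfolding of_nat_sum[symmetric] R.total_balls ..
      have "real n * p powr d + ?t * (real n * d) = (\<Sum>u\<in>R.T. p powr d * (1 - d * ln p) * balls u x)"
        unfolding sum_distrib_left[symmetric] tot by (simp add: algebra_simps)
      also have "\<dots> \<le> (\<Sum>u\<in>R.T. (p ^ length u + ?t * real (length u)) * balls u x)"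
        by (intro sum_mono mult_right_mono power_tangent_le p) simp
      also have "\<dots> = (\<Sum>u\<in>R.T. p ^ length u * balls u x) + ?t * real (\<Sum>u\<in>R.T. length u * R.bal u)"
        by (simp only: distrib_right sum.distrib of_nat_sum of_nat_mult sum_distrib_left mult.assoc)
      also have "?t * real (\<Sum>u\<in>R.T. length u * R.bal u) \<le> ?t * real (\<Sum>v\<in>R.T. N v x)"
        by (intro mult_left_mono t of_nat_mono R.path_length_le)
      finally have "ennreal (real n * p powr d + ?t * (real n * d))
          \<le> ennreal ((\<Sum>u\<in>R.T. p ^ length u * balls u x) + ?t * (\<Sum>v\<in>R.T. real (N v x)))"
        by (intro ennreal_leI) (simp only: of_nat_sum)
      also have "\<dots> = ennreal (\<Sum>u\<in>R.T. p ^ length u * balls u x) + ennreal ?t * ennreal (\<Sum>v\<in>R.T. real (N v x))"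
      proof -
        have "0 \<le> (\<Sum>u\<in>R.T. p ^ length u * balls u x)" "0 \<le> (\<Sum>v\<in>R.T. real (N v x))"
          using p by (auto intro!: sum_nonneg)
        then show ?thesis using t by (simp only: ennreal_plus ennreal_mult mult_nonneg_nonneg)
      qed
      also have "ennreal (\<Sum>u\<in>R.T. p ^ length u * balls u x) = ?A x"
        by (rule R.nn_integral_tree[symmetric]) (use p in \<open>auto simp: balls_at_def\<close>)
      also have "ennreal (\<Sum>v\<in>R.T. real (N v x)) = ?Z x"
        by (subst R.nn_integral_tree) auto
      finally show "ennreal (real n * p powr d + ?t * (real n * d))
       \<le> ?A x
        + ennreal ?t * ?Z x" .
    qed
  qed
  also have "\<dots> = (\<integral>\<^sup>+x. ?A x \<partial>M)
      + ennreal ?t * (\<integral>\<^sup>+x. ?Z x \<partial>M)"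
  proof -
    have m: "(\<lambda>x. \<integral>\<^sup>+u. ennreal (q ^ length u * \<phi> (N u x)) \<partial>?V) \<in> borel_measurable M"
      for q and \<phi> :: "nat \<Rightarrow> real"
      by (rule measurable_nn_integral_count_space[OF _ countable_vertices])
         (intro measurable_compose[OF _ measurable_ennreal] borel_measurable_times borel_measurable_const count_measurable_borel)
    note m1 = m[of p "\<lambda>m. real (balls_at s s0 m)"] and m2 = m[of 1 real]
    show ?thesis
      by (subst nn_integral_add) (use m1 m2 in \<open>auto simp: nn_integral_cmult intro!: borel_measurable_times\<close>)
  qed
  also have "\<dots> \<le> (\<integral>\<^sup>+x. ?A x \<partial>M) + ennreal (?t * (real n * d))"
  proof (rule add_left_mono)
    have "ennreal ?t * (\<integral>\<^sup>+x. ?Z x \<partial>M)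
        \<le> ennreal ?t * ennreal (real n * d)"
      by (intro mult_left_mono order_trans[OF supersolution_bound[OF ss]] ennreal_leI d) simp
    also have "\<dots> = ennreal (?t * (real n * d))" using t d by (intro ennreal_mult[symmetric]) auto
    finally show "ennreal ?t * (\<integral>\<^sup>+x. ?Z x \<partial>M)
        \<le> ennreal (?t * (real n * d))" .
  qed
  finally have "ennreal (real n * p powr d + ?t * (real n * d))
      \<le> (\<integral>\<^sup>+x. ?A x \<partial>M) + ennreal (?t * (real n * d))" .
  moreover have "ennreal (real n * p powr d + ?t * (real n * d)) = ennreal (real n * p powr d) + ennreal (?t * (real n * d))"
    using p d by (intro ennreal_plus mult_nonneg_nonneg) simp_all
  ultimately have "ennreal (real n * p powr d) + ennreal (?t * (real n * d))
      \<le> (\<integral>\<^sup>+x. ?A x \<partial>M) + ennreal (?t * (real n * d))"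
    by (simp only:)
  then have "ennreal (real n * p powr d) \<le> (\<integral>\<^sup>+x. ?A x \<partial>M)"
    by (simp add: add.commute[of _ "ennreal (?t * (real n * d))"] ennreal_add_left_cancel_le)
  also have "\<dots> = (\<integral>\<^sup>+u. \<integral>\<^sup>+x. ennreal (p ^ length u * balls u x) \<partial>M \<partial>?V)"
    by (rule nn_integral_count_space_nn_integral[OF countable_vertices bm])
  also have "\<dots> = (\<integral>\<^sup>+u. \<integral>\<^sup>+x. ennreal (balls u x) * indicator (kept (ancestors u)) x \<partial>M \<partial>?V)"
  proof (rule nn_integral_cong)
    fix u assume "u \<in> space ?V"
    then have u: "u \<in> vertices b" by simp
    show "(\<integral>\<^sup>+x. ennreal (p ^ length u * balls u x) \<partial>M)
        = (\<integral>\<^sup>+x. ennreal (balls u x) * indicator (kept (ancestors u)) x \<partial>M)"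
      unfolding card_ancestors[symmetric]
    proof (rule counts_on_kept[OF finite_ancestors ancestors_vertices[OF u] u u _ _ p(1), symmetric])
      show "real (balls_at s s0 i) \<le> real s" for i using balls_at_le by simp
    qed simp
  qed
  also have "\<dots> = (\<integral>\<^sup>+x. \<integral>\<^sup>+u. ennreal (balls u x) * indicator (kept (ancestors u)) x \<partial>?V \<partial>M)"
  proof (rule nn_integral_count_space_nn_integral[OF countable_vertices, symmetric])
    fix u assume u: "u \<in> vertices b"
    show "(\<lambda>x. ennreal (balls u x) * indicator (kept (ancestors u)) x) \<in> borel_measurable M"
      using bm[OF u, of 1] by (intro borel_measurable_times_ennreal borel_measurable_indicator
          kept_event finite_ancestors ancestors_vertices u) auto
  qed
  also have "\<dots> \<le> (\<integral>\<^sup>+x. ennreal (real (root_size x)) \<partial>M)"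
  proof (rule nn_integral_mono_AE)
    show "AE x in M. (\<integral>\<^sup>+u. ennreal (balls u x) * indicator (kept (ancestors u)) x \<partial>?V)
        \<le> ennreal (real (root_size x))"
      using AE_realised
    proof eventually_elim
      fix x assume "realised_tree b s s0 n (\<lambda>u. N u x)"
      then interpret R: realised_tree b s s0 n "\<lambda>u. N u x" by simp
      let ?k = "\<lambda>u. indicator (kept (ancestors u)) x :: real"
      have "(\<integral>\<^sup>+u. ennreal (balls u x) * indicator (kept (ancestors u)) x \<partial>?V)
          = (\<integral>\<^sup>+u. ennreal (balls u x * ?k u) \<partial>?V)"
        by (intro nn_integral_cong) (simp add: indicator_def)
      also have "\<dots> = ennreal (\<Sum>u\<in>R.T. balls u x * ?k u)"
        by (rule R.nn_integral_tree) (auto simp: balls_at_def)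
      also have "\<dots> \<le> ennreal (real (root_size x))"
        unfolding R.root_cluster_size_eq of_nat_sum
      proof (intro ennreal_leI sum_mono)
        fix u assume u: "u \<in> R.T"
        have "([], u) \<in> connection b (\<lambda>u. N u x) (\<lambda>u. E u x)" if "x \<in> kept (ancestors u)"
          using that by (intro R.root_cluster_kept[OF u]) (simp add: kept_def)
        then show "balls u x * ?k u
            \<le> real (if ([], u) \<in> connection b (\<lambda>u. N u x) (\<lambda>u. E u x) then R.bal u else 0)"
          by (auto simp: indicator_def)
      qed
      finally show "(\<integral>\<^sup>+u. ennreal (balls u x) * indicator (kept (ancestors u)) x \<partial>?V)
        \<le> ennreal (real (root_size x))" .
    qed
  qed
  finally show ?thesis .
qed

end

section \<open>Measurability of the cluster sizes\<close>

lemma clusters_image: "clusters b N E = (\<lambda>u. connection b N E `` {u}) ` tree_vertices b N"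
  unfolding clusters_def quotient_def by blast

text \<open>
  A list of representatives expresses finiteness by countable quantifiers.
\<close>

lemma finite_clusters_iff:
  "finite (clusters b N E) \<longleftrightarrow>
     (\<exists>l. \<forall>u. u \<in> tree_vertices b N \<longrightarrow> (\<exists>v\<in>set l. (v, u) \<in> connection b N E))"
proof
  assume "finite (clusters b N E)"
  then obtain F where F: "F \<subseteq> tree_vertices b N" "finite F"
    "clusters b N E = (\<lambda>u. connection b N E `` {u}) ` F"
    using finite_subset_image[of "clusters b N E" "\<lambda>u. connection b N E `` {u}" "tree_vertices b N"]
    unfolding clusters_image by blast
  obtain l where l: "set l = F" using finite_list[OF F(2)] by blast
  have "\<exists>v\<in>set l. (v, u) \<in> connection b N E" if u: "u \<in> tree_vertices b N" for u
  proof -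
    have "connection b N E `` {u} \<in> clusters b N E" unfolding clusters_image using u by (rule imageI)
    then obtain v where v: "v \<in> F" "connection b N E `` {u} = connection b N E `` {v}" unfolding F(3) by blast
    moreover have "u \<in> connection b N E `` {u}" by (rule equiv_class_self[OF equiv_connection u])
    ultimately show ?thesis unfolding l by blast
  qed
  then show "\<exists>l. \<forall>u. u \<in> tree_vertices b N \<longrightarrow> (\<exists>v\<in>set l. (v, u) \<in> connection b N E)" by blast
next
  assume "\<exists>l. \<forall>u. u \<in> tree_vertices b N \<longrightarrow> (\<exists>v\<in>set l. (v, u) \<in> connection b N E)"
  then obtain l where l: "\<And>u. u \<in> tree_vertices b N \<Longrightarrow> \<exists>v\<in>set l. (v, u) \<in> connection b N E" by blast
  have "clusters b N E \<subseteq> (\<lambda>u. connection b N E `` {u}) ` set l"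
  proof
    fix C assume "C \<in> clusters b N E"
    then obtain u where u: "u \<in> tree_vertices b N" "C = connection b N E `` {u}" unfolding clusters_image by blast
    obtain v where v: "v \<in> set l" "(v, u) \<in> connection b N E" using l[OF u(1)] by blast
    have "C = connection b N E `` {v}" unfolding u(2) by (rule equiv_class_eq[OF equiv_connection v(2), symmetric])
    then show "C \<in> (\<lambda>u. connection b N E `` {u}) ` set l" using v(1) by (rule image_eqI)
  qed
  then show "finite (clusters b N E)" by (rule finite_subset) simp
qed

text \<open>
  Every operation on the right is a countable one in the events that two vertices are connected.
\<close>

lemma second_cluster_size_ge_iff:
  assumes t: "0 < t"
  shows "t \<le> second_cluster_size b s s0 N E \<longleftrightarrow> finite (clusters b N E) \<and>
    (\<exists>u w. u \<in> tree_vertices b N \<and> w \<in> tree_vertices b N \<and> (u, w) \<notin> connection b N E \<and>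
       t \<le> cluster_size s s0 N (connection b N E `` {u}) \<and> t \<le> cluster_size s s0 N (connection b N E `` {w}))"
    (is "_ \<longleftrightarrow> _ \<and> ?pair")
proof -
  define L where "L = rev (sorted_list_of_multiset
      (image_mset (cluster_size s s0 N) (mset_set (clusters b N E))))"
  have S: "second_cluster_size b s s0 N E = (if length L < 2 then 0 else L ! 1)"
    by (simp add: second_cluster_size_def L_def)
  have len: "length L = card (clusters b N E)"
  proof -
    have "length L = size (mset L)" by simp
    also have "mset L = image_mset (cluster_size s s0 N) (mset_set (clusters b N E))" by (simp add: L_def)
    finally show ?thesis by simp
  qed
  let ?two = "\<exists>C\<in>clusters b N E. \<exists>D\<in>clusters b N E. C \<noteq> D \<and> t \<le> cluster_size s s0 N C \<and> t \<le> cluster_size s s0 N D"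
  have pair: "?two \<longleftrightarrow> ?pair"
  proof
    assume ?two
    then obtain C D where CD: "C \<in> clusters b N E" "D \<in> clusters b N E" "C \<noteq> D"
      "t \<le> cluster_size s s0 N C" "t \<le> cluster_size s s0 N D" by blast
    obtain u w where uw: "u \<in> tree_vertices b N" "C = connection b N E `` {u}"
      "w \<in> tree_vertices b N" "D = connection b N E `` {w}"
      using CD(1,2) unfolding clusters_image by blast
    have "(u, w) \<notin> connection b N E"
      using CD(3) equiv_class_eq[OF equiv_connection, of u w b N E] unfolding uw by blast
    then show ?pair using uw CD(4,5) by blast
  next
    assume ?pair
    then obtain u w where uw: "u \<in> tree_vertices b N" "w \<in> tree_vertices b N" "(u, w) \<notin> connection b N E"
       "t \<le> cluster_size s s0 N (connection b N E `` {u})" "t \<le> cluster_size s s0 N (connection b N E `` {w})" by blast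
    have "w \<in> connection b N E `` {w}" by (rule equiv_class_self[OF equiv_connection uw(2)])
    then have ne: "connection b N E `` {u} \<noteq> connection b N E `` {w}" using uw(3) by blast
    have in_clusters: "connection b N E `` {u} \<in> clusters b N E" "connection b N E `` {w} \<in> clusters b N E"
      unfolding clusters_image by (rule imageI, rule uw)+
    show ?two
      by (rule bexI[OF _ in_clusters(1)], rule bexI[OF _ in_clusters(2)]) (intro conjI ne uw(4,5))
  qed
  show ?thesis
  proof (cases "finite (clusters b N E)")
    case False
    then have "length L = 0" by (simp add: len)
    then show ?thesis using t False by (simp add: S)
  next
    case True
    show ?thesis
    proof (cases "2 \<le> length L")
      case two: True
      then have "t \<le> second_cluster_size b s s0 N E \<longleftrightarrow> t \<le> L ! 1" by (simp add: S)
      also have "\<dots> \<longleftrightarrow> ?two" unfolding L_def by (rule second_largest_ge_iff[OF True two[unfolded L_def]])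
      finally show ?thesis using True pair by blast
    next
      case False
      then have "card (clusters b N E) \<le> Suc 0" using len by linarith
      then have "\<not> ?two" using card_le_Suc0_iff_eq[OF True] by blast
      moreover have "\<not> t \<le> second_cluster_size b s s0 N E" using t False by (simp add: S)
      ultimately show ?thesis using pair by blast
    qed
  qed
qed

context percolated_process begin

abbreviation connected :: "nat list \<Rightarrow> nat list \<Rightarrow> 'a \<Rightarrow> bool" where
  "connected u w x \<equiv> (u, w) \<in> connection b (\<lambda>u. N u x) (\<lambda>u. E u x)"

lemma tree_event: "{x \<in> space M. u \<in> tree_vertices b (\<lambda>u. N u x)} \<in> events"
proof (cases "u \<in> vertices b")
  case True
  then show ?thesis using count_event[OF True, of "\<lambda>m. 0 < m"] by (simp add: tree_vertices_def)
next
  case False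
  then show ?thesis by (simp add: tree_vertices_def)
qed

lemma kept_edge_event: "{x \<in> space M. (u, w) \<in> kept_edges b (\<lambda>u. N u x) (\<lambda>u. E u x)} \<in> events"
proof (cases "w \<in> vertices b - {[]} \<and> (\<exists>i. w = u @ [i])")
  case True
  then have w: "w \<in> vertices b - {[]}" and ex: "\<exists>i. w = u @ [i]" by blast+
  have "{x \<in> space M. (u, w) \<in> kept_edges b (\<lambda>u. N u x) (\<lambda>u. E u x)}
      = {x \<in> space M. u \<in> tree_vertices b (\<lambda>u. N u x)} \<inter> {x \<in> space M. w \<in> tree_vertices b (\<lambda>u. N u x)}
        \<inter> (E w -` {True} \<inter> space M)"
    using ex unfolding kept_edges_def by blast
  also have "\<dots> \<in> events" by (intro sets.Int tree_event edge_event w)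
  finally show ?thesis .
next
  case False
  have "{x \<in> space M. (u, w) \<in> kept_edges b (\<lambda>u. N u x) (\<lambda>u. E u x)} = {}"
    using False unfolding kept_edges_def tree_vertices_def by blast
  then show ?thesis by (simp only: sets.empty_sets)
qed

lemma connected_event: "{x \<in> space M. connected u w x} \<in> events"
proof -
  let ?K = "\<lambda>x. kept_edges b (\<lambda>u. N u x) (\<lambda>u. E u x)"
  let ?R = "\<lambda>x. ?K x \<union> (?K x)\<inverse>"
  have R: "{x \<in> space M. (u, w) \<in> ?R x} \<in> events" for u w
  proof -
    have "{x \<in> space M. (u, w) \<in> ?R x} = {x \<in> space M. (u, w) \<in> ?K x} \<union> {x \<in> space M. (w, u) \<in> ?K x}"
      by blast
    also have "\<dots> \<in> events" by (intro sets.Un kept_edge_event)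
    finally show ?thesis .
  qed
  have pow: "{x \<in> space M. (u, w) \<in> ?R x ^^ k} \<in> events" for k w
  proof (induction k arbitrary: w)
    case 0
    show ?case by (cases "u = w") simp_all
  next
    case (Suc k)
    have "{x \<in> space M. (u, w) \<in> ?R x ^^ Suc k}
        = {x \<in> space M. \<exists>z. (u, z) \<in> ?R x ^^ k \<and> (z, w) \<in> ?R x}"
      by (simp only: relpow.simps relcomp_unfold mem_Collect_eq split_conv)
    also have "\<dots> \<in> events"
      by (intro sets.sets_Collect_countable_Ex sets.sets_Collect_conj Suc.IH R)
    finally show ?case .
  qed
  have "{x \<in> space M. connected u w x}
      = {x \<in> space M. u \<in> tree_vertices b (\<lambda>u. N u x)} \<inter> {x \<in> space M. w \<in> tree_vertices b (\<lambda>u. N u x)}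
        \<inter> {x \<in> space M. \<exists>k. (u, w) \<in> ?R x ^^ k}"
    unfolding connection_def rtrancl_power by blast
  also have "\<dots> \<in> events"
    by (intro sets.Int tree_event sets.sets_Collect_countable_Ex pow)
  finally show ?thesis .
qed

abbreviation cluster_of :: "nat list \<Rightarrow> 'a \<Rightarrow> nat" where
  "cluster_of u x \<equiv> cluster_size s s0 (\<lambda>u. N u x) (connection b (\<lambda>u. N u x) (\<lambda>u. E u x) `` {u})"

lemma cluster_eq_event: "{x \<in> space M. \<forall>w. w \<in> set l \<longleftrightarrow> connected u w x} \<in> events"
proof (rule sets.sets_Collect_countable_All)
  fix w
  show "{x \<in> space M. w \<in> set l \<longleftrightarrow> connected u w x} \<in> events"
    using connected_event[of u w] sets.sets_Collect_neg[OF connected_event[of u w]]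
    by (cases "w \<in> set l") simp_all
qed

text \<open>
  A finite cluster is encoded by a list of its vertices, of which there are countably many, and infinite
  clusters have size \<open>0\<close> by the convention on sums.
\<close>

lemma cluster_size_event: "{x \<in> space M. cluster_of u x = t} \<in> events"
proof -
  let ?eq = "\<lambda>l x. \<forall>w. w \<in> set l \<longleftrightarrow> connected u w x"
  let ?sum = "\<lambda>l x. (\<Sum>v\<in>set l. balls v x)"
  have 1: "{x \<in> space M. ?eq l x \<and> ?sum l x = real t} \<in> events" for l
  proof (cases "set l \<subseteq> vertices b")
    case True
    have "?sum l \<in> borel_measurable M"
      using True by (intro borel_measurable_sum balls_measurable) blast
    then have "?sum l -` {real t} \<inter> space M \<in> events" by (rule measurable_sets) simp
    then have "{x \<in> space M. ?eq l x} \<inter> (?sum l -` {real t} \<inter> space M) \<in> events"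
      by (rule sets.Int[OF cluster_eq_event])
    moreover have "{x \<in> space M. ?eq l x} \<inter> (?sum l -` {real t} \<inter> space M)
        = {x \<in> space M. ?eq l x \<and> ?sum l x = real t}" by blast
    ultimately show ?thesis by (simp only:)
  next
    case False
    then have "{x \<in> space M. ?eq l x \<and> ?sum l x = real t} = {}"
      unfolding connection_def tree_vertices_def by blast
    then show ?thesis by (simp only: sets.empty_sets)
  qed
  have "{x \<in> space M. cluster_of u x = t}
      = {x \<in> space M. \<exists>l. ?eq l x \<and> ?sum l x = real t} \<union>
        (if t = 0 then {x \<in> space M. \<not> (\<exists>l. ?eq l x)} else {})"
  proof -
    have "cluster_of u x = t \<longleftrightarrow> (\<exists>l. ?eq l x \<and> ?sum l x = real t) \<or> (t = 0 \<and> \<not> (\<exists>l. ?eq l x))" for x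
    proof -
      let ?C = "connection b (\<lambda>u. N u x) (\<lambda>u. E u x) `` {u}"
      have eq: "?eq l x \<longleftrightarrow> set l = ?C" for l by blast
      have sum: "?sum l x = real t \<longleftrightarrow> cluster_of u x = t" if "set l = ?C" for l
        unfolding that cluster_size_def of_nat_sum[symmetric] by (rule of_nat_eq_iff)
      show ?thesis
      proof (cases "finite ?C")
        case True
        then obtain l where "set l = ?C" using finite_list by blast
        then show ?thesis using sum unfolding eq by metis
      next
        case False
        then have no: "\<not> (\<exists>l. set l = ?C)" by (metis List.finite_set)
        have "cluster_of u x = 0" using False by (simp add: cluster_size_def)
        then show ?thesis using no unfolding eq by metis
      qed
    qed
    then show ?thesis by auto
  qed
  also have "\<dots> \<in> events"
  proof (rule sets.Un)
    show "{x \<in> space M. \<exists>l. ?eq l x \<and> ?sum l x = real t} \<in> events"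
      by (rule sets.sets_Collect_countable_Ex[OF 1])
    have "{x \<in> space M. \<not> (\<exists>l. ?eq l x)} \<in> events"
      by (intro sets.sets_Collect_neg sets.sets_Collect_countable_Ex cluster_eq_event)
    then show "(if t = 0 then {x \<in> space M. \<not> (\<exists>l. ?eq l x)} else {}) \<in> events" by simp
  qed
  finally show ?thesis .
qed

lemma nat_valued_borel:
  assumes "\<And>t. {x \<in> space M. f x = (t::nat)} \<in> events"
  shows "(\<lambda>x. real (f x)) \<in> borel_measurable M"
proof -
  have "f \<in> measurable M (count_space UNIV)"
  proof (subst measurable_count_space_eq2_countable)
    have "f -` {t} \<inter> space M = {x \<in> space M. f x = t}" for t by blast
    then show "f \<in> space M \<rightarrow> UNIV \<and> (\<forall>a\<in>UNIV. f -` {a} \<inter> space M \<in> events)"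
      using assms by simp
  qed
  then show ?thesis by (rule measurable_compose) simp
qed

lemma root_cluster_size_measurable:
  "(\<lambda>x. real (root_size x)) \<in> borel_measurable M"
  unfolding root_cluster_size_def by (rule nat_valued_borel[OF cluster_size_event])

lemma second_cluster_size_measurable:
  "(\<lambda>x. real (second_size x)) \<in> borel_measurable M"
proof (rule nat_valued_borel)
  fix t
  let ?S = "\<lambda>x. second_size x"
  have fin: "{x \<in> space M. finite (clusters b (\<lambda>u. N u x) (\<lambda>u. E u x))} \<in> events"
    unfolding finite_clusters_iff
  proof (intro sets.sets_Collect_countable_Ex sets.sets_Collect_countable_All sets.sets_Collect_imp tree_event)
    fix l u
    show "{x \<in> space M. \<exists>v\<in>set l. connected v u x} \<in> events"
      by (rule sets.sets_Collect_finite_Ex[OF connected_event]) simp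
  qed
  have size: "{x \<in> space M. t \<le> cluster_of u x} \<in> events" for t u
  proof -
    have "{x \<in> space M. t \<le> cluster_of u x} = (\<Union>j\<in>{t..}. {x \<in> space M. cluster_of u x = j})" by auto
    also have "\<dots> \<in> events" by (rule sets.countable_UN''[OF _ cluster_size_event]) simp
    finally show ?thesis .
  qed
  have ge: "{x \<in> space M. t \<le> ?S x} \<in> events" if "0 < t" for t
    unfolding second_cluster_size_ge_iff[OF that]
    by (intro sets.sets_Collect_conj fin sets.sets_Collect_countable_Ex tree_event
          sets.sets_Collect_neg connected_event size)
  have "{x \<in> space M. ?S x = t} = {x \<in> space M. t = 0 \<or> t \<le> ?S x} - {x \<in> space M. Suc t \<le> ?S x}"
    by auto
  also have "\<dots> \<in> events"
    using ge[of t] ge[of "Suc t"] by (cases "t = 0") auto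
  finally show "{x \<in> space M. ?S x = t} \<in> events" .
qed

end

section \<open>Asymptotics\<close>

context percolated_process begin

abbreviation root_fraction :: "'a \<Rightarrow> real" where
  "root_fraction x \<equiv> real (root_size x) / real n"

abbreviation second_fraction :: "'a \<Rightarrow> real" where
  "second_fraction x \<equiv> real (second_size x) / real n"

lemma fractions_measurable:
  "root_fraction \<in> borel_measurable M" "second_fraction \<in> borel_measurable M"
  by (rule borel_measurable_divide[OF root_cluster_size_measurable borel_measurable_const],
      rule borel_measurable_divide[OF second_cluster_size_measurable borel_measurable_const])

text \<open>
  Chebyshev's inequality, as \<open>p powr d\<close> is a lower bound of the mean of \<open>G / n\<close> and \<open>up\<close> bounds the sum of the
  second moments of \<open>G / n\<close> and \<open>S / n\<close>.
\<close>

theorem fraction_tail_bounds: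
  assumes n: "0 < n" and p: "0 < p" "p \<le> 1"
    and H: "supersolution (p\<^sup>2) (\<lambda>m. real (balls_at s s0 m)) H" "H n \<le> real n * h"
    and f: "supersolution 1 real f" "f n \<le> real n * d" "0 \<le> d"
    and L: "0 \<le> L" and \<eta>: "0 < \<eta>"
  defines "up \<equiv> h + 2 * (1 - p) * square_const"
  shows "\<P>(x in M. \<bar>root_fraction x - L\<bar> > \<eta>) \<le> (up - 2 * L * p powr d + L\<^sup>2) / \<eta>\<^sup>2"
    and "\<P>(x in M. \<bar>second_fraction x - 0\<bar> > \<eta>) \<le> (up - (p powr d)\<^sup>2) / \<eta>\<^sup>2"
proof -
  let ?g = root_fraction and ?t = second_fraction
  note gm = fractions_measurable(1) and tm = fractions_measurable(2)
  have le1: "AE x in M. ?g x \<le> 1 \<and> ?t x \<le> 1"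
    using AE_realised
  proof eventually_elim
    fix x assume "realised_tree b s s0 n (\<lambda>u. N u x)"
    then interpret R: realised_tree b s s0 n "\<lambda>u. N u x" by simp
    have "real (root_size x) \<le> real n"
      "real (second_size x) \<le> real n"
      using R.root_cluster_size_le R.second_cluster_size_le by simp_all
    then show "?g x \<le> 1 \<and> ?t x \<le> 1" using n by simp
  qed
  have pos: "0 \<le> ?g x" "0 \<le> ?t x" for x by simp_all
  have int: "integrable M ?g" "integrable M (\<lambda>x. (?g x)\<^sup>2)" "integrable M (\<lambda>x. (?t x)\<^sup>2)"
  proof -
    show "integrable M ?g"
      by (rule integrable_const_bound[where B = 1], use le1 in \<open>eventually_elim, simp\<close>, rule gm)
    have "AE x in M. norm ((?g x)\<^sup>2) \<le> 1"
      using le1 by eventually_elim (use pos in \<open>simp add: power_le_one\<close>)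
    then show "integrable M (\<lambda>x. (?g x)\<^sup>2)"
      by (rule integrable_const_bound) (intro borel_measurable_power gm)
    have "AE x in M. norm ((?t x)\<^sup>2) \<le> 1"
      using le1 by eventually_elim (use pos in \<open>simp add: power_le_one\<close>)
    then show "integrable M (\<lambda>x. (?t x)\<^sup>2)"
      by (rule integrable_const_bound) (intro borel_measurable_power tm)
  qed
  have lo: "p powr d \<le> expectation ?g"
  proof -
    have "ennreal (real n * p powr d)
        \<le> (\<integral>\<^sup>+x. ennreal (real (root_size x)) \<partial>M)"
      by (rule first_moment_ge[OF p f])
    also have "\<dots> = (\<integral>\<^sup>+x. ennreal (real n * ?g x) \<partial>M)" using n by simp
    also have "\<dots> = ennreal (expectation (\<lambda>x. real n * ?g x))"
      by (rule nn_integral_eq_integral[OF integrable_mult_right[OF int(1)]]) simp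
    finally have "real n * p powr d \<le> expectation (\<lambda>x. real n * ?g x)"
      by (subst (asm) ennreal_le_iff) (auto intro!: integral_nonneg_AE)
    also have "\<dots> = real n * expectation ?g" by (rule integral_mult_right_zero)
    finally show ?thesis by (rule mult_left_le_imp_le) (use n in simp)
  qed
  have up: "expectation (\<lambda>x. (?g x)\<^sup>2) + expectation (\<lambda>x. (?t x)\<^sup>2) \<le> up"
  proof -
    have "(\<integral>\<^sup>+x. ennreal ((real n)\<^sup>2 * ((?g x)\<^sup>2 + (?t x)\<^sup>2)) \<partial>M)
        = (\<integral>\<^sup>+x. ennreal ((real (root_size x))\<^sup>2
          + (real (second_size x))\<^sup>2) \<partial>M)"
      using n by (intro nn_integral_cong arg_cong[of _ _ ennreal]) (simp add: power_divide distrib_left)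
    also have "\<dots> \<le> ennreal (real n * H n + 2 * (1 - p) * (square_const * (real n)\<^sup>2))"
      by (rule second_moment_le[OF n p H(1)])
    also have "\<dots> \<le> ennreal ((real n)\<^sup>2 * up)"
    proof (rule ennreal_leI)
      have "real n * H n \<le> real n * (real n * h)" using H(2) by (intro mult_left_mono) auto
      then show "real n * H n + 2 * (1 - p) * (square_const * (real n)\<^sup>2) \<le> (real n)\<^sup>2 * up"
        by (simp add: up_def power2_eq_square algebra_simps)
    qed
    also have "(\<integral>\<^sup>+x. ennreal ((real n)\<^sup>2 * ((?g x)\<^sup>2 + (?t x)\<^sup>2)) \<partial>M)
        = ennreal (expectation (\<lambda>x. (real n)\<^sup>2 * ((?g x)\<^sup>2 + (?t x)\<^sup>2)))"
      using int by (intro nn_integral_eq_integral integrable_mult_right Bochner_Integration.integrable_add) auto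
    finally have le: "ennreal (expectation (\<lambda>x. (real n)\<^sup>2 * ((?g x)\<^sup>2 + (?t x)\<^sup>2))) \<le> ennreal ((real n)\<^sup>2 * up)" .
    have "0 \<le> up"
    proof -
      have "0 \<le> H n" using H(1) unfolding supersolution_def by (meson order_trans)
      then have "0 \<le> real n * h" using H(2) by linarith
      then have "0 \<le> h" using n by (simp add: zero_le_mult_iff)
      then show ?thesis using p square_const_ge_1 by (simp add: up_def)
    qed
    then have "expectation (\<lambda>x. (real n)\<^sup>2 * ((?g x)\<^sup>2 + (?t x)\<^sup>2)) \<le> (real n)\<^sup>2 * up"
      using le by (subst (asm) ennreal_le_iff) auto
    also have "expectation (\<lambda>x. (real n)\<^sup>2 * ((?g x)\<^sup>2 + (?t x)\<^sup>2))
        = (real n)\<^sup>2 * (expectation (\<lambda>x. (?g x)\<^sup>2) + expectation (\<lambda>x. (?t x)\<^sup>2))"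
      unfolding integral_mult_right_zero using int by (simp only: Bochner_Integration.integral_add)
    finally show ?thesis using n by simp
  qed
  have t2: "0 \<le> expectation (\<lambda>x. (?t x)\<^sup>2)" by (rule integral_nonneg_AE) simp
  have sq: "expectation (\<lambda>x. (?g x - a)\<^sup>2) = expectation (\<lambda>x. (?g x)\<^sup>2) - 2 * a * expectation ?g + a\<^sup>2" for a
  proof -
    have lin: "integrable M (\<lambda>x. 2 * a * ?g x)" by (rule integrable_mult_right[OF int(1)])
    have "expectation (\<lambda>x. (?g x - a)\<^sup>2) = expectation (\<lambda>x. (?g x)\<^sup>2 - 2 * a * ?g x + a\<^sup>2)"
      by (intro Bochner_Integration.integral_cong refl) (simp add: power2_eq_square algebra_simps)
    also have "\<dots> = expectation (\<lambda>x. (?g x)\<^sup>2 - 2 * a * ?g x) + expectation (\<lambda>x. a\<^sup>2)"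
      by (rule Bochner_Integration.integral_add[OF Bochner_Integration.integrable_diff[OF int(2) lin] integrable_const])
    also have "expectation (\<lambda>x. (?g x)\<^sup>2 - 2 * a * ?g x) = expectation (\<lambda>x. (?g x)\<^sup>2) - expectation (\<lambda>x. 2 * a * ?g x)"
      by (rule Bochner_Integration.integral_diff[OF int(2) lin])
    also have "expectation (\<lambda>x. 2 * a * ?g x) = 2 * a * expectation ?g" by (rule integral_mult_right_zero)
    also have "expectation (\<lambda>x. a\<^sup>2) = a\<^sup>2" by (simp add: prob_space)
    finally show ?thesis .
  qed
  have intsq: "integrable M (\<lambda>x. (?g x - L)\<^sup>2)"
  proof -
    have "integrable M (\<lambda>x. (?g x)\<^sup>2 - 2 * L * ?g x + L\<^sup>2)"
      by (intro Bochner_Integration.integrable_add Bochner_Integration.integrable_diff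
            integrable_mult_right integrable_const int)
    moreover have "(\<lambda>x. (?g x)\<^sup>2 - 2 * L * ?g x + L\<^sup>2) = (\<lambda>x. (?g x - L)\<^sup>2)"
      by (simp add: fun_eq_iff power2_eq_square algebra_simps)
    ultimately show ?thesis by simp
  qed
  have "\<P>(x in M. \<bar>?g x - L\<bar> > \<eta>) \<le> measure M {x \<in> space M. \<bar>?g x - L\<bar> \<ge> \<eta>}"
    by (intro finite_measure_mono) (use gm in \<open>auto intro!: borel_measurable_le\<close>)
  also have "\<dots> \<le> expectation (\<lambda>x. (?g x - L)\<^sup>2) / \<eta>\<^sup>2"
    by (rule second_moment_method[OF _ intsq \<eta>]) (intro borel_measurable_diff gm borel_measurable_const)
  also have "\<dots> \<le> (up - 2 * L * p powr d + L\<^sup>2) / \<eta>\<^sup>2"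
  proof (rule divide_right_mono)
    have "2 * L * p powr d \<le> 2 * L * expectation ?g" using lo L by (intro mult_left_mono) auto
    then show "expectation (\<lambda>x. (?g x - L)\<^sup>2) \<le> up - 2 * L * p powr d + L\<^sup>2"
      unfolding sq using up t2 by linarith
  qed simp
  finally show "\<P>(x in M. \<bar>root_fraction x - L\<bar> > \<eta>) \<le> (up - 2 * L * p powr d + L\<^sup>2) / \<eta>\<^sup>2" .
  have "0 \<le> expectation (\<lambda>x. (?g x - expectation ?g)\<^sup>2)" by (rule integral_nonneg_AE) simp
  then have var: "(expectation ?g)\<^sup>2 \<le> expectation (\<lambda>x. (?g x)\<^sup>2)"
    unfolding sq by (simp add: power2_eq_square)
  have "(p powr d)\<^sup>2 \<le> (expectation ?g)\<^sup>2" using lo by (intro power_mono) auto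
  with var up have E2: "expectation (\<lambda>x. (?t x)\<^sup>2) \<le> up - (p powr d)\<^sup>2" by linarith
  have "\<P>(x in M. \<bar>?t x - 0\<bar> > \<eta>) \<le> measure M {x \<in> space M. \<bar>?t x\<bar> \<ge> \<eta>}"
    by (intro finite_measure_mono) (use tm in \<open>auto intro!: borel_measurable_le\<close>)
  also have "\<dots> \<le> expectation (\<lambda>x. (?t x)\<^sup>2) / \<eta>\<^sup>2"
    by (rule second_moment_method[OF tm int(3) \<eta>])
  also have "\<dots> \<le> (up - (p powr d)\<^sup>2) / \<eta>\<^sup>2" by (rule divide_right_mono[OF E2]) simp
  finally show "\<P>(x in M. \<bar>second_fraction x - 0\<bar> > \<eta>) \<le> (up - (p powr d)\<^sup>2) / \<eta>\<^sup>2" .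
qed

end

lemma percolation_power_limit:
  fixes c a B :: real assumes "c > 0" "a > 0"
  shows "((\<lambda>x. (1 - c / x) powr (a * x + B)) \<longlongrightarrow> exp (- c * a)) at_top"
  using assms by real_asymp

text \<open>
  With \<open>x = ln n\<close> this is the gap between \<open>1\<close> and the factor by which one generation multiplies
  \<open>m powr (1 - \<delta>)\<close>, where \<open>\<delta> \<mu> = (1 - e) 2 c / x\<close>.
\<close>

lemma percolation_gap_limit:
  fixes c e B :: real assumes "c > 0" "e > 0"
  shows "((\<lambda>x. x * (1 - (1 - c / x)\<^sup>2 * (1 + (1 - e) * 2 * c / x + B / x\<^sup>2))) \<longlongrightarrow> 2 * c * e) at_top"
proof -
  have "((\<lambda>x. x * (1 - (1 - c / x)\<^sup>2 * (1 + (1 - e) * 2 * c / x + B / x\<^sup>2)))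
      \<longlongrightarrow> c * 2 - (2 - e * 2) * c) at_top"
    using assms by real_asymp
  also have "c * 2 - (2 - e * 2) * c = 2 * c * e" by (simp add: algebra_simps)
  finally show ?thesis .
qed

lemma log_power_limit:
  fixes a :: real assumes "a > 0"
  shows "((\<lambda>x. (x ^ 4) powr (a / x)) \<longlongrightarrow> 1) at_top"
  using assms by real_asymp

lemma ln_real_at_top: "filterlim (\<lambda>n. ln (real n)) at_top sequentially"
  by real_asymp

context nondegenerate_split begin

lemma lower_rate:
  assumes c: "0 < c" and e: "0 < e"
  obtains f d where "supersolution 1 real f" "\<forall>n. 0 \<le> d n \<and> f n \<le> real n * d n"
    "(\<lambda>n. (1 - c / ln (real n)) powr d n) \<longlonglongrightarrow> exp (- c * (1 + e) / split_mu b \<nu>)"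
proof -
  define a where "a = (1 + e) / split_mu b \<nu>"
  have a: "0 < a" using e split_mu_pos by (simp add: a_def)
  obtain K :: nat where ss: "supersolution 1 real (\<lambda>m. a * (real m * ln (real m))
        + square_const * min ((real m)\<^sup>2) (real K * real m))"
    using supersolution_path_length[OF e] unfolding a_def by blast
  define d where "d = (\<lambda>n. a * ln (real n) + square_const * real K)"
  have dpos: "0 \<le> d n" for n
  proof -
    have "0 \<le> ln (real n)" by (cases n) auto
    then show ?thesis using a square_const_ge_1 by (simp add: d_def)
  qed
  have le: "a * (real n * ln (real n)) + square_const * min ((real n)\<^sup>2) (real K * real n) \<le> real n * d n" for n
  proof -
    have "square_const * min ((real n)\<^sup>2) (real K * real n) \<le> square_const * (real K * real n)"
      using square_const_ge_1 by (intro mult_left_mono) auto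
    then show ?thesis by (simp add: d_def algebra_simps)
  qed
  have "((\<lambda>x. (1 - c / x) powr (a * x + square_const * real K)) \<longlongrightarrow> exp (- c * a)) at_top"
    by (rule percolation_power_limit[OF c a])
  then have "(\<lambda>n. (1 - c / ln (real n)) powr d n) \<longlonglongrightarrow> exp (- c * a)"
    unfolding d_def by (rule filterlim_compose[OF _ ln_real_at_top])
  then have "(\<lambda>n. (1 - c / ln (real n)) powr d n) \<longlonglongrightarrow> exp (- c * (1 + e) / split_mu b \<nu>)"
    by (simp add: a_def)
  then show ?thesis using that[OF ss, of d] dpos le by blast
qed

text \<open>
  The exponent \<open>\<delta> = a / ln n\<close> is a factor \<open>1 - e\<close> below the critical one, which leaves a gap of order
  \<open>1 / ln n\<close>. The threshold \<open>K = (ln n) ^ 4\<close> is so large that \<open>K powr (1 - \<delta>) \<ge> (ln n)\<^sup>2\<close> times this gap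
  exceeds any constant, while \<open>K powr \<delta>\<close> still tends to \<open>1\<close>.
\<close>

lemma upper_rate:
  assumes c: "0 < c" and e: "0 < e" "e < 1"
  obtains H h where
    "\<forall>\<^sub>F n in sequentially. supersolution ((1 - c / ln (real n))\<^sup>2) (\<lambda>m. real (balls_at s s0 m)) (H n)
       \<and> H n n \<le> real n * h n"
    "h \<longlonglongrightarrow> exp (- 2 * c * (1 - e) / split_mu b \<nu>)"
proof -
  define \<mu> where "\<mu> = split_mu b \<nu>"
  have mu: "0 < \<mu>" using split_mu_pos by (simp add: \<mu>_def)
  define a where "a = (1 - e) * 2 * c / \<mu>"
  have a: "0 < a" using c e mu by (simp add: a_def)
  define B where "B = 8 * real b * a\<^sup>2"
  define r where "r = (\<lambda>x. x * (1 - (1 - c / x)\<^sup>2 * (1 + (1 - e) * 2 * c / x + B / x\<^sup>2)))"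
  define H where "H = (\<lambda>n m. min (real m) ((ln (real n) ^ 4) powr (a / ln (real n)) * real m powr (1 - a / ln (real n))))"
  define h where "h = (\<lambda>n. (ln (real n) ^ 4) powr (a / ln (real n)) * exp (- a))"
  have "(r \<longlongrightarrow> 2 * c * e) at_top"
    unfolding r_def by (rule percolation_gap_limit[OF c e(1)])
  \<comment> \<open>half of the limiting gap is kept\<close>
  moreover have "c * e < 2 * c * e" using c e by simp
  ultimately have "\<forall>\<^sub>F x in at_top. c * e < r x" by (rule order_tendstoD)
  moreover have "\<forall>\<^sub>F x in at_top. c < x \<and> 2 * a < x \<and> 1 < x \<and> real s < x \<and>
      (real s0 + real b * real s1) / (c * e) < x"
    by (intro eventually_conj eventually_gt_at_top)
  ultimately have large: "\<forall>\<^sub>F x in at_top. c * e < r x \<and> c < x \<and> 2 * a < x \<and> 1 < x \<and> real s < x \<and>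
      (real s0 + real b * real s1) / (c * e) < x"
    by (rule eventually_conj)
  have "\<forall>\<^sub>F n in sequentially. supersolution ((1 - c / ln (real n))\<^sup>2) (\<lambda>m. real (balls_at s s0 m)) (H n)
       \<and> H n n \<le> real n * h n"
    using eventually_compose_filterlim[OF large ln_real_at_top] eventually_gt_at_top[of 0]
  proof eventually_elim
    fix n :: nat
    define x where "x = ln (real n)"
    define q where "q = (1 - c / x)\<^sup>2"
    define dl where "dl = a / x"
    assume "c * e < r (ln (real n)) \<and> c < ln (real n) \<and> 2 * a < ln (real n) \<and> 1 < ln (real n) \<and>
      real s < ln (real n) \<and> (real s0 + real b * real s1) / (c * e) < ln (real n)" and n: "0 < n"
    then have rx: "c * e < r x" and x: "c < x" "2 * a < x" "1 < x" "real s < x"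
      and x4: "(real s0 + real b * real s1) / (c * e) < x" unfolding x_def by blast+
    have q: "0 \<le> q" "q \<le> 1"
      using x c by (auto simp: q_def power_le_one)
    have dl: "0 \<le> dl" "dl < 1" "dl \<le> 1 / 2" using x a by (auto simp: dl_def field_simps)
    have x4_ge: "x \<le> x ^ 4" using x power_increasing[of 1 4 x] by simp
    have "dl * \<mu> = (1 - e) * 2 * c / x" using mu by (simp add: dl_def a_def)
    moreover have "8 * real b * dl\<^sup>2 = B / x\<^sup>2" by (simp add: dl_def B_def power_divide)
    ultimately have "powr_moment (1 - dl) \<le> 1 + (1 - e) * 2 * c / x + B / x\<^sup>2"
      using powr_moment_le[OF dl(1) dl(3)] by (simp add: \<mu>_def)
    then have "q * powr_moment (1 - dl) \<le> q * (1 + (1 - e) * 2 * c / x + B / x\<^sup>2)"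
      using q by (intro mult_left_mono)
    then have "x * (1 - q * (1 + (1 - e) * 2 * c / x + B / x\<^sup>2)) \<le> x * (1 - q * powr_moment (1 - dl))"
      using x by (intro mult_left_mono) auto
    then have "c * e \<le> x * (1 - q * powr_moment (1 - dl))" using rx by (simp add: r_def q_def)
    then have gap: "c * e / x \<le> 1 - q * powr_moment (1 - dl)" using x by (simp add: field_simps)
    have gap0: "0 \<le> c * e / x" using c e x by simp
    have "real s0 + real b * real s1 \<le> x * (c * e)" using x4 c e by (simp add: field_simps)
    also have "\<dots> = x\<^sup>2 * (c * e / x)" using x by (simp add: power2_eq_square)
    also have "x\<^sup>2 = (x ^ 4) powr (1 / 2)"
    proof -
      have "x ^ 4 = (x\<^sup>2)\<^sup>2" by (simp flip: power_mult)
      then have "(x ^ 4) powr (1 / 2) = sqrt ((x\<^sup>2)\<^sup>2)" by (simp only: powr_half_sqrt zero_le_power2)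
      also have "\<dots> = x\<^sup>2" by (simp only: real_sqrt_abs abs_power2)
      finally show ?thesis ..
    qed
    also have "\<dots> * (c * e / x) \<le> (x ^ 4) powr (1 - dl) * (1 - q * powr_moment (1 - dl))"
      using gap gap0 dl x x4_ge by (intro mult_mono powr_mono) auto
    finally have g: "real s0 + real b * real s1 \<le> (x ^ 4) powr (1 - dl) * (1 - q * powr_moment (1 - dl))" .
    have "supersolution q (\<lambda>m. real (balls_at s s0 m))
       (\<lambda>m. min (real m) ((x ^ 4) powr dl * real m powr (1 - dl)))"
      using q dl(1,2) x x4_ge gap gap0 g by (intro supersolution_powr) auto
    moreover have "H n n \<le> real n * h n"
    proof -
      have "H n n \<le> (x ^ 4) powr dl * real n powr (1 - dl)" by (simp add: H_def x_def dl_def)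
      also have "real n powr (1 - dl) = exp (ln (real n) + - (dl * x))"
        using n by (simp add: powr_def x_def algebra_simps)
      also have "\<dots> = real n * exp (- (dl * x))" using n by (simp only: exp_add) simp
      also have "dl * x = a" using x by (simp add: dl_def)
      finally show ?thesis by (simp add: h_def x_def dl_def mult_ac)
    qed
    ultimately show "supersolution ((1 - c / ln (real n))\<^sup>2) (\<lambda>m. real (balls_at s s0 m)) (H n)
       \<and> H n n \<le> real n * h n" unfolding H_def q_def dl_def x_def by blast
  qed
  moreover have "h \<longlonglongrightarrow> 1 * exp (- a)"
    unfolding h_def
    by (intro tendsto_mult tendsto_const filterlim_compose[OF log_power_limit[OF a] ln_real_at_top])
  then have "h \<longlonglongrightarrow> exp (- 2 * c * (1 - e) / split_mu b \<nu>)"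
    by (simp add: a_def \<mu>_def mult_ac)
  ultimately show ?thesis by (rule that)
qed

end

lemma tendsto_0_if_bounded_by_small_limits:
  fixes f :: "nat \<Rightarrow> real" and y :: "real \<Rightarrow> real"
  assumes nn: "\<And>n. 0 \<le> f n"
    and bound: "\<And>e. 0 < e \<Longrightarrow> e < 1 \<Longrightarrow> \<exists>h. h \<longlonglongrightarrow> y e \<and> (\<forall>\<^sub>F n in sequentially. f n \<le> h n)"
    and y: "(y \<longlongrightarrow> 0) (at_right 0)"
  shows "f \<longlonglongrightarrow> 0"
proof (rule order_tendstoI)
  fix a :: real assume "0 < a"
  then have "\<forall>\<^sub>F e in at_right 0. y e < a" by (rule order_tendstoD(2)[OF y])
  moreover have "\<forall>\<^sub>F e in at_right (0::real). e \<in> {0<..<1}" by (rule eventually_at_right_real) simp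
  ultimately have "\<forall>\<^sub>F e in at_right 0. y e < a \<and> e \<in> {0<..<1}" by (rule eventually_conj)
  then obtain e where e: "y e < a" "0 < e" "e < 1"
    using eventually_happens[of _ "at_right (0::real)"] by force
  obtain h where h: "h \<longlonglongrightarrow> y e" "\<forall>\<^sub>F n in sequentially. f n \<le> h n"
    using bound[OF e(2,3)] by blast
  have "\<forall>\<^sub>F n in sequentially. h n < a" by (rule order_tendstoD(2)[OF h(1) e(1)])
  then show "\<forall>\<^sub>F n in sequentially. f n < a" using h(2) by eventually_elim simp
next
  fix a :: real assume "a < 0"
  then show "\<forall>\<^sub>F n in sequentially. a < f n" using nn by (intro always_eventually allI) (meson less_le_trans)
qed

text \<open>
  The tail bounds hold for every \<open>e\<close> with limits that vanish as \<open>e\<close> tends to \<open>0\<close>.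
\<close>

theorem lemma2:
  fixes b s s0 s1 :: nat and \<nu> :: "(nat \<Rightarrow> real) measure" and c :: real
    and M :: "nat \<Rightarrow> 'a measure"
    and V :: "nat \<Rightarrow> nat list \<Rightarrow> 'a \<Rightarrow> nat \<Rightarrow> real"
    and N :: "nat \<Rightarrow> nat list \<Rightarrow> 'a \<Rightarrow> nat"
    and E :: "nat \<Rightarrow> nat list \<Rightarrow> 'a \<Rightarrow> bool"
  assumes "split_parameters b s s0 s1 \<nu>"
    and "\<P>(v in \<nu>. v 0 = 1) = 0" and "\<P>(v in \<nu>. v 0 = 0) = 0"
    and "c > 0"
    and "\<forall>\<^sub>F n in sequentially.
           percolated_split_tree (M n) b s s0 s1 \<nu> n (V n) (N n) (1 - c / ln (real n)) (E n)"
  shows "tendsto_in_probability M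
           (\<lambda>n x. real (root_cluster_size b s s0 (\<lambda>u. N n u x) (\<lambda>u. E n u x)) / real n)
           (exp (- c / split_mu b \<nu>))
       \<and> tendsto_in_probability M
           (\<lambda>n x. real (second_cluster_size b s s0 (\<lambda>u. N n u x) (\<lambda>u. E n u x)) / real n)
           0"
proof -
  interpret S: split_parameters b s s0 s1 \<nu> by (rule assms(1))
  interpret P\<nu>: prob_space \<nu> by (rule S.prob_space_split)
  have "(\<lambda>v. v 0) \<in> borel_measurable \<nu>"
    using S.b_ge_2
    by (subst measurable_cong_sets[OF S.sets_split refl]) (rule measurable_component_singleton, simp)
  then have ev: "{v \<in> space \<nu>. v 0 = a} \<in> sets \<nu>" for a :: real
    using measurable_sets[of "\<lambda>v. v 0" \<nu> borel "{a}"] by (simp add: vimage_def Int_def conj_commute)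
  interpret D: nondegenerate_split b s s0 s1 \<nu>
  proof
    show "AE v in \<nu>. v 0 \<noteq> 0" using assms(3) unfolding P\<nu>.prob_Collect_eq_0[OF ev] .
    show "AE v in \<nu>. v 0 \<noteq> 1" using assms(2) unfolding P\<nu>.prob_Collect_eq_0[OF ev] .
  qed
  define \<mu> where "\<mu> = split_mu b \<nu>"
  have mu: "0 < \<mu>" using D.split_mu_pos by (simp add: \<mu>_def)
  define L where "L = exp (- c / \<mu>)"
  define p where "p = (\<lambda>n. 1 - c / ln (real n))"
  let ?G = "\<lambda>n x. real (root_cluster_size b s s0 (\<lambda>u. N n u x) (\<lambda>u. E n u x)) / real n"
  let ?S = "\<lambda>n x. real (second_cluster_size b s s0 (\<lambda>u. N n u x) (\<lambda>u. E n u x)) / real n"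
  let ?PG = "\<lambda>n \<eta>. \<P>(x in M n. \<bar>?G n x - L\<bar> > \<eta>)"
  let ?PS = "\<lambda>n \<eta>. \<P>(x in M n. \<bar>?S n x - 0\<bar> > \<eta>)"
  have proc: "\<forall>\<^sub>F n in sequentially. percolated_process b s s0 s1 \<nu> (M n) n (V n) (N n) (p n) (E n)"
    using assms(5)
  proof eventually_elim
    fix n assume P: "percolated_split_tree (M n) b s s0 s1 \<nu> n (V n) (N n) (1 - c / ln (real n)) (E n)"
    then interpret percolated_split_tree "M n" b s s0 s1 \<nu> n "V n" "N n" "1 - c / ln (real n)" "E n" .
    show "percolated_process b s s0 s1 \<nu> (M n) n (V n) (N n) (p n) (E n)"
      unfolding p_def by unfold_locales
  qed
  have prange: "\<forall>\<^sub>F n in sequentially. 0 < n \<and> 0 < p n \<and> p n \<le> 1"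
  proof -
    have "\<forall>\<^sub>F x in at_top. c < x" by (rule eventually_gt_at_top)
    from eventually_compose_filterlim[OF this ln_real_at_top] eventually_gt_at_top[of 0]
    show ?thesis
    proof eventually_elim
      fix n :: nat assume "c < ln (real n)" "0 < n"
      moreover from this have "c / ln (real n) < 1" "0 \<le> c / ln (real n)"
        using assms(4) by (simp_all add: divide_less_eq)
      ultimately show "0 < n \<and> 0 < p n \<and> p n \<le> 1" by (simp add: p_def)
    qed
  qed
  have plim: "p \<longlonglongrightarrow> 1"
  proof -
    have "((\<lambda>x. 1 - c / x) \<longlongrightarrow> 1) at_top" by real_asymp
    then show ?thesis unfolding p_def by (rule filterlim_compose[OF _ ln_real_at_top])
  qed
  have rate: "\<exists>lo up. lo \<longlonglongrightarrow> exp (- c * (1 + e) / \<mu>) \<and> up \<longlonglongrightarrow> exp (- 2 * c * (1 - e) / \<mu>) \<and>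
      (\<forall>\<^sub>F n in sequentially. \<forall>\<eta>>0.
         ?PG n \<eta> \<le> (up n - 2 * L * lo n + L\<^sup>2) / \<eta>\<^sup>2 \<and>
         ?PS n \<eta> \<le> (up n - (lo n)\<^sup>2) / \<eta>\<^sup>2)"
    if e: "0 < e" "e < 1" for e
  proof -
    obtain f d where f: "D.supersolution 1 real f" "\<forall>n. 0 \<le> d n \<and> f n \<le> real n * d n"
      and lo: "(\<lambda>n. (1 - c / ln (real n)) powr d n) \<longlonglongrightarrow> exp (- c * (1 + e) / split_mu b \<nu>)"
      by (rule D.lower_rate[OF assms(4) e(1)])
    obtain H h where H: "\<forall>\<^sub>F n in sequentially.
          D.supersolution ((1 - c / ln (real n))\<^sup>2) (\<lambda>m. real (balls_at s s0 m)) (H n) \<and> H n n \<le> real n * h n"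
      and h: "h \<longlonglongrightarrow> exp (- 2 * c * (1 - e) / split_mu b \<nu>)"
      by (rule D.upper_rate[OF assms(4) e])
    define up where "up = (\<lambda>n. h n + 2 * (1 - p n) * D.square_const)"
    have "up \<longlonglongrightarrow> exp (- 2 * c * (1 - e) / split_mu b \<nu>) + 2 * (1 - 1) * D.square_const"
      unfolding up_def by (intro tendsto_intros h plim)
    then have up: "up \<longlonglongrightarrow> exp (- 2 * c * (1 - e) / \<mu>)" by (simp add: \<mu>_def)
    have "\<forall>\<^sub>F n in sequentially. \<forall>\<eta>>0.
         ?PG n \<eta> \<le> (up n - 2 * L * p n powr d n + L\<^sup>2) / \<eta>\<^sup>2 \<and>
         ?PS n \<eta> \<le> (up n - (p n powr d n)\<^sup>2) / \<eta>\<^sup>2"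
      using proc prange H
    proof eventually_elim
      fix n assume proc: "percolated_process b s s0 s1 \<nu> (M n) n (V n) (N n) (p n) (E n)"
        and pr: "0 < n \<and> 0 < p n \<and> p n \<le> 1"
        and "D.supersolution ((1 - c / ln (real n))\<^sup>2) (\<lambda>m. real (balls_at s s0 m)) (H n)
          \<and> H n n \<le> real n * h n"
      then have Hn: "D.supersolution ((p n)\<^sup>2) (\<lambda>m. real (balls_at s s0 m)) (H n)" "H n n \<le> real n * h n"
        by (simp_all add: p_def)
      interpret R: percolated_process b s s0 s1 \<nu> "M n" n "V n" "N n" "p n" "E n" by (rule proc)
      have L0: "0 \<le> L" by (simp add: L_def)
      show "\<forall>\<eta>>0.
         ?PG n \<eta> \<le> (up n - 2 * L * p n powr d n + L\<^sup>2) / \<eta>\<^sup>2 \<and>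
         ?PS n \<eta> \<le> (up n - (p n powr d n)\<^sup>2) / \<eta>\<^sup>2"
        using R.fraction_tail_bounds[OF _ _ _ Hn f(1) _ _ L0] pr f(2) unfolding up_def by blast
    qed
    moreover have "(\<lambda>n. p n powr d n) \<longlonglongrightarrow> exp (- c * (1 + e) / \<mu>)"
      using lo by (simp add: p_def \<mu>_def)
    ultimately show ?thesis using up by blast
  qed
  have LL: "exp (- 2 * c / \<mu>) = L\<^sup>2" "exp (- c / \<mu>) = L"
    by (simp_all add: L_def power2_eq_square flip: exp_add)
  have y1: "((\<lambda>e. exp (- c * (1 + e) / \<mu>)) \<longlongrightarrow> L) (at_right 0)"
  proof -
    have "((\<lambda>e. exp (- c * (1 + e) / \<mu>)) \<longlongrightarrow> exp (- c * (1 + 0) / \<mu>)) (at_right 0)"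
      using mu by (intro tendsto_intros) auto
    then show ?thesis by (simp add: L_def)
  qed
  have y2: "((\<lambda>e. exp (- 2 * c * (1 - e) / \<mu>)) \<longlongrightarrow> L\<^sup>2) (at_right 0)"
  proof -
    have "((\<lambda>e. exp (- 2 * c * (1 - e) / \<mu>)) \<longlongrightarrow> exp (- 2 * c * (1 - 0) / \<mu>)) (at_right 0)"
      using mu by (intro tendsto_intros) auto
    then show ?thesis using LL by simp
  qed
  have limG: "(\<lambda>n. ?PG n \<eta>) \<longlonglongrightarrow> 0" if \<eta>: "0 < \<eta>" for \<eta>
  proof (rule tendsto_0_if_bounded_by_small_limits)
    let ?y = "\<lambda>e. (exp (- 2 * c * (1 - e) / \<mu>) - 2 * L * exp (- c * (1 + e) / \<mu>) + L\<^sup>2) / \<eta>\<^sup>2"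
    have "(?y \<longlongrightarrow> (L\<^sup>2 - 2 * L * L + L\<^sup>2) / \<eta>\<^sup>2) (at_right 0)"
      using \<eta> by (intro tendsto_intros y1 y2) auto
    then show "(?y \<longlongrightarrow> 0) (at_right 0)" by (simp add: power2_eq_square)
    fix e :: real assume e: "0 < e" "e < 1"
    obtain lo up where lo: "lo \<longlonglongrightarrow> exp (- c * (1 + e) / \<mu>)" and up: "up \<longlonglongrightarrow> exp (- 2 * c * (1 - e) / \<mu>)"
      and bd: "\<forall>\<^sub>F n in sequentially. \<forall>\<eta>>0.
         ?PG n \<eta> \<le> (up n - 2 * L * lo n + L\<^sup>2) / \<eta>\<^sup>2 \<and>
         ?PS n \<eta> \<le> (up n - (lo n)\<^sup>2) / \<eta>\<^sup>2"
      using rate[OF e] by blast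
    have "(\<lambda>n. (up n - 2 * L * lo n + L\<^sup>2) / \<eta>\<^sup>2) \<longlonglongrightarrow> ?y e"
      using \<eta> by (intro tendsto_intros lo up) auto
    moreover have "\<forall>\<^sub>F n in sequentially. ?PG n \<eta> \<le> (up n - 2 * L * lo n + L\<^sup>2) / \<eta>\<^sup>2"
      using bd by eventually_elim (use \<eta> in blast)
    ultimately show "\<exists>h. h \<longlonglongrightarrow> ?y e \<and> (\<forall>\<^sub>F n in sequentially. ?PG n \<eta> \<le> h n)"
      by blast
  qed simp
  have limS: "(\<lambda>n. ?PS n \<eta>) \<longlonglongrightarrow> 0" if \<eta>: "0 < \<eta>" for \<eta>
  proof (rule tendsto_0_if_bounded_by_small_limits)
    let ?y = "\<lambda>e. (exp (- 2 * c * (1 - e) / \<mu>) - (exp (- c * (1 + e) / \<mu>))\<^sup>2) / \<eta>\<^sup>2"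
    have "(?y \<longlongrightarrow> (L\<^sup>2 - L\<^sup>2) / \<eta>\<^sup>2) (at_right 0)"
      using \<eta> by (intro tendsto_intros y1 y2) auto
    then show "(?y \<longlongrightarrow> 0) (at_right 0)" by simp
    fix e :: real assume e: "0 < e" "e < 1"
    obtain lo up where lo: "lo \<longlonglongrightarrow> exp (- c * (1 + e) / \<mu>)" and up: "up \<longlonglongrightarrow> exp (- 2 * c * (1 - e) / \<mu>)"
      and bd: "\<forall>\<^sub>F n in sequentially. \<forall>\<eta>>0.
         ?PG n \<eta> \<le> (up n - 2 * L * lo n + L\<^sup>2) / \<eta>\<^sup>2 \<and>
         ?PS n \<eta> \<le> (up n - (lo n)\<^sup>2) / \<eta>\<^sup>2"
      using rate[OF e] by blast
    have "(\<lambda>n. (up n - (lo n)\<^sup>2) / \<eta>\<^sup>2) \<longlonglongrightarrow> ?y e"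
      using \<eta> by (intro tendsto_intros lo up) auto
    moreover have "\<forall>\<^sub>F n in sequentially. ?PS n \<eta> \<le> (up n - (lo n)\<^sup>2) / \<eta>\<^sup>2"
      using bd by eventually_elim (use \<eta> in blast)
    ultimately show "\<exists>h. h \<longlonglongrightarrow> ?y e \<and> (\<forall>\<^sub>F n in sequentially. ?PS n \<eta> \<le> h n)"
      by blast
  qed simp
  have measG: "\<forall>\<^sub>F n in sequentially. ?G n \<in> borel_measurable (M n)"
    using proc by eventually_elim (rule percolated_process.fractions_measurable(1))
  have measS: "\<forall>\<^sub>F n in sequentially. ?S n \<in> borel_measurable (M n)"
    using proc by eventually_elim (rule percolated_process.fractions_measurable(2))
  show ?thesis
    unfolding tendsto_in_probability_def
    using measG measS limG limS unfolding L_def \<mu>_def by blast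
qed

end
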